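(* For every integer $n\ge 0$, \[ N^{0}(0,8;8n+r)=N^{0}(4,8;8n+r)\quad (r\in\{5,7\}),\qquad N^{0}(1,8;8n+r)=N^{0}(3,8;8n+r)\quad (r\in\{4,6\}). \]
   Context: An odd Durfee symbol of a positive integer $n$ consists of a nonnegative integer $D$ together with two (possibly empty) non-increasing sequences of odd positive integers $a_1\ge\cdots\ge a_s$ (top row) and $b_1\ge\cdots\ge b_t$ (bottom row), all entries at most $2D+1$, such that $n=\sum a_i+\sum b_j+2D^2+2D+1$. Its odd rank is $s-t$. For integers $a$ and $M\ge1$, $N^{0}(a,M;n)$ is the number of odd Durfee symbols of $n$ whose odd rank is congruent to $a$ modulo $M$ (and $N^0(a,M;0)=0$). *)

theory Defs
  imports Complex_Main "HOL-Number_Theory.Cong"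
begin

text \<open>A triple \<open>(D, as, bs)\<close> stands for the symbol with subscript \<open>D\<close>, top row \<open>as\<close> and
  bottom row \<open>bs\<close>. Entries are natural numbers, so odd entries are positive.\<close>

type_synonym odd_durfee = "nat \<times> nat list \<times> nat list"

definition odd_durfee_row :: "nat \<Rightarrow> nat list \<Rightarrow> bool" where
  "odd_durfee_row D xs \<longleftrightarrow> sorted_wrt (\<ge>) xs \<and> (\<forall>x\<in>set xs. odd x \<and> x \<le> 2 * D + 1)"

definition odd_durfee_symbols :: "nat \<Rightarrow> odd_durfee set" where
  "odd_durfee_symbols n = {(D, as, bs). odd_durfee_row D as \<and> odd_durfee_row D bs \<and>
     n = sum_list as + sum_list bs + 2 * D\<^sup>2 + 2 * D + 1}"

fun odd_rank :: "odd_durfee \<Rightarrow> int" where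
  "odd_rank (D, as, bs) = int (length as) - int (length bs)"

definition N0 :: "int \<Rightarrow> nat \<Rightarrow> nat \<Rightarrow> nat" where
  "N0 a M n = card {\<sigma> \<in> odd_durfee_symbols n. [odd_rank \<sigma> = a] (mod int M)}"

lemma odd_durfee_row_length: "odd_durfee_row D xs \<Longrightarrow> length xs \<le> sum_list xs"
proof -
  assume "odd_durfee_row D xs"
  then have "\<forall>x\<in>set xs. 1 \<le> x"
    unfolding odd_durfee_row_def by (metis One_nat_def Suc_leI odd_pos)
  then show ?thesis by (induction xs) auto
qed

text \<open>Finiteness ensures that \<open>card\<close> in the definition of \<open>N0\<close> is a genuine count.\<close>

lemma finite_odd_durfee_symbols: "finite (odd_durfee_symbols n)"
proof (rule finite_subset)
  let ?L = "{xs. set xs \<subseteq> {..n} \<and> length xs \<le> n}"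
  show "odd_durfee_symbols n \<subseteq> {..n} \<times> ?L \<times> ?L"
    unfolding odd_durfee_symbols_def
    by (auto dest!: odd_durfee_row_length member_le_sum_list)
  show "finite ({..n} \<times> ?L \<times> ?L)"
    by (intro finite_cartesian_product finite_lists_length_le) auto
qed

lemma N0_zero: "N0 a M 0 = 0"
  by (simp add: N0_def odd_durfee_symbols_def)

end

theory Submission
  imports Defs "HOL-Analysis.Analysis"
begin

text \<open>
  Let \<open>z\<close> be a primitive eighth root of unity and let \<open>c n\<close> be the sum of \<open>z\<close> to the power of the odd rank over all
  odd Durfee symbols of \<open>n\<close>. The rank of a symbol of \<open>n\<close> has the parity of \<open>n + 1\<close>, and interchanging the rows changes
  its sign, so both claims follow once \<open>c n = 0\<close> whenever \<open>n mod 8 \<in> {4, 5, 6, 7}\<close>.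

  By partial fractions and the Durfee square identity, with \<open>q = Q\<^sup>2\<close>, the generating function of \<open>c\<close> is
  \<open>Q / (q; q)\<close> times the Appell sum over all integers \<open>n\<close> of
  \<open>(- 1) ^ n * q ^ (3 * n * (n + 1) / 2) / (1 - z * Q * q ^ n)\<close>. Separating residues of \<open>n\<close> modulo 4 and applying the
  partial fraction expansion of the reciprocal of a product of three theta functions of nome \<open>q ^ 16\<close> replaces this sum
  by Appell sums in powers of \<open>q ^ 4\<close> and theta quotients in \<open>a = theta (- q ^ 6)\<close> and \<open>b = theta (- q\<^sup>2)\<close>. Since
  \<open>a - q b\<close> and \<open>a + q b\<close> are theta functions of nome \<open>q ^ 4\<close>, the factor \<open>(q; q)\<close> cancels, and the only remaining
  function that is not a series in \<open>q ^ 4\<close> is the sum of \<open>q\<close> to all squares, whose exponents are 0 or 1 modulo 4. Hence the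
  generating function of \<open>c\<close> has exponents 0, 1, 2, 3 modulo 8 only.
\<close>

section \<open>Infinite q-products\<close>

text \<open>The factor 3 in the quadratic exponent is why products of three theta functions fit:
  each theta contributes one \<open>tri\<close> to the residues at its poles. As
  \<open>z ^ 4 = - 1\<close>, the denominator \<open>1 - z * Q * q ^ n\<close> divides
  \<open>1 + q ^ (4 * n + 2)\<close>, which removes \<open>z\<close> from the denominators; for
  \<open>n = 4 * k + r\<close> the poles belong to the point \<open>- (q ^ (4 * r + 2))\<close> in
  nome \<open>q ^ 16\<close>. An expansion through two such points treats two residue classes at
  once. Its third point is forced by matching multipliers, and the pairs of classes are chosen so
  that both expansions leave the same third Appell sum, a series in \<open>q ^ 4\<close>. Weighted
  by the right powers of \<open>q\<close>, the two expansions share the factor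
  \<open>a - q * b\<close>, and this factor is what absorbs \<open>(q; q)\<close>. The infinite
  partial fractions and the triple product are limits of rational identities: finite versions are
  proved by algebra, and dominated convergence does the rest, so neither residue calculus nor formal
  power series enter. Coefficients are isolated at the end by averaging over the rotations
  \<open>z ^ k * Q\<close>.\<close>

definition q_poch :: "complex \<Rightarrow> complex \<Rightarrow> nat \<Rightarrow> complex" where
  "q_poch x p n = (\<Prod>k<n. 1 - x * p ^ k)"

definition q_poch_inf :: "complex \<Rightarrow> complex \<Rightarrow> complex" where
  "q_poch_inf x p = (\<Prod>k. 1 - x * p ^ k)"

text \<open>The factor \<open>(p; p)\<close> is built in so that the triple product becomes a bare
  bilateral Gaussian sum.\<close>

definition theta :: "complex \<Rightarrow> complex \<Rightarrow> complex" where
  "theta x p = q_poch_inf x p * q_poch_inf (p / x) p * q_poch_inf p p"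

lemma q_poch_0 [simp]: "q_poch x p 0 = 1"
  by (simp add: q_poch_def)

lemma q_poch_Suc: "q_poch x p (Suc n) = q_poch x p n * (1 - x * p ^ n)"
  by (simp add: q_poch_def)

lemma q_poch_Suc_left: "q_poch x p (Suc n) = (1 - x) * q_poch (x * p) p n"
  unfolding q_poch_def by (subst prod.lessThan_Suc_shift) (simp add: mult_ac)

lemma q_poch_nonzero: "(\<And>k. x * p ^ k \<noteq> 1) \<Longrightarrow> q_poch x p n \<noteq> 0"
  by (auto simp: q_poch_def)

lemma abs_convergent_prod_q_poch:
  fixes x p :: complex
  assumes "norm p < 1"
  shows "abs_convergent_prod (\<lambda>k. 1 - x * p ^ k)"
proof -
  have "summable (\<lambda>k. norm x * norm p ^ k)"
    using assms by (intro summable_mult summable_geometric) auto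
  then show ?thesis
    by (simp add: abs_convergent_prod_conv_summable norm_mult norm_power)
qed

lemma q_poch_tendsto:
  assumes "norm p < 1"
  shows "q_poch x p \<longlonglongrightarrow> q_poch_inf x p"
proof -
  have "convergent_prod (\<lambda>k. 1 - x * p ^ k)"
    using abs_convergent_prod_q_poch[OF assms] by (rule abs_convergent_prod_imp_convergent_prod)
  then have "(\<lambda>k. 1 - x * p ^ k) has_prod q_poch_inf x p"
    unfolding q_poch_inf_def by (rule convergent_prod_has_prod)
  then have "(\<lambda>n. \<Prod>k<n. 1 - x * p ^ k) \<longlonglongrightarrow> q_poch_inf x p"
    by (rule has_prod_imp_tendsto')
  then show ?thesis by (simp add: q_poch_def[abs_def])
qed

lemma q_poch_inf_nonzero:
  assumes "norm p < 1" "\<And>k. x * p ^ k \<noteq> 1"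
  shows "q_poch_inf x p \<noteq> 0"
  unfolding q_poch_inf_def
proof (rule prodinf_nonzero)
  show "1 - x * p ^ k \<noteq> 0" for k
    using assms(2)[of k] by (metis right_minus_eq)
qed (intro abs_convergent_prod_imp_convergent_prod abs_convergent_prod_q_poch assms)

lemma q_poch_inf_rec:
  assumes "norm p < 1"
  shows "q_poch_inf x p = (1 - x) * q_poch_inf (x * p) p"
proof (rule LIMSEQ_unique)
  show "(\<lambda>n. q_poch x p (Suc n)) \<longlonglongrightarrow> q_poch_inf x p"
    by (rule LIMSEQ_Suc[OF q_poch_tendsto[OF assms]])
  show "(\<lambda>n. q_poch x p (Suc n)) \<longlonglongrightarrow> (1 - x) * q_poch_inf (x * p) p"
    unfolding q_poch_Suc_left by (intro tendsto_intros q_poch_tendsto assms)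
qed

lemma norm_power_less_one: "norm p < 1 \<Longrightarrow> n > 0 \<Longrightarrow> norm (p ^ n :: complex) < 1"
  by (simp add: norm_power power_Suc_less_one power_less_one_iff)

lemma q_poch_inf_mult_minus:
  assumes "norm p < 1"
  shows "q_poch_inf x p * q_poch_inf (- x) p = q_poch_inf (x\<^sup>2) (p\<^sup>2)"
proof (rule LIMSEQ_unique)
  show "(\<lambda>n. q_poch x p n * q_poch (- x) p n) \<longlonglongrightarrow> q_poch_inf x p * q_poch_inf (- x) p"
    by (intro tendsto_intros q_poch_tendsto assms)
  have "q_poch x p n * q_poch (- x) p n = q_poch (x\<^sup>2) (p\<^sup>2) n" for n
    unfolding q_poch_def prod.distrib[symmetric]
    by (intro prod.cong) (auto simp: algebra_simps power2_eq_square power_mult_distrib)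
  then show "(\<lambda>n. q_poch x p n * q_poch (- x) p n) \<longlonglongrightarrow> q_poch_inf (x\<^sup>2) (p\<^sup>2)"
    using q_poch_tendsto[of "p\<^sup>2" "x\<^sup>2"] norm_power_less_one[OF assms, of 2] by simp
qed

lemma q_poch_inf_even_odd:
  assumes "norm p < 1"
  shows "q_poch_inf x p = q_poch_inf x (p\<^sup>2) * q_poch_inf (x * p) (p\<^sup>2)"
proof (rule LIMSEQ_unique)
  have "filterlim (\<lambda>n::nat. 2 * n) at_top at_top"
    by (rule filterlim_subseq) (simp add: strict_mono_def)
  then show "(\<lambda>n. q_poch x p (2 * n)) \<longlonglongrightarrow> q_poch_inf x p"
    using q_poch_tendsto[OF assms] filterlim_compose by blast
  have "q_poch x p (2 * n) = q_poch x (p\<^sup>2) n * q_poch (x * p) (p\<^sup>2) n" for n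
    by (induction n) (simp_all add: q_poch_Suc power_mult[symmetric] mult_ac)
  then show "(\<lambda>n. q_poch x p (2 * n)) \<longlonglongrightarrow> q_poch_inf x (p\<^sup>2) * q_poch_inf (x * p) (p\<^sup>2)"
    using norm_power_less_one[OF assms, of 2]
    by (simp, intro tendsto_intros q_poch_tendsto) auto
qed

text \<open>A convergent sequence with nonzero limit has bounded inverses. These uniform bounds
  provide the domination when finite partial fractions pass to the limit.\<close>

lemma Bseq_inverse_q_poch:
  assumes "norm p < 1" "\<And>k. x * p ^ k \<noteq> 1"
  shows "Bseq (\<lambda>n. inverse (q_poch x p n))"
  by (rule convergent_imp_Bseq[OF convergentI[OF tendsto_inverse[OF q_poch_tendsto q_poch_inf_nonzero]]])
    (use assms in auto)

section \<open>Symmetries and zeros of theta functions\<close>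

lemma theta_inverse:
  assumes "norm p < 1" "x \<noteq> 0" "p \<noteq> 0"
  shows "theta (inverse x) p = - theta x p / x"
proof -
  define Y where "Y = q_poch_inf (p / x) p * q_poch_inf (p * x) p * q_poch_inf p p"
  have 1: "theta (inverse x) p = (1 - inverse x) * Y"
    using q_poch_inf_rec[OF assms(1), of "inverse x"] by (simp add: theta_def Y_def divide_inverse mult_ac)
  have 2: "theta x p = (1 - x) * Y"
    using q_poch_inf_rec[OF assms(1), of x] by (simp add: theta_def Y_def mult_ac)
  show ?thesis unfolding 1 2 using assms(2) by (simp add: field_simps)
qed

lemma theta_reflect:
  assumes "x \<noteq> 0" "p \<noteq> 0"
  shows "theta (p / x) p = theta x p"
  using assms by (simp add: theta_def)

lemma theta_nonzero:
  assumes "norm p < 1" "p \<noteq> 0" "x \<noteq> 0" "\<And>n::int. x * p powi n \<noteq> 1"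
  shows "theta x p \<noteq> 0"
proof -
  have "q_poch_inf x p \<noteq> 0"
    using assms(4)[of "int _"] by (intro q_poch_inf_nonzero assms) auto
  moreover have "q_poch_inf (p / x) p \<noteq> 0"
  proof (intro q_poch_inf_nonzero assms)
    show "p / x * p ^ k \<noteq> 1" for k
      using assms(4)[of "- int (Suc k)"] assms(2,3) unfolding power_int_minus power_int_of_nat
      by (auto simp: field_simps)
  qed
  moreover have "q_poch_inf p p \<noteq> 0"
  proof (intro q_poch_inf_nonzero assms)
    show "p * p ^ k \<noteq> 1" for k
      using norm_power_less_one[OF assms(1), of "Suc k"] by auto
  qed
  ultimately show ?thesis by (simp add: theta_def)
qed

section \<open>Bilateral Gaussian sums and dominated convergence over the integers\<close>

definition tri :: "int \<Rightarrow> int" where "tri n = n * (n - 1) div 2"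

lemma two_tri: "2 * tri n = n * (n - 1)"
  unfolding tri_def by (rule dvd_mult_div_cancel) auto

text \<open>The defect of additivity is bilinear. Together with \<open>two_tri\<close> this replaces
  integer division in almost all exponent computations below.\<close>

lemma tri_add: "tri (m + n) = tri m + tri n + m * n"
  using two_tri[of m] two_tri[of n] two_tri[of "m + n"] by (simp add: algebra_simps)

lemma tri_0 [simp]: "tri 0 = 0" and tri_1 [simp]: "tri 1 = 0"
  by (simp_all add: tri_def)

lemma tri_minus: "tri (- n) = tri n + n"
  using two_tri[of n] two_tri[of "-n"] by (simp add: algebra_simps)

text \<open>The ratio \<open>D * r ^ n\<close> tends to 0 whatever the size of \<open>D\<close>, so
  it eventually stays below one half.\<close>

lemma summable_power_ratio:
  fixes f :: "nat \<Rightarrow> real"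
  assumes "0 \<le> r" "r < 1" "\<And>n. f (Suc n) = f n * (D * r ^ n)"
  shows "summable f"
proof -
  have "(\<lambda>n. D * r ^ n) \<longlonglongrightarrow> D * 0"
    using assms by (intro tendsto_intros LIMSEQ_realpow_zero) auto
  then have "(\<lambda>n. norm (D * r ^ n)) \<longlonglongrightarrow> 0"
    using tendsto_norm_zero by fastforce
  then have "eventually (\<lambda>n. norm (D * r ^ n) < 1 / 2) sequentially"
    by (rule order_tendstoD) auto
  then obtain N where N: "\<And>n. n \<ge> N \<Longrightarrow> norm (D * r ^ n) < 1 / 2"
    by (auto simp: eventually_sequentially)
  show ?thesis
  proof (rule summable_ratio_test[of "1 / 2" N])
    show "norm (f (Suc n)) \<le> 1 / 2 * norm (f n)" if "N \<le> n" for n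
    proof -
      have "norm (f (Suc n)) = norm (f n) * norm (D * r ^ n)"
        by (simp only: assms(3) norm_mult)
      also have "\<dots> \<le> norm (f n) * (1 / 2)"
        using N[OF that] by (intro mult_left_mono) auto
      finally show ?thesis by simp
    qed
  qed auto
qed

lemma summable_on_intI:
  fixes f :: "int \<Rightarrow> real"
  assumes "(\<lambda>n. f (int n)) summable_on UNIV" "(\<lambda>n. f (- int (Suc n))) summable_on UNIV"
  shows "f summable_on UNIV"
proof -
  have "f summable_on range int"
    using assms(1) by (subst summable_on_reindex) (auto simp: o_def)
  moreover have "f summable_on range (\<lambda>n. - int (Suc n))"
    using assms(2) by (subst summable_on_reindex) (auto simp: o_def inj_on_def)
  moreover have "range int \<inter> range (\<lambda>n. - int (Suc n)) = {}" by auto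
  moreover have "UNIV = range int \<union> range (\<lambda>n. - int (Suc n))"
  proof -
    have "n \<in> range int \<union> range (\<lambda>n. - int (Suc n))" for n :: int
      by (cases n rule: int_cases) auto
    then show ?thesis by auto
  qed
  ultimately show ?thesis using summable_on_Un_disjoint by metis
qed

text \<open>The dominating series for theta and Appell sums: a quadratic exponent beats any
  geometric factor in both directions.\<close>

lemma summable_on_gauss:
  fixes r C :: real
  assumes "0 < r" "r < 1" "0 < C"
  shows "(\<lambda>n. r powi tri n * C powi n) summable_on UNIV"
proof (rule summable_on_intI)
  have nz: "r \<noteq> 0" "C \<noteq> 0" using assms by auto
  show "(\<lambda>n. r powi tri (int n) * C powi int n) summable_on UNIV"
  proof (rule summable_nonneg_imp_summable_on)
    show "summable (\<lambda>n. r powi tri (int n) * C powi int n)"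
    proof (rule summable_power_ratio[of r _ C])
      show "r powi tri (int (Suc n)) * C powi int (Suc n)
          = r powi tri (int n) * C powi int n * (C * r ^ n)" for n
        using nz tri_add[of "int n" 1] by (simp add: power_int_add add.commute)
    qed (use assms in auto)
  qed (use assms in auto)
  show "(\<lambda>n. r powi tri (- int (Suc n)) * C powi (- int (Suc n))) summable_on UNIV"
  proof (rule summable_nonneg_imp_summable_on)
    show "summable (\<lambda>n. r powi tri (- int (Suc n)) * C powi (- int (Suc n)))"
    proof (rule summable_power_ratio[of r _ "r\<^sup>2 / C"])
      fix n
      have "tri (- int (Suc (Suc n))) = tri (- int (Suc n)) + (2 + int n)"
      proof -
        have "- int (Suc (Suc n)) = - int (Suc n) + (-1)" by simp
        then show ?thesis
          using tri_add[of "- int (Suc n)" "-1"] tri_minus[of 1] by simp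
      qed
      then have "r powi tri (- int (Suc (Suc n))) = r powi tri (- int (Suc n)) * r powi (2 + int n)"
        using power_int_add[of r "tri (- int (Suc n))"] nz by simp
      moreover have "C powi (- int (Suc (Suc n))) = C powi (- int (Suc n)) * C powi (-1)"
        using power_int_add[of C "- int (Suc n)" "-1"] nz by simp
      ultimately have "r powi tri (- int (Suc (Suc n))) * C powi (- int (Suc (Suc n)))
         = (r powi tri (- int (Suc n)) * r powi (2 + int n)) * (C powi (- int (Suc n)) * C powi (-1))"
        by simp
      then show "r powi tri (- int (Suc (Suc n))) * C powi (- int (Suc (Suc n)))
         = r powi tri (- int (Suc n)) * C powi (- int (Suc n)) * (r\<^sup>2 / C * r ^ n)"
        using nz by (simp add: power_int_add power_int_minus divide_inverse mult_ac)
    qed (use assms in auto)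
  qed (use assms in auto)
qed

text \<open>Tannery's theorem, transported from the natural numbers along \<open>int_decode\<close>.
  It carries the triple product and the theta partial fractions from their finite forms to the
  infinite ones.\<close>

lemma tendsto_infsum_int:
  fixes f :: "nat \<Rightarrow> int \<Rightarrow> complex"
  assumes lim: "\<And>n. (\<lambda>N. f N n) \<longlonglongrightarrow> g n"
    and bd: "\<And>N n. norm (f N n) \<le> h n" and h: "h summable_on UNIV"
  shows "(\<lambda>N. infsum (f N) UNIV) \<longlonglongrightarrow> infsum g UNIV"
proof -
  have bij: "bij_betw int_decode UNIV UNIV" by (rule bij_int_decode)
  have h': "summable (\<lambda>k. h (int_decode k))"
  proof -
    have "(\<lambda>k. h (int_decode k)) summable_on UNIV"
      using h summable_on_reindex_bij_betw[OF bij, of h] by simp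
    then show ?thesis by (rule summable_on_imp_summable)
  qed
  have eq: "infsum u UNIV = (\<Sum>k. u (int_decode k))" if "\<And>n. norm (u n) \<le> h n" for u :: "int \<Rightarrow> complex"
  proof -
    have "summable (\<lambda>k. norm (u (int_decode k)))"
      using that by (intro summable_comparison_test[OF _ h']) auto
    then have "((\<lambda>k. u (int_decode k)) has_sum (\<Sum>k. u (int_decode k))) UNIV"
      by (intro norm_summable_imp_has_sum summable_sums) (auto intro: summable_norm_cancel)
    then have "infsum (\<lambda>k. u (int_decode k)) UNIV = (\<Sum>k. u (int_decode k))"
      by (rule infsumI)
    then show ?thesis using infsum_reindex_bij_betw[OF bij, of u] by simp
  qed
  have gb: "norm (g n) \<le> h n" for n
    using tendsto_norm[OF lim] bd by (intro LIMSEQ_le_const2[where X = "\<lambda>N. norm (f N n)"]) auto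
  have "((\<lambda>N. \<Sum>k. f N (int_decode k)) \<longlongrightarrow> (\<Sum>k. g (int_decode k))) sequentially"
    by (rule tannerys_theorem[where M = "\<lambda>k. h (int_decode k)", THEN conjunct2, THEN conjunct2])
       (use lim bd h' in \<open>auto simp: case_prod_unfold\<close>)
  then show ?thesis using eq bd gb by simp
qed

section \<open>The Jacobi triple product\<close>

text \<open>The value \<open>0\<close> at negative indices makes finite expansions into sums over all integers.\<close>

definition inv_q_poch :: "complex \<Rightarrow> int \<Rightarrow> complex" where
  "inv_q_poch p k = (if k < 0 then 0 else inverse (q_poch p p (nat k)))"

lemma one_minus_power_nonzero:
  fixes p :: complex
  assumes "norm p < 1" "n > 0"
  shows "p ^ n \<noteq> 1"
  using norm_power_less_one[OF assms] by auto

lemma q_poch_self_nonzero: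
  assumes "norm p < 1"
  shows "q_poch p p n \<noteq> 0"
  using one_minus_power_nonzero[OF assms, of "Suc _"] by (intro q_poch_nonzero) auto

lemma q_poch_inf_self_nonzero:
  assumes "norm p < 1"
  shows "q_poch_inf p p \<noteq> 0"
  using one_minus_power_nonzero[OF assms, of "Suc _"] by (intro q_poch_inf_nonzero assms) auto

text \<open>The value 0 at negative indices makes the recurrence valid at every integer: at
  \<open>k = 0\<close> the factor \<open>1 - p powi 0\<close> vanishes. Inductions over bilateral
  sums therefore have no boundary cases.\<close>

lemma inv_q_poch_rec:
  assumes "norm p < 1"
  shows "inv_q_poch p (k - 1) = (1 - p powi k) * inv_q_poch p k"
proof (cases "k \<le> 0")
  case True
  then show ?thesis by (cases "k = 0") (auto simp: inv_q_poch_def)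
next
  case False
  define m where "m = nat (k - 1)"
  have k: "k = int (Suc m)" using False by (simp add: m_def)
  have "p powi k = p * p ^ m" unfolding k power_int_of_nat by simp
  moreover have "1 - p * p ^ m \<noteq> 0"
    using one_minus_power_nonzero[OF assms, of "Suc m"] by auto
  ultimately show ?thesis
    using q_poch_self_nonzero[OF assms, of m] by (simp add: inv_q_poch_def k nat_add_distrib q_poch_Suc)
qed

lemma inv_q_poch_bounded:
  assumes "norm p < 1"
  obtains B where "B > 0" "\<And>k. norm (inv_q_poch p k) \<le> B"
proof -
  have "Bseq (\<lambda>n. inverse (q_poch p p n))"
    using one_minus_power_nonzero[OF assms, of "Suc _"] by (intro Bseq_inverse_q_poch assms) auto
  then obtain B where "B > 0" "\<And>n. norm (inverse (q_poch p p n)) \<le> B"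
    by (auto elim!: BseqE)
  then show ?thesis
    by (intro that[of B]) (auto simp: inv_q_poch_def)
qed

lemma tendsto_nat_offset:
  assumes "(f :: nat \<Rightarrow> complex) \<longlonglongrightarrow> l"
  shows "(\<lambda>N. f (nat (int N + k))) \<longlonglongrightarrow> l"
proof -
  have "filterlim (\<lambda>N. nat (int N + k)) at_top at_top"
  proof (rule filterlim_at_top_mono[of "\<lambda>N. N - nat (- k)"])
    show "filterlim (\<lambda>N. N - nat (- k)) at_top at_top"
      by (rule filterlim_minus_const_nat_at_top)
  qed (auto intro!: always_eventually)
  then show ?thesis using assms filterlim_compose by blast
qed

lemma inv_q_poch_tendsto:
  assumes "norm p < 1"
  shows "(\<lambda>N. inv_q_poch p (int N + k)) \<longlonglongrightarrow> inverse (q_poch_inf p p)"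
proof -
  have "(\<lambda>N. inverse (q_poch p p (nat (int N + k)))) \<longlonglongrightarrow> inverse (q_poch_inf p p)"
    by (intro tendsto_nat_offset tendsto_inverse q_poch_tendsto assms q_poch_inf_self_nonzero)
  moreover have "eventually (\<lambda>N. inverse (q_poch p p (nat (int N + k))) = inv_q_poch p (int N + k)) sequentially"
    using eventually_ge_at_top[of "nat (- k)"] by eventually_elim (auto simp: inv_q_poch_def)
  ultimately show ?thesis by (rule Lim_transform_eventually)
qed

lemma has_sum_int_shift:
  fixes f :: "int \<Rightarrow> complex"
  shows "((\<lambda>n. f (n + k)) has_sum S) UNIV \<longleftrightarrow> (f has_sum S) UNIV"
  by (rule has_sum_reindex_bij_witness[of _ "\<lambda>n. n - k" "\<lambda>n. n + k"]) auto

text \<open>Division by \<open>q_poch p p (2 * N)\<close> splits the Gaussian binomial coefficient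
  into two independent reciprocals. Raising \<open>N\<close> by one is then a three-term recurrence
  in \<open>n\<close>, checked termwise.\<close>

lemma finite_jacobi_triple:
  assumes p: "norm p < 1" "p \<noteq> 0" and x: "x \<noteq> 0"
  shows "((\<lambda>n. p powi tri n * (- x) powi n * (inv_q_poch p (int N - n) * inv_q_poch p (int N + n)))
          has_sum (q_poch x p N * q_poch (p / x) p N * inverse (q_poch p p (2 * N)))) UNIV"
    (is "(?t N has_sum ?S N) UNIV")
proof (induction N)
  case 0
  have "(?t 0 has_sum 1) {0}"
    by (simp add: inv_q_poch_def has_sum_finiteI)
  moreover have "?t 0 n = 0" if "n \<in> UNIV - {0}" for n
    using that by (auto simp: inv_q_poch_def)
  ultimately have "(?t 0 has_sum 1) UNIV"
    using has_sum_cong_neutral[of UNIV "{0}" "?t 0" "?t 0"] by auto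
  then show ?case by simp
next
  case (Suc N)
  define y where "y = - x"
  have y: "y \<noteq> 0" using x by (simp add: y_def)
  \<comment> \<open>The ratio of \<open>q_poch p p (2 * Suc N)\<close> to
    \<open>q_poch p p (2 * N)\<close>.\<close>
  define c where "c = (1 - p * p ^ (2 * N)) * (1 - p * p ^ Suc (2 * N))"
  have c: "c \<noteq> 0"
    using one_minus_power_nonzero[OF p(1), of "Suc (2 * N)"]
      one_minus_power_nonzero[OF p(1), of "Suc (Suc (2 * N))"] by (auto simp: c_def)
  \<comment> \<open>The two new factors multiply out to
    \<open>1 + p * p ^ (2 * N) - x * p ^ N - p ^ Suc N / x\<close>. Multiplication by
    \<open>x\<close> or by its inverse shifts the summation index, which explains the neighbours
    \<open>n - 1\<close> and \<open>n + 1\<close>.\<close>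
  have step: "c * ?t (Suc N) n = (1 + p * p ^ (2 * N)) * ?t N n
      + y * p ^ N * ?t N (n + (-1)) + p ^ Suc N / y * ?t N (n + 1)" for n
  proof -
    \<comment> \<open>Every reciprocal in the step is a polynomial in \<open>u\<close> or
      \<open>v\<close> times \<open>A\<close> or \<open>B\<close>, and \<open>p ^ (2 * N)\<close> is
      expressed by \<open>u * v\<close>, so the step becomes a rational identity in
      \<open>u\<close>, \<open>v\<close> and \<open>p\<close>.\<close>
    define u v where "u = p powi (int N + 1 - n)" and "v = p powi (int N + 1 + n)"
    define A B where "A = inv_q_poch p (int N + 1 - n)" and "B = inv_q_poch p (int N + 1 + n)"
    define E where "E = p powi tri n * y powi n"
    have uv: "u * v = p ^ Suc (Suc (2 * N))"
    proof -
      have "u * v = p powi ((int N + 1 - n) + (int N + 1 + n))"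
        unfolding u_def v_def using p by (subst power_int_add) auto
      also have "(int N + 1 - n) + (int N + 1 + n) = int (Suc (Suc (2 * N)))" by simp
      finally show ?thesis by (simp only: power_int_of_nat)
    qed
    have u1: "p powi (int N - n) = u / p" and v1: "p powi (int N + n) = v / p"
      unfolding u_def v_def using p power_int_add[of p "int N - n" 1] power_int_add[of p "int N + n" 1]
      by (auto simp: algebra_simps)
    have r: "inv_q_poch p (int N - n) = (1 - u) * A" "inv_q_poch p (int N + n) = (1 - v) * B"
      using inv_q_poch_rec[OF p(1), of "int N + 1 - n"] inv_q_poch_rec[OF p(1), of "int N + 1 + n"]
      by (auto simp: u_def v_def A_def B_def algebra_simps)
    have r2: "inv_q_poch p (int N - n - 1) = (1 - u / p) * (1 - u) * A" "inv_q_poch p (int N + n - 1) = (1 - v / p) * (1 - v) * B"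
      using inv_q_poch_rec[OF p(1), of "int N - n"] inv_q_poch_rec[OF p(1), of "int N + n"]
      unfolding u1 v1 r by (simp_all add: mult_ac)
    have t0: "?t N n = E * ((1 - u) * A * ((1 - v) * B))"
      using r by (simp add: E_def y_def)
    have t1: "y * p ^ N * ?t N (n + (-1)) = E * u * (A * ((1 - v / p) * (1 - v) * B))"
    proof -
      have "tri (n - 1) = tri n + (1 - n)"
        using tri_add[of n "-1"] tri_minus[of 1] by simp
      then have e1: "p powi tri (n - 1) = p powi tri n * p powi (1 - n)"
        using power_int_add[of p "tri n"] p by simp
      have e2: "p powi (1 - n) * p ^ N = u"
        using power_int_add[of p "1 - n" "int N"] p by (simp add: u_def algebra_simps)
      have e3: "y powi (n - 1) * y = y powi n"
        using y by (simp add: power_int_minus_mult)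
      have "y * p ^ N * (p powi tri (n - 1) * y powi (n - 1))
          = p powi tri n * (p powi (1 - n) * p ^ N) * (y powi (n - 1) * y)"
        unfolding e1 by (simp only: mult_ac)
      also have "\<dots> = E * u"
        unfolding e2 e3 E_def by (simp only: mult_ac)
      finally have "y * p ^ N * (p powi tri (n - 1) * y powi (n - 1)) = E * u" .
      moreover have "?t N (n + (-1)) = (p powi tri (n - 1) * y powi (n - 1)) * (A * ((1 - v / p) * (1 - v) * B))"
      proof -
        have "int N - (n + (-1)) = int N + 1 - n" "int N + (n + (-1)) = int N + n - 1" by auto
        then show ?thesis unfolding y_def using r2 by (simp only: A_def B_def) simp
      qed
      ultimately show ?thesis by (simp only: mult.assoc[symmetric])
    qed
    have t2: "p ^ Suc N / y * ?t N (n + 1) = E * v * ((1 - u / p) * (1 - u) * A * B)"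
    proof -
      have e1: "p powi tri (n + 1) = p powi tri n * p powi n"
        using power_int_add[of p "tri n"] p tri_add[of n 1] by simp
      have e2: "p powi n * p ^ Suc N = v"
        using power_int_add[of p n "int (Suc N)"] p
        unfolding power_int_of_nat v_def by (simp add: algebra_simps)
      have e3: "y powi (n + 1) / y = y powi n"
        using y by (simp add: power_int_add)
      have "p ^ Suc N / y * (p powi tri (n + 1) * y powi (n + 1))
          = p powi tri n * (p powi n * p ^ Suc N) * (y powi (n + 1) / y)"
        unfolding e1 by (simp only: mult_ac divide_inverse)
      also have "\<dots> = E * v"
        unfolding e2 e3 E_def by (simp only: mult_ac)
      finally have "p ^ Suc N / y * (p powi tri (n + 1) * y powi (n + 1)) = E * v" .
      moreover have "?t N (n + 1) = (p powi tri (n + 1) * y powi (n + 1)) * ((1 - u / p) * (1 - u) * A * B)"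
      proof -
        have "int N - (n + 1) = int N - n - 1" "int N + (n + 1) = int N + 1 + n" by auto
        then show ?thesis unfolding y_def using r2 by (simp only: A_def B_def)
      qed
      ultimately show ?thesis by (simp only: mult.assoc[symmetric])
    qed
    have t3: "?t (Suc N) n = E * (A * B)"
      by (simp add: E_def y_def A_def B_def algebra_simps)
    have c': "c = (1 - u * v / p) * (1 - u * v)" and q': "p * p ^ (2 * N) = u * v / p"
      unfolding uv c_def using p by auto
    show ?thesis
      unfolding t0 t1 t2 t3 c' q' using p by (simp add: field_simps)
  qed
  have "((\<lambda>n. (1 + p * p ^ (2 * N)) * ?t N n + y * p ^ N * ?t N (n + (-1)) + p ^ Suc N / y * ?t N (n + 1))
      has_sum ((1 + p * p ^ (2 * N)) * ?S N + y * p ^ N * ?S N + p ^ Suc N / y * ?S N)) UNIV"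
    using Suc.IH has_sum_int_shift[of "?t N"]
    by (intro has_sum_add has_sum_cmult_right) blast+
  then have "((\<lambda>n. c * ?t (Suc N) n) has_sum
     ((1 + p * p ^ (2 * N)) * ?S N + y * p ^ N * ?S N + p ^ Suc N / y * ?S N)) UNIV"
    by (simp only: step)
  then have "((\<lambda>n. inverse c * (c * ?t (Suc N) n)) has_sum inverse c *
     ((1 + p * p ^ (2 * N)) * ?S N + y * p ^ N * ?S N + p ^ Suc N / y * ?S N)) UNIV"
    by (rule has_sum_cmult_right)
  moreover have "inverse c * (c * ?t (Suc N) n) = ?t (Suc N) n" for n
    using c by simp
  moreover have "inverse c *
     ((1 + p * p ^ (2 * N)) * ?S N + y * p ^ N * ?S N + p ^ Suc N / y * ?S N) = ?S (Suc N)"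
  proof -
    have "(1 + p * p ^ (2 * N)) + y * p ^ N + p ^ Suc N / y = (1 - x * p ^ N) * (1 - p / x * p ^ N)"
      using x by (simp add: y_def field_simps mult_2_right power_add)
    moreover have "inverse (q_poch p p (2 * Suc N)) = inverse c * inverse (q_poch p p (2 * N))"
      by (simp add: q_poch_Suc c_def mult_ac)
    ultimately show ?thesis
      unfolding q_poch_Suc distrib_right[symmetric] by (simp add: mult_ac)
  qed
  ultimately show ?case by (simp only:)
qed

text \<open>In the finite form both reciprocals tend to \<open>inverse Q\<close>, and so does the
  denominator on the product side. Clearing \<open>inverse Q * inverse Q\<close> leaves exactly the
  one factor \<open>Q\<close> contained in \<open>theta\<close>.\<close>

theorem jacobi_triple:
  assumes p: "norm p < 1" "p \<noteq> 0" and x: "x \<noteq> 0"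
  shows "((\<lambda>n. p powi tri n * (- x) powi n) has_sum theta x p) UNIV"
proof -
  obtain B where B: "B > 0" "\<And>k. norm (inv_q_poch p k) \<le> B" using inv_q_poch_bounded[OF p(1)] by blast
  define g where "g n = p powi tri n * (- x) powi n" for n
  define Q where "Q = q_poch_inf p p"
  have Q: "Q \<noteq> 0" unfolding Q_def by (rule q_poch_inf_self_nonzero[OF p(1)])
  have sg: "(\<lambda>n. norm (g n)) summable_on UNIV"
    using summable_on_gauss[of "norm p" "norm x"] p x
    by (simp add: g_def norm_mult norm_power_int)
  have "(\<lambda>N. infsum (\<lambda>n. g n * (inv_q_poch p (int N - n) * inv_q_poch p (int N + n))) UNIV)
        \<longlonglongrightarrow> infsum (\<lambda>n. g n * (inverse Q * inverse Q)) UNIV"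
  proof (rule tendsto_infsum_int[where h = "\<lambda>n. norm (g n) * (B * B)"])
    show "(\<lambda>N. g n * (inv_q_poch p (int N - n) * inv_q_poch p (int N + n))) \<longlonglongrightarrow> g n * (inverse Q * inverse Q)" for n
      using inv_q_poch_tendsto[OF p(1), of "-n"] inv_q_poch_tendsto[OF p(1), of n] unfolding Q_def
      by (intro tendsto_intros) auto
    show "norm (g n * (inv_q_poch p (int N - n) * inv_q_poch p (int N + n))) \<le> norm (g n) * (B * B)" for N n
      unfolding norm_mult by (intro mult_mono mult_nonneg_nonneg B order_refl) (use B in auto)
    show "(\<lambda>n. norm (g n) * (B * B)) summable_on UNIV"
      using sg by (intro summable_on_cmult_left)
  qed
  moreover have "infsum (\<lambda>n. g n * (inv_q_poch p (int N - n) * inv_q_poch p (int N + n))) UNIV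
      = q_poch x p N * q_poch (p / x) p N * inverse (q_poch p p (2 * N))" for N
    unfolding g_def using finite_jacobi_triple[OF p x] by (rule infsumI)
  moreover have "(\<lambda>N. q_poch x p N * q_poch (p / x) p N * inverse (q_poch p p (2 * N)))
      \<longlonglongrightarrow> q_poch_inf x p * q_poch_inf (p / x) p * inverse Q"
  proof -
    have "filterlim (\<lambda>n::nat. 2 * n) at_top at_top"
      by (rule filterlim_subseq) (simp add: strict_mono_def)
    then have "(\<lambda>N. q_poch p p (2 * N)) \<longlonglongrightarrow> Q"
      unfolding Q_def using q_poch_tendsto[OF p(1)] filterlim_compose by blast
    then show ?thesis using Q by (intro tendsto_intros q_poch_tendsto p)
  qed
  ultimately have "infsum (\<lambda>n. g n * (inverse Q * inverse Q)) UNIV = q_poch_inf x p * q_poch_inf (p / x) p * inverse Q"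
    using LIMSEQ_unique by simp
  then have "infsum g UNIV * (inverse Q * inverse Q) = q_poch_inf x p * q_poch_inf (p / x) p * inverse Q"
    by (simp add: infsum_cmult_left')
  then have "infsum g UNIV = theta x p"
    using Q by (simp add: theta_def Q_def[symmetric] field_simps)
  moreover have "g summable_on UNIV"
    using sg by (rule abs_summable_summable)
  ultimately show ?thesis using has_sum_infsum unfolding g_def by metis
qed

section \<open>Partial fractions of theta quotients\<close>

text \<open>Lagrange interpolation of the monomial \<open>w ^ m\<close> at the nodes
  \<open>1 / c i\<close>, read off at \<open>w = 1\<close>. The exponent \<open>m\<close> is left
  free: half the number of nodes is the choice that makes the terms converge for poles on both
  sides.\<close>

lemma partial_fractions:
  fixes c :: "'i \<Rightarrow> complex"
  assumes "finite I" "inj_on c I" "\<And>i. i \<in> I \<Longrightarrow> c i \<noteq> 0" "\<And>i. i \<in> I \<Longrightarrow> c i \<noteq> 1" "m < card I"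
  shows "1 / (\<Prod>i\<in>I. 1 - c i)
       = (\<Sum>i\<in>I. (1 / c i) ^ m / (\<Prod>j\<in>I - {i}. 1 - c j / c i) / (1 - c i))"
proof -
  define w where "w i = (1 / c i) ^ m / (\<Prod>j\<in>I - {i}. 1 - c j / c i)" for i
  define L where "L i = (\<Prod>j\<in>I - {i}. [:1, - c j:])" for i
  \<comment> \<open>Interpolant minus monomial: its degree is below \<open>card I\<close>, yet it
    vanishes at all \<open>card I\<close> nodes.\<close>
  define P where "P = (\<Sum>i\<in>I. smult (w i) (L i)) - monom 1 m"
  have "P = 0"
  proof (rule ccontr)
    assume "P \<noteq> 0"
    have nz: "(\<Prod>j\<in>I - {i}. 1 - c j / c i) \<noteq> 0" if "i \<in> I" for i
      using that assms by (auto simp: field_simps inj_on_def)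
    have "poly P (1 / c k) = 0" if k: "k \<in> I" for k
    proof -
      have "poly (L i) (1 / c k) = 0" if "i \<in> I - {k}" for i
        unfolding L_def poly_prod using that k assms by (intro prod_zero) (auto intro!: bexI[of _ k])
      then have "(\<Sum>i\<in>I. w i * poly (L i) (1 / c k)) = w k * poly (L k) (1 / c k)"
        using k assms(1) by (subst sum.remove[of _ k]) (auto intro!: sum.neutral)
      also have "poly (L k) (1 / c k) = (\<Prod>j\<in>I - {k}. 1 - c j / c k)"
        by (simp add: L_def poly_prod)
      also have "w k * \<dots> = (1 / c k) ^ m"
        using nz[OF k] by (simp add: w_def)
      finally show ?thesis
        by (simp add: P_def poly_sum poly_monom)
    qed
    then have "(\<lambda>i. 1 / c i) ` I \<subseteq> {x. poly P x = 0}" by auto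
    then have "card ((\<lambda>i. 1 / c i) ` I) \<le> card {x. poly P x = 0}"
      by (intro card_mono poly_roots_finite \<open>P \<noteq> 0\<close>)
    also have "\<dots> \<le> degree P"
      by (rule card_poly_roots_bound[OF \<open>P \<noteq> 0\<close>])
    also have "card ((\<lambda>i. 1 / c i) ` I) = card I"
      using assms(2) by (intro card_image) (auto simp: inj_on_def)
    also have "degree P \<le> card I - 1"
    proof -
      have "degree (L i) \<le> card I - 1" if "i \<in> I" for i
      proof -
        have "degree (L i) \<le> (\<Sum>j\<in>I - {i}. degree [:1, - c j:])"
          unfolding L_def using degree_prod_sum_le[of "I - {i}" "\<lambda>j. [:1, - c j:]"] assms(1)
          by (simp only: o_def finite_Diff)
        also have "\<dots> \<le> (\<Sum>j\<in>I - {i}. 1)" by (intro sum_mono) auto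
        also have "\<dots> = card I - 1" using that assms(1) by simp
        finally show ?thesis .
      qed
      then have "degree (\<Sum>i\<in>I. smult (w i) (L i)) \<le> card I - 1"
        using assms(1) by (intro degree_sum_le) (auto intro: order_trans[OF degree_smult_le])
      moreover have "degree (monom (1::complex) m) \<le> card I - 1"
        using assms(5) by (simp add: degree_monom_eq)
      ultimately show ?thesis unfolding P_def by (rule degree_diff_le)
    qed
    finally show False using assms(5) by simp
  qed
  then have "poly P 1 = 0" by simp
  then have "(\<Sum>i\<in>I. w i * (\<Prod>j\<in>I - {i}. 1 - c j)) = 1"
    by (simp add: P_def poly_sum poly_monom L_def poly_prod)
  moreover have "(\<Prod>j\<in>I - {i}. 1 - c j) = (\<Prod>j\<in>I. 1 - c j) / (1 - c i)" if "i \<in> I" for i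
    using that assms(1,4) by (simp add: prod.remove[of I i])
  ultimately have "(\<Sum>i\<in>I. w i * ((\<Prod>j\<in>I. 1 - c j) / (1 - c i))) = 1" by simp
  then have "(\<Prod>j\<in>I. 1 - c j) * (\<Sum>i\<in>I. w i / (1 - c i)) = 1"
    by (simp add: sum_distrib_left mult_ac)
  moreover have "(\<Prod>j\<in>I. 1 - c j) \<noteq> 0"
    using assms(1,4) by auto
  ultimately show ?thesis
    by (simp add: w_def field_simps)
qed

text \<open>Extracting \<open>- y * p powi (- k)\<close> from \<open>1 - y * p powi (- k)\<close>
  leaves \<open>1 - p ^ k / y\<close>, and the extracted exponents add up to
  \<open>tri (d + 1)\<close>.\<close>

lemma prod_powi_below:
  assumes "p \<noteq> 0" "y \<noteq> 0"
  shows "(\<Prod>a<d. 1 - y * p powi (int a - int d)) = (- y) ^ d * p powi (- tri (int d + 1)) * q_poch (p / y) p d"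
proof (induction d)
  case (Suc d)
  have "(\<Prod>a<Suc d. 1 - y * p powi (int a - int (Suc d)))
      = (1 - y * p powi (- int (Suc d))) * (\<Prod>a<d. 1 - y * p powi (int a - int d))"
    by (subst prod.lessThan_Suc_shift) simp
  also have "1 - y * p powi (- int (Suc d)) = - y * p powi (- (int d + 1)) * (1 - p / y * p ^ d)"
  proof -
    have "p powi (- (int d + 1)) * (p / y * p ^ d) = 1 / y"
      using assms power_int_add[of p "- (int d + 1)" "int d + 1"] by (simp add: power_int_add field_simps)
    then have "- y * p powi (- (int d + 1)) * (p / y * p ^ d) = - 1"
      using assms by (simp only: mult.assoc) simp
    then show ?thesis by (simp add: algebra_simps)
  qed
  also have "p powi (- (int d + 1)) * p powi (- tri (int d + 1)) = p powi (- tri (int (Suc d) + 1))"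
    using tri_add[of "int d + 1" 1] power_int_add[of p "- (int d + 1)" "- tri (int d + 1)"] assms
    by (simp add: algebra_simps)
  then have "- y * p powi (- (int d + 1)) * (1 - p / y * p ^ d) * (\<Prod>a<d. 1 - y * p powi (int a - int d))
     = (- y) ^ Suc d * p powi (- tri (int (Suc d) + 1)) * q_poch (p / y) p (Suc d)"
    unfolding Suc.IH q_poch_Suc by (simp add: mult_ac flip: power_int_minus)
  finally show ?case .
qed auto

lemma prod_powi_above:
  assumes "p \<noteq> 0"
  shows "(\<Prod>a\<in>{d..<d + m}. 1 - y * p powi (int a - int d)) = q_poch y p m"
  unfolding q_poch_def
  by (rule prod.reindex_bij_witness[of _ "\<lambda>k. k + d" "\<lambda>a. a - d"]) (auto simp flip: power_int_of_nat simp: of_nat_diff)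

lemma prod_powi_window:
  assumes "p \<noteq> 0" "y \<noteq> 0" "d \<le> M"
  shows "(\<Prod>a<M. 1 - y * p powi (int a - int d))
       = q_poch y p (M - d) * ((- y) ^ d * p powi (- tri (int d + 1)) * q_poch (p / y) p d)"
proof -
  have "{..<M} = {..<d} \<union> {d..<d + (M - d)}" using assms by auto
  then have "(\<Prod>a<M. 1 - y * p powi (int a - int d)) =
     (\<Prod>a\<in>{..<d} \<union> {d..<d + (M - d)}. 1 - y * p powi (int a - int d))"
    by (rule arg_cong)
  also have "\<dots> =
     (\<Prod>a<d. 1 - y * p powi (int a - int d)) * (\<Prod>a\<in>{d..<d + (M - d)}. 1 - y * p powi (int a - int d))"
    by (rule prod.union_disjoint) auto
  finally show ?thesis
    unfolding prod_powi_below[OF assms(1,2)] prod_powi_above[OF assms(1)] by (simp add: mult_ac)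
qed

text \<open>The window at \<open>y = 1\<close> without its vanishing factor: what the remaining
  poles of the same family contribute to a residue.\<close>

lemma prod_powi_window_punctured:
  assumes "p \<noteq> 0" "d < M"
  shows "(\<Prod>a\<in>{..<M} - {d}. 1 - p powi (int a - int d))
       = q_poch p p (M - d - 1) * ((- 1) ^ d * p powi (- tri (int d + 1)) * q_poch p p d)"
proof -
  have "{..<M} - {d} = {..<d} \<union> {Suc d..<Suc d + (M - d - 1)}" using assms by auto
  then have "(\<Prod>a\<in>{..<M} - {d}. 1 - p powi (int a - int d)) =
     (\<Prod>a\<in>{..<d} \<union> {Suc d..<Suc d + (M - d - 1)}. 1 - p powi (int a - int d))"
    by (rule arg_cong)
  also have "\<dots> = (\<Prod>a<d. 1 - p powi (int a - int d)) * (\<Prod>a\<in>{Suc d..<Suc d + (M - d - 1)}. 1 - p powi (int a - int d))"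
    by (rule prod.union_disjoint) auto
  also have "(\<Prod>a\<in>{Suc d..<Suc d + (M - d - 1)}. 1 - p powi (int a - int d))
      = (\<Prod>a\<in>{Suc d..<Suc d + (M - d - 1)}. 1 - p * p powi (int a - int (Suc d)))"
  proof (intro prod.cong refl)
    fix a assume "a \<in> {Suc d..<Suc d + (M - d - 1)}"
    have "int a - int d = 1 + (int a - int (Suc d))" by simp
    then show "1 - p powi (int a - int d) = 1 - p * p powi (int a - int (Suc d))"
      using assms power_int_add[of p 1 "int a - int (Suc d)"] by simp
  qed
  also have "(\<Prod>a<d. 1 - p powi (int a - int d)) = (- 1) ^ d * p powi (- tri (int d + 1)) * q_poch p p d"
    using prod_powi_below[OF assms(1), of 1 d] by simp
  finally show ?thesis
    unfolding prod_powi_above[OF assms(1)] by (simp add: mult_ac)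
qed

text \<open>Up to a constant factor, the residue of \<open>1 / (\<Prod>j\<in>J. theta (w * x j) p)\<close> at \<open>w = 1 / (x i * p powi n)\<close>,
  divided by the corresponding linear factor at \<open>w = 1\<close>.\<close>

definition appell_coeff :: "'i set \<Rightarrow> ('i \<Rightarrow> complex) \<Rightarrow> complex \<Rightarrow> 'i \<Rightarrow> int \<Rightarrow> complex" where
  "appell_coeff J x p i n = (\<Prod>j\<in>J. (- (x i / x j)) powi n * p powi tri (n + 1)) / (1 - x i * p powi n)"

text \<open>Partial fractions with nodes \<open>x i * p powi n\<close> for
  \<open>- N \<le> n < N\<close>. The exponent \<open>card J * N\<close> cancels the powers
  extracted from the lower half of each window, so a residue is the coefficient
  \<open>appell_coeff\<close>, free of \<open>N\<close>, times finite products that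
  converge.\<close>

lemma finite_appell:
  fixes x :: "'i \<Rightarrow> complex"
  assumes p: "norm p < 1" "p \<noteq> 0" and J: "finite J" "J \<noteq> {}" and N: "N > 0"
    and x0: "\<And>i. i \<in> J \<Longrightarrow> x i \<noteq> 0"
    and x1: "\<And>i n. i \<in> J \<Longrightarrow> x i * p powi n \<noteq> 1"
    and x2: "\<And>i j n. i \<in> J \<Longrightarrow> j \<in> J \<Longrightarrow> i \<noteq> j \<Longrightarrow> x i * p powi n \<noteq> x j"
  shows "1 / (\<Prod>i\<in>J. q_poch (x i) p N * q_poch (p / x i) p N) =
    (\<Sum>i\<in>J. infsum (\<lambda>n. appell_coeff J x p i n *
       ((\<Prod>j\<in>J - {i}. inverse (q_poch (x j / x i) p (nat (int N - n))) * inverse (q_poch (p / (x j / x i)) p (nat (int N + n))))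
        * (inv_q_poch p (int N - n - 1) * inv_q_poch p (int N + n)))) UNIV)"
proof -
  define c where "c = (\<lambda>(i, d). x i * p powi (int d - int N))"
  define I where "I = J \<times> {..<2 * N}"
  \<comment> \<open>The monomial that a full window of the family of \<open>x j\<close> leaves
    beside its two q-products.\<close>
  define M where "M j = (- x j) ^ N * p powi (- tri (int N + 1))" for j
  have M0: "M j \<noteq> 0" if "j \<in> J" for j using that x0 p by (auto simp: M_def)
  have inj: "inj_on c I"
  proof (rule inj_onI, clarify)
    fix i d j e assume h: "(i, d) \<in> I" "(j, e) \<in> I" "c (i, d) = c (j, e)"
    have eq: "x i * p powi (int d - int e) = x j"
    proof -
      have "p powi (int d - int N) = p powi (int d - int e) * p powi (int e - int N)"
        using p power_int_add[of p "int d - int e" "int e - int N"] by simp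
      then have "x i * p powi (int d - int e) * p powi (int e - int N) = x j * p powi (int e - int N)"
        using h(3) by (simp add: c_def mult_ac)
      then show ?thesis using p by simp
    qed
    then have ij: "i = j" using x2[of i j "int d - int e"] h by (auto simp: I_def)
    moreover have "d = e"
    proof (rule ccontr)
      assume "d \<noteq> e"
      have "x i \<noteq> 0" using x0 h by (auto simp: I_def)
      then have 1: "p powi (int d - int e) = 1" using eq ij by simp
      then have "p powi (int e - int d) = 1"
        using power_int_minus[of p "int d - int e"] by simp
      with 1 have "p ^ nat \<bar>int d - int e\<bar> = 1"
        using \<open>d \<noteq> e\<close> by (cases "d \<le> e") (auto simp: power_int_def split: if_splits)
      then show False using one_minus_power_nonzero[OF p(1), of "nat \<bar>int d - int e\<bar>"] \<open>d \<noteq> e\<close> by auto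
    qed
    ultimately show "i = j \<and> d = e" by simp
  qed
  have full: "(\<Prod>i\<in>I. 1 - c i) = (\<Prod>j\<in>J. q_poch (x j) p N * q_poch (p / x j) p N) * (\<Prod>j\<in>J. M j)"
  proof -
    have "(\<Prod>i\<in>I. 1 - c i) = (\<Prod>j\<in>J. \<Prod>d<2 * N. 1 - x j * p powi (int d - int N))"
      by (simp add: I_def c_def prod.cartesian_product case_prod_unfold)
    also have "\<dots> = (\<Prod>j\<in>J. (q_poch (x j) p N * q_poch (p / x j) p N) * M j)"
      using x0 p by (intro prod.cong refl) (subst prod_powi_window; simp add: M_def mult_ac)
    finally show ?thesis by (simp add: prod.distrib)
  qed
  have node: "(\<Prod>j\<in>J. M j) * ((1 / c (i, d)) ^ (card J * N) / (\<Prod>j\<in>I - {(i, d)}. 1 - c j / c (i, d)) / (1 - c (i, d)))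
     = appell_coeff J x p i (int d - int N) *
       ((\<Prod>j\<in>J - {i}. inverse (q_poch (x j / x i) p (2 * N - d)) * inverse (q_poch (p / (x j / x i)) p d))
        * (inv_q_poch p (int N - (int d - int N) - 1) * inv_q_poch p (int N + (int d - int N))))"
    if i: "i \<in> J" and d: "d < 2 * N" for i d
  proof -
    define n where "n = int d - int N"
    define K where "K j = (- (x j / x i)) ^ d * p powi (- tri (int d + 1))" for j
    define G where "G j = q_poch (x j / x i) p (2 * N - d) * q_poch (p / (x j / x i)) p d" for j
    have xi: "x i \<noteq> 0" using i x0 by auto
    have ratio: "c (j, a) / c (i, d) = x j / x i * p powi (int a - int d)" for j a
      using p power_int_diff[of p "int a - int N" "int d - int N"] by (simp add: c_def)
    have split: "I - {(i, d)} = (J - {i}) \<times> {..<2 * N} \<union> {i} \<times> ({..<2 * N} - {d})"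
      using i by (auto simp: I_def)
    have "(\<Prod>j\<in>I - {(i, d)}. 1 - c j / c (i, d))
        = (\<Prod>j\<in>(J - {i}) \<times> {..<2 * N}. 1 - c j / c (i, d)) * (\<Prod>j\<in>{i} \<times> ({..<2 * N} - {d}). 1 - c j / c (i, d))"
      unfolding split using J by (intro prod.union_disjoint) auto
    also have "(\<Prod>j\<in>(J - {i}) \<times> {..<2 * N}. 1 - c j / c (i, d)) = (\<Prod>j\<in>J - {i}. \<Prod>a<2 * N. 1 - x j / x i * p powi (int a - int d))"
      unfolding prod.cartesian_product by (intro prod.cong refl) (auto simp: ratio)
    also have "\<dots> = (\<Prod>j\<in>J - {i}. G j * K j)"
      using x0 xi p d by (intro prod.cong refl) (subst prod_powi_window; simp add: K_def G_def mult_ac)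
    also have "(\<Prod>j\<in>{i} \<times> ({..<2 * N} - {d}). 1 - c j / c (i, d)) = (\<Prod>a\<in>{..<2 * N} - {d}. 1 - p powi (int a - int d))"
      by (rule prod.reindex_bij_witness[of _ "\<lambda>a. (i, a)" snd]) (use xi in \<open>auto simp: ratio\<close>)
    also have "\<dots> = q_poch p p (2 * N - d - 1) * q_poch p p d * K i"
      using prod_powi_window_punctured[OF p(2) d] xi by (simp add: K_def mult_ac)
    finally have den: "(\<Prod>j\<in>I - {(i, d)}. 1 - c j / c (i, d))
       = (\<Prod>j\<in>J - {i}. G j) * (q_poch p p (2 * N - d - 1) * q_poch p p d) * (\<Prod>j\<in>J. K j)"
      using J i by (simp add: prod.distrib prod.remove[of J i K] mult_ac)
    have r1: "inv_q_poch p (int N - n - 1) = inverse (q_poch p p (2 * N - d - 1))"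
    proof -
      have "int N - n - 1 = int (2 * N - d - 1)" using d by (simp add: n_def of_nat_diff)
      then show ?thesis by (simp add: inv_q_poch_def)
    qed
    have r2: "inv_q_poch p (int N + n) = inverse (q_poch p p d)" by (simp add: inv_q_poch_def n_def)
    have cid: "c (i, d) = x i * p powi n" by (simp add: c_def n_def)
    \<comment> \<open>Here the powers depending on \<open>N\<close> and \<open>d\<close> separately
      collapse to powers depending on \<open>n = d - N\<close> alone, one family at a time.\<close>
    have fam: "M j * (1 / c (i, d)) ^ N / K j = (- (x i / x j)) powi n * p powi tri (n + 1)" if j: "j \<in> J" for j
    proof -
      have xj: "x j \<noteq> 0" using j x0 by auto
      have e: "p powi (- tri (int N + 1)) * p powi (- (n * int N)) * p powi (tri (int d + 1)) = p powi tri (n + 1)"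
      proof -
        have "- tri (int N + 1) + - (n * int N) + tri (int d + 1) = tri (n + 1)"
          using tri_add[of "int N + 1" n] tri_add[of n 1] by (simp add: n_def algebra_simps)
        then show ?thesis using p by (simp only: power_int_add[symmetric] simp_thms)
      qed
      have y: "(- x j) ^ N * (1 / x i) ^ N / (- (x j / x i)) ^ d = (- (x i / x j)) powi n"
      proof -
        define z where "z = - (x j / x i)"
        have z: "z \<noteq> 0" using xi xj by (simp add: z_def)
        have "- (x i / x j) = inverse z" by (simp add: z_def)
        then have "(- (x i / x j)) powi n = z powi (int N - int d)"
          by (simp add: n_def power_int_inverse flip: power_int_minus)
        also have "\<dots> = z ^ N / z ^ d"
          using z by (simp add: power_int_diff)
        also have "z ^ N = (- x j) ^ N * (1 / x i) ^ N"
          unfolding power_mult_distrib[symmetric] by (simp add: z_def)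
        finally show ?thesis by (simp add: z_def)
      qed
      have c1: "(1 / c (i, d)) ^ N = (1 / x i) ^ N * p powi (- (n * int N))"
        unfolding cid
        by (simp add: power_int_minus power_int_mult divide_inverse power_mult_distrib power_inverse)
      have k1: "inverse (K j) = inverse ((- (x j / x i)) ^ d) * p powi (tri (int d + 1))"
        by (simp add: K_def power_int_minus)
      have "M j * (1 / c (i, d)) ^ N / K j
          = ((- x j) ^ N * (1 / x i) ^ N / (- (x j / x i)) ^ d) *
            (p powi (- tri (int N + 1)) * p powi (- (n * int N)) * p powi (tri (int d + 1)))"
        unfolding M_def c1 divide_inverse[of _ "K j"] k1 by (simp only: mult_ac divide_inverse)
      then show ?thesis unfolding e y .
    qed
    have "(\<Prod>j\<in>J. M j) * (1 / c (i, d)) ^ (card J * N) / (\<Prod>j\<in>J. K j) = (\<Prod>j\<in>J. M j * (1 / c (i, d)) ^ N / K j)"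
      by (simp add: prod.distrib prod_dividef power_mult mult.commute[of "card J"])
    also have "\<dots> = (\<Prod>j\<in>J. (- (x i / x j)) powi n * p powi tri (n + 1))"
      by (intro prod.cong refl fam)
    finally have main: "(\<Prod>j\<in>J. M j) * (1 / c (i, d)) ^ (card J * N) / (\<Prod>j\<in>J. K j)
      = (\<Prod>j\<in>J. (- (x i / x j)) powi n * p powi tri (n + 1))" .
    have "(\<Prod>j\<in>J. M j) * ((1 / c (i, d)) ^ (card J * N) / (\<Prod>j\<in>I - {(i, d)}. 1 - c j / c (i, d)) / (1 - c (i, d)))
       = ((\<Prod>j\<in>J. M j) * (1 / c (i, d)) ^ (card J * N) / (\<Prod>j\<in>J. K j)) / (1 - c (i, d)) *
         (inverse (\<Prod>j\<in>J - {i}. G j) * (inv_q_poch p (int N - n - 1) * inv_q_poch p (int N + n)))"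
      unfolding den r1 r2 by (simp add: divide_inverse mult_ac)
    also have "inverse (\<Prod>j\<in>J - {i}. G j) = (\<Prod>j\<in>J - {i}. inverse (q_poch (x j / x i) p (2 * N - d)) * inverse (q_poch (p / (x j / x i)) p d))"
      unfolding prod_inversef[symmetric] G_def o_def by (simp add: mult_ac)
    finally show ?thesis
      unfolding main by (simp only: appell_coeff_def n_def[symmetric] cid)
  qed
  have pf: "1 / (\<Prod>i\<in>I. 1 - c i)
       = (\<Sum>i\<in>I. (1 / c i) ^ (card J * N) / (\<Prod>j\<in>I - {i}. 1 - c j / c i) / (1 - c i))"
  proof (rule partial_fractions)
    show "card J * N < card I" using J N by (simp add: I_def card_gt_0_iff)
  qed (use J x0 x1 p inj in \<open>auto simp: I_def c_def\<close>)
  have "(\<Prod>j\<in>J. M j) \<noteq> 0" using J M0 by auto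
  then have "1 / (\<Prod>i\<in>J. q_poch (x i) p N * q_poch (p / x i) p N)
      = (\<Prod>j\<in>J. M j) * (\<Sum>i\<in>I. (1 / c i) ^ (card J * N) / (\<Prod>j\<in>I - {i}. 1 - c j / c i) / (1 - c i))"
    unfolding pf[symmetric] full by simp
  also have "\<dots> = (\<Sum>i\<in>J. \<Sum>d<2 * N. appell_coeff J x p i (int d - int N) *
       ((\<Prod>j\<in>J - {i}. inverse (q_poch (x j / x i) p (2 * N - d)) * inverse (q_poch (p / (x j / x i)) p d))
        * (inv_q_poch p (int N - (int d - int N) - 1) * inv_q_poch p (int N + (int d - int N)))))"
    unfolding sum_distrib_left sum.cartesian_product I_def
    by (intro sum.cong refl) (use node in \<open>auto simp: I_def\<close>)
  also have "\<dots> = (\<Sum>i\<in>J. infsum (\<lambda>n. appell_coeff J x p i n *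
       ((\<Prod>j\<in>J - {i}. inverse (q_poch (x j / x i) p (nat (int N - n))) * inverse (q_poch (p / (x j / x i)) p (nat (int N + n))))
        * (inv_q_poch p (int N - n - 1) * inv_q_poch p (int N + n)))) UNIV)"
    (is "_ = (\<Sum>i\<in>J. infsum (?T i) UNIV)")
  proof (intro sum.cong refl)
    fix i assume "i \<in> J"
    \<comment> \<open>The two factors \<open>inv_q_poch\<close> vanish for \<open>n \<ge> N\<close>
      and for \<open>n < - N\<close> respectively.\<close>
    have "infsum (?T i) UNIV = infsum (?T i) {- int N..<int N}"
      by (rule infsum_cong_neutral) (auto simp: inv_q_poch_def)
    also have "\<dots> = sum (?T i) {- int N..<int N}" by simp
    also have "\<dots> = (\<Sum>d<2 * N. ?T i (int d - int N))"
      by (rule sum.reindex_bij_witness[of _ "\<lambda>d. int d - int N" "\<lambda>n. nat (n + int N)"]) auto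
    also have "\<dots> = (\<Sum>d<2 * N. appell_coeff J x p i (int d - int N) *
       ((\<Prod>j\<in>J - {i}. inverse (q_poch (x j / x i) p (2 * N - d)) * inverse (q_poch (p / (x j / x i)) p d))
        * (inv_q_poch p (int N - (int d - int N) - 1) * inv_q_poch p (int N + (int d - int N)))))"
    proof (intro sum.cong refl)
      fix d assume "d \<in> {..<2 * N}"
      then have "nat (int N - (int d - int N)) = 2 * N - d" "nat (int N + (int d - int N)) = d" by auto
      then show "?T i (int d - int N) = appell_coeff J x p i (int d - int N) *
       ((\<Prod>j\<in>J - {i}. inverse (q_poch (x j / x i) p (2 * N - d)) * inverse (q_poch (p / (x j / x i)) p d))
        * (inv_q_poch p (int N - (int d - int N) - 1) * inv_q_poch p (int N + (int d - int N))))"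
        by (simp only:)
    qed
    finally show "(\<Sum>d<2 * N. appell_coeff J x p i (int d - int N) *
       ((\<Prod>j\<in>J - {i}. inverse (q_poch (x j / x i) p (2 * N - d)) * inverse (q_poch (p / (x j / x i)) p d))
        * (inv_q_poch p (int N - (int d - int N) - 1) * inv_q_poch p (int N + (int d - int N))))) = infsum (?T i) UNIV" ..
  qed
  finally show ?thesis .
qed

text \<open>No pole is hit, and the reciprocal tends to 1 as \<open>n\<close> grows and to 0 as
  \<open>n\<close> decreases, so both halves are bounded sequences.\<close>

lemma pole_factor_bounded:
  fixes x p :: complex
  assumes p: "norm p < 1" "p \<noteq> 0" and x: "x \<noteq> 0" "\<And>n::int. x * p powi n \<noteq> 1"
  obtains B where "B > 0" "\<And>n::int. norm (inverse (1 - x * p powi n)) \<le> B"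
proof -
  have p0: "(\<lambda>k. p ^ k) \<longlonglongrightarrow> 0" using p by (simp add: LIMSEQ_power_zero)
  have "(\<lambda>k. inverse (1 - x * p ^ k)) \<longlonglongrightarrow> inverse (1 - x * 0)"
    by (intro tendsto_intros p0) auto
  then have "Bseq (\<lambda>k. inverse (1 - x * p ^ k))"
    by (intro convergent_imp_Bseq convergentI)
  then obtain B1 where B1: "B1 > 0" "\<And>k. norm (inverse (1 - x * p ^ k)) \<le> B1"
    by (auto elim!: BseqE)
  have "(\<lambda>k. p ^ k / (p ^ k - x)) \<longlonglongrightarrow> 0 / (0 - x)"
    using x by (intro tendsto_intros p0) auto
  then have "Bseq (\<lambda>k. p ^ k / (p ^ k - x))"
    by (intro convergent_imp_Bseq convergentI)
  then obtain B2 where B2: "B2 > 0" "\<And>k. norm (p ^ k / (p ^ k - x)) \<le> B2"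
    by (auto elim!: BseqE)
  show ?thesis
  proof (rule that[of "max B1 B2"])
    fix n :: int
    show "norm (inverse (1 - x * p powi n)) \<le> max B1 B2"
    proof (cases "n \<ge> 0")
      case True
      then have "p powi n = p ^ nat n" by (simp add: power_int_def)
      then show ?thesis using B1(2)[of "nat n"] by simp
    next
      case False
      then have "p powi n = inverse (p ^ nat (- n))" by (simp add: power_int_def power_inverse)
      then have "1 - x * p powi n = (p ^ nat (- n) - x) / p ^ nat (- n)"
        using p by (simp add: diff_divide_distrib) (simp add: divide_inverse)
      then have "inverse (1 - x * p powi n) = p ^ nat (- n) / (p ^ nat (- n) - x)"
        by simp
      then show ?thesis using B2(2)[of "nat (- n)"] by simp
    qed
  qed (use B1 in auto)
qed

lemma appell_coeff_abs_summable:
  fixes x :: "'i \<Rightarrow> complex"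
  assumes p: "norm p < 1" "p \<noteq> 0" and J: "finite J" "J \<noteq> {}" and i: "i \<in> J"
    and x0: "\<And>i. i \<in> J \<Longrightarrow> x i \<noteq> 0" and x1: "\<And>n. x i * p powi n \<noteq> 1"
  shows "(\<lambda>n. norm (appell_coeff J x p i n)) summable_on UNIV"
proof -
  obtain B where B: "B > 0" "\<And>n. norm (inverse (1 - x i * p powi n)) \<le> B"
    using pole_factor_bounded[OF p x0[OF i] x1] by blast
  define D where "D = (\<Prod>j\<in>J. norm (x i / x j))"
  define r where "r = norm p ^ card J"
  have D: "D > 0" unfolding D_def using x0 i by (intro prod_pos) auto
  have r: "0 < r" "r < 1" using p J by (auto simp: r_def power_less_one_iff card_gt_0_iff)
  have num: "norm (\<Prod>j\<in>J. (- (x i / x j)) powi n * p powi tri (n + 1)) = r powi tri n * (r * D) powi n" for n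
  proof -
    have "norm (\<Prod>j\<in>J. (- (x i / x j)) powi n * p powi tri (n + 1))
        = (\<Prod>j\<in>J. norm (x i / x j) powi n) * (norm p powi tri (n + 1)) ^ card J"
      by (simp add: norm_mult norm_power_int norm_divide norm_power prod.distrib flip: prod_norm)
    also have "(\<Prod>j\<in>J. norm (x i / x j) powi n) = D powi n"
      unfolding D_def using J(1) by (induction J rule: finite_induct) (auto simp: power_int_mult_distrib)
    also have "(norm p powi tri (n + 1)) ^ card J = r powi (tri n + n)"
      using tri_add[of n 1] by (simp add: r_def power_int_power power_int_power' mult.commute)
    also have "r powi (tri n + n) = r powi tri n * r powi n" using r by (simp add: power_int_add)
    finally show ?thesis by (simp add: power_int_mult_distrib)
  qed
  have "(\<lambda>n. B * (r powi tri n * (r * D) powi n)) summable_on UNIV"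
    using r D by (intro summable_on_cmult_right summable_on_gauss) auto
  then show ?thesis
  proof (rule summable_on_comparison_test)
    show "norm (appell_coeff J x p i n) \<le> B * (r powi tri n * (r * D) powi n)" for n
    proof -
      have "norm (appell_coeff J x p i n)
          = norm (\<Prod>j\<in>J. (- (x i / x j)) powi n * p powi tri (n + 1)) * norm (inverse (1 - x i * p powi n))"
        by (simp only: appell_coeff_def divide_inverse norm_mult)
      also have "\<dots> \<le> (r powi tri n * (r * D) powi n) * B"
        unfolding num using r D by (intro mult_left_mono B(2)) auto
      finally show ?thesis by (simp add: mult_ac)
    qed
  qed auto
qed

text \<open>The limit of \<open>finite_appell\<close>. The last two hypotheses keep 1 away from the
  poles and make the poles simple; they also bound the finite products uniformly in \<open>N\<close>
  and \<open>n\<close>.\<close>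

theorem theta_partial_fractions:
  fixes x :: "'i \<Rightarrow> complex"
  assumes p: "norm p < 1" "p \<noteq> 0" and J: "finite J" "J \<noteq> {}"
    and x0: "\<And>i. i \<in> J \<Longrightarrow> x i \<noteq> 0"
    and x1: "\<And>i n. i \<in> J \<Longrightarrow> x i * p powi n \<noteq> 1"
    and x2: "\<And>i j n. i \<in> J \<Longrightarrow> j \<in> J \<Longrightarrow> i \<noteq> j \<Longrightarrow> x i * p powi n \<noteq> x j"
  shows "1 / (\<Prod>i\<in>J. q_poch_inf (x i) p * q_poch_inf (p / x i) p) =
    (\<Sum>i\<in>J. infsum (appell_coeff J x p i) UNIV *
       ((\<Prod>j\<in>J - {i}. inverse (q_poch_inf (x j / x i) p) * inverse (q_poch_inf (p / (x j / x i)) p))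
        * (inverse (q_poch_inf p p) * inverse (q_poch_inf p p))))"
proof -
  have k1: "y * p ^ k \<noteq> 1" "p / y * p ^ k \<noteq> 1" if "y \<noteq> 0" "\<And>n. y * p powi n \<noteq> 1" for y k
  proof -
    show "y * p ^ k \<noteq> 1" using that(2)[of "int k"] by simp
    show "p / y * p ^ k \<noteq> 1"
    proof
      assume "p / y * p ^ k = 1"
      then have "p ^ Suc k = y" using that(1) by (simp add: field_simps)
      then have "y * p powi (- int (Suc k)) = 1"
        using that(1) unfolding power_int_minus power_int_of_nat by simp
      then show False using that(2) by blast
    qed
  qed
  have xr: "x j / x i * p powi n \<noteq> 1" if "i \<in> J" "j \<in> J" "i \<noteq> j" for i j n
    using x2[of j i n] x0[of i] that by (auto simp: field_simps)
  let ?F = "\<lambda>N i n. appell_coeff J x p i n *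
       ((\<Prod>j\<in>J - {i}. inverse (q_poch (x j / x i) p (nat (int N - n))) * inverse (q_poch (p / (x j / x i)) p (nat (int N + n))))
        * (inv_q_poch p (int N - n - 1) * inv_q_poch p (int N + n)))"
  let ?c = "\<lambda>i. (\<Prod>j\<in>J - {i}. inverse (q_poch_inf (x j / x i) p) * inverse (q_poch_inf (p / (x j / x i)) p))
        * (inverse (q_poch_inf p p) * inverse (q_poch_inf p p))"
  have lim: "(\<lambda>N. infsum (?F N i) UNIV) \<longlonglongrightarrow> infsum (\<lambda>n. appell_coeff J x p i n * ?c i) UNIV"
    if i: "i \<in> J" for i
  proof -
    obtain R where R: "R > 0" "\<And>k. norm (inv_q_poch p k) \<le> R" using inv_q_poch_bounded[OF p(1)] by blast
    have "\<forall>j\<in>J - {i}. \<exists>B. \<forall>n m. norm (inverse (q_poch (x j / x i) p n) * inverse (q_poch (p / (x j / x i)) p m)) \<le> B"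
    proof
      fix j assume j: "j \<in> J - {i}"
      have y: "x j / x i \<noteq> 0" "\<And>n. x j / x i * p powi n \<noteq> 1" using j i x0 xr by auto
      have "Bseq (\<lambda>n. inverse (q_poch (x j / x i) p n))" "Bseq (\<lambda>n. inverse (q_poch (p / (x j / x i)) p n))"
        by (intro Bseq_inverse_q_poch p k1 y)+
      then obtain B1 B2 where "\<And>n. norm (inverse (q_poch (x j / x i) p n)) \<le> B1" "B1 > 0"
        "\<And>n. norm (inverse (q_poch (p / (x j / x i)) p n)) \<le> B2"
        by (auto elim!: BseqE)
      then have "norm (inverse (q_poch (x j / x i) p n) * inverse (q_poch (p / (x j / x i)) p m)) \<le> B1 * B2" for n m
        unfolding norm_mult by (intro mult_mono) auto
      then show "\<exists>B. \<forall>n m. norm (inverse (q_poch (x j / x i) p n) * inverse (q_poch (p / (x j / x i)) p m)) \<le> B"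
        by blast
    qed
    then obtain B where B: "\<And>j n m. j \<in> J - {i} \<Longrightarrow>
        norm (inverse (q_poch (x j / x i) p n) * inverse (q_poch (p / (x j / x i)) p m)) \<le> B j"
      by metis
    define C where "C = (\<Prod>j\<in>J - {i}. B j)"
    show ?thesis
    proof (rule tendsto_infsum_int[where h = "\<lambda>n. norm (appell_coeff J x p i n) * (C * (R * R))"])
      show "(\<lambda>N. ?F N i n) \<longlonglongrightarrow> appell_coeff J x p i n * ?c i" for n
      proof -
        have "(\<lambda>N. inverse (q_poch (x j / x i) p (nat (int N - n)))) \<longlonglongrightarrow> inverse (q_poch_inf (x j / x i) p)"
          "(\<lambda>N. inverse (q_poch (p / (x j / x i)) p (nat (int N + n)))) \<longlonglongrightarrow> inverse (q_poch_inf (p / (x j / x i)) p)"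
          if j: "j \<in> J - {i}" for j
        proof -
          have y: "x j / x i \<noteq> 0" "\<And>n. x j / x i * p powi n \<noteq> 1" using j i x0 xr by auto
          have "(\<lambda>N. inverse (q_poch (x j / x i) p (nat (int N + - n)))) \<longlonglongrightarrow> inverse (q_poch_inf (x j / x i) p)"
            by (intro tendsto_nat_offset tendsto_inverse q_poch_tendsto q_poch_inf_nonzero p k1 y)
          then show "(\<lambda>N. inverse (q_poch (x j / x i) p (nat (int N - n)))) \<longlonglongrightarrow> inverse (q_poch_inf (x j / x i) p)" by simp
          show "(\<lambda>N. inverse (q_poch (p / (x j / x i)) p (nat (int N + n)))) \<longlonglongrightarrow> inverse (q_poch_inf (p / (x j / x i)) p)"
            by (intro tendsto_nat_offset tendsto_inverse q_poch_tendsto q_poch_inf_nonzero p k1 y)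
        qed
        moreover have "(\<lambda>N. inv_q_poch p (int N - n - 1)) \<longlonglongrightarrow> inverse (q_poch_inf p p)"
          using inv_q_poch_tendsto[OF p(1), of "- n - 1"] by (simp add: algebra_simps)
        moreover have "(\<lambda>N. inv_q_poch p (int N + n)) \<longlonglongrightarrow> inverse (q_poch_inf p p)"
          by (rule inv_q_poch_tendsto[OF p(1)])
        ultimately show ?thesis by (intro tendsto_mult tendsto_const tendsto_prod) auto
      qed
      show "norm (?F N i n) \<le> norm (appell_coeff J x p i n) * (C * (R * R))" for N n
      proof -
        have "norm (\<Prod>j\<in>J - {i}. inverse (q_poch (x j / x i) p (nat (int N - n))) * inverse (q_poch (p / (x j / x i)) p (nat (int N + n)))) \<le> C"
          unfolding C_def prod_norm[symmetric] by (intro prod_mono conjI B) auto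
        moreover have "norm (inv_q_poch p (int N - n - 1) * inv_q_poch p (int N + n)) \<le> R * R"
          unfolding norm_mult using R by (intro mult_mono) auto
        ultimately show ?thesis
          unfolding norm_mult[of "appell_coeff J x p i n"] norm_mult[of "prod _ _"]
          by (intro mult_left_mono mult_mono) (auto intro: order_trans[OF norm_ge_zero])
      qed
      show "(\<lambda>n. norm (appell_coeff J x p i n) * (C * (R * R))) summable_on UNIV"
        by (intro summable_on_cmult_left appell_coeff_abs_summable p J i x0 x1)
    qed
  qed
  have "(\<lambda>N. \<Sum>i\<in>J. infsum (?F N i) UNIV) \<longlonglongrightarrow> (\<Sum>i\<in>J. infsum (\<lambda>n. appell_coeff J x p i n * ?c i) UNIV)"
    by (intro tendsto_sum lim)
  moreover have "eventually (\<lambda>N. (\<Sum>i\<in>J. infsum (?F N i) UNIV) = 1 / (\<Prod>i\<in>J. q_poch (x i) p N * q_poch (p / x i) p N)) sequentially"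
    using eventually_gt_at_top[of 0]
    by eventually_elim (rule finite_appell[OF p J _ x0 x1 x2, symmetric])
  ultimately have "(\<lambda>N. 1 / (\<Prod>i\<in>J. q_poch (x i) p N * q_poch (p / x i) p N))
      \<longlonglongrightarrow> (\<Sum>i\<in>J. infsum (\<lambda>n. appell_coeff J x p i n * ?c i) UNIV)"
    by (rule Lim_transform_eventually)
  moreover have "(\<lambda>N. 1 / (\<Prod>i\<in>J. q_poch (x i) p N * q_poch (p / x i) p N)) \<longlonglongrightarrow> 1 / (\<Prod>i\<in>J. q_poch_inf (x i) p * q_poch_inf (p / x i) p)"
  proof (intro tendsto_divide tendsto_const tendsto_prod tendsto_mult q_poch_tendsto p)
    show "(\<Prod>i\<in>J. q_poch_inf (x i) p * q_poch_inf (p / x i) p) \<noteq> 0"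
      using J q_poch_inf_nonzero[OF p(1) k1(1)] q_poch_inf_nonzero[OF p(1) k1(2)] x0 x1 by auto
  qed
  ultimately have "1 / (\<Prod>i\<in>J. q_poch_inf (x i) p * q_poch_inf (p / x i) p)
      = (\<Sum>i\<in>J. infsum (\<lambda>n. appell_coeff J x p i n * ?c i) UNIV)"
    using LIMSEQ_unique by blast
  then show ?thesis by (simp only: infsum_cmult_left')
qed

text \<open>The Appell sum of level 3, with the pole \<open>x\<close> and the multiplier
  \<open>c\<close> independent: residues at three points have \<open>c\<close> depending on all
  three, whereas the rank generating function has \<open>c = 1\<close>.\<close>

definition appell3 :: "complex \<Rightarrow> complex \<Rightarrow> complex \<Rightarrow> complex" where
  "appell3 p x c = infsum (\<lambda>n. (- 1) powi n * p powi (3 * tri (n + 1)) * c powi n / (1 - x * p powi n)) UNIV"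

lemma power_int_minus_one_square: "(- 1 :: complex) powi n * ((- 1) powi n * z) = z"
  unfolding mult.assoc[symmetric] power_int_mult_distrib[symmetric] by simp

lemma appell_coeff_three:
  fixes x :: "nat \<Rightarrow> complex"
  shows "appell_coeff {0, 1, 2} x p i n
    = (- 1) powi n * p powi (3 * tri (n + 1)) * (x i / x 0 * (x i / x 1) * (x i / x 2)) powi n / (1 - x i * p powi n)"
proof -
  have m: "(- (x i / x j)) powi n = (- 1) powi n * (x i / x j) powi n" for j
    using power_int_mult_distrib[of "-1" "x i / x j" n] by simp
  have e: "p powi (3 * tri (n + 1)) = p powi tri (n + 1) * p powi tri (n + 1) * p powi tri (n + 1)"
    unfolding mult.commute[of 3] power_int_mult by (simp add: power3_eq_cube)
  show ?thesis
    unfolding appell_coeff_def m e power_int_mult_distrib[of _ _ n]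
    by (simp add: power_int_minus_one_square mult_ac)
qed

text \<open>Factors \<open>(p; p)\<close> balance: three are hidden in the thetas on the left, and
  the two in each residue complete the two thetas at ratios of points.\<close>

theorem three_theta_partial_fractions:
  assumes p: "norm p < 1" "p \<noteq> 0" and x0: "x1 \<noteq> 0" "x2 \<noteq> 0" "x3 \<noteq> 0"
    and x1: "\<And>n. x1 * p powi n \<noteq> 1" "\<And>n. x2 * p powi n \<noteq> 1" "\<And>n. x3 * p powi n \<noteq> 1"
    and x2: "\<And>n. x1 * p powi n \<noteq> x2" "\<And>n. x1 * p powi n \<noteq> x3" "\<And>n. x2 * p powi n \<noteq> x3"
  shows "q_poch_inf p p ^ 3 / (theta x1 p * theta x2 p * theta x3 p) =
      appell3 p x1 (x1\<^sup>2 / (x2 * x3)) / (theta (x2 / x1) p * theta (x3 / x1) p)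
    + appell3 p x2 (x2\<^sup>2 / (x1 * x3)) / (theta (x1 / x2) p * theta (x3 / x2) p)
    + appell3 p x3 (x3\<^sup>2 / (x1 * x2)) / (theta (x1 / x3) p * theta (x2 / x3) p)"
proof -
  define x where "x = (\<lambda>i::nat. if i = 0 then x1 else if i = 1 then x2 else x3)"
  have [simp]: "x 0 = x1" "x (Suc 0) = x2" "x 2 = x3" by (auto simp: x_def)
  have sym: "a * p powi n \<noteq> b" if "\<And>n. b * p powi n \<noteq> a" for a b n
    using that[of "- n"] p by (auto simp: power_int_minus field_simps)
  define Q where "Q = q_poch_inf p p"
  have Q: "Q \<noteq> 0" unfolding Q_def by (rule q_poch_inf_self_nonzero[OF p(1)])
  have D: "{0, 1, 2::nat} - {0} = {1, 2}" "{0, 1, 2::nat} - {1} = {0, 2}" "{0, 1, 2::nat} - {2} = {0, 1}"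
    by auto
  have A: "infsum (appell_coeff {0, 1, 2} x p 0) UNIV = appell3 p x1 (x1\<^sup>2 / (x2 * x3))"
    "infsum (appell_coeff {0, 1, 2} x p 1) UNIV = appell3 p x2 (x2\<^sup>2 / (x1 * x3))"
    "infsum (appell_coeff {0, 1, 2} x p 2) UNIV = appell3 p x3 (x3\<^sup>2 / (x1 * x2))"
    unfolding appell3_def appell_coeff_three using x0
    by (auto intro!: infsum_cong simp: power2_eq_square mult_ac)
  have "1 / (\<Prod>i\<in>{0, 1, 2}. q_poch_inf (x i) p * q_poch_inf (p / x i) p) =
    (\<Sum>i\<in>{0, 1, 2}. infsum (appell_coeff {0, 1, 2} x p i) UNIV *
       ((\<Prod>j\<in>{0, 1, 2} - {i}. inverse (q_poch_inf (x j / x i) p) * inverse (q_poch_inf (p / (x j / x i)) p))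
        * (inverse (q_poch_inf p p) * inverse (q_poch_inf p p))))"
  proof (rule theta_partial_fractions[OF p])
    show "x i * p powi n \<noteq> x j" if "i \<in> {0, 1, 2}" "j \<in> {0, 1, 2}" "i \<noteq> j" for i j n
      using that x2 sym[OF x2(1)] sym[OF x2(2)] sym[OF x2(3)] by (auto simp: x_def split: if_splits)
  qed (use x0 x1 in \<open>auto simp: x_def\<close>)
  then have "1 / (q_poch_inf x1 p * q_poch_inf (p / x1) p * (q_poch_inf x2 p * q_poch_inf (p / x2) p * (q_poch_inf x3 p * q_poch_inf (p / x3) p))) =
      appell3 p x1 (x1\<^sup>2 / (x2 * x3)) * ((inverse (q_poch_inf (x2 / x1) p) * inverse (q_poch_inf (p / (x2 / x1)) p)) *
        (inverse (q_poch_inf (x3 / x1) p) * inverse (q_poch_inf (p / (x3 / x1)) p)) * (inverse Q * inverse Q))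
    + appell3 p x2 (x2\<^sup>2 / (x1 * x3)) * ((inverse (q_poch_inf (x1 / x2) p) * inverse (q_poch_inf (p / (x1 / x2)) p)) *
        (inverse (q_poch_inf (x3 / x2) p) * inverse (q_poch_inf (p / (x3 / x2)) p)) * (inverse Q * inverse Q))
    + appell3 p x3 (x3\<^sup>2 / (x1 * x2)) * ((inverse (q_poch_inf (x1 / x3) p) * inverse (q_poch_inf (p / (x1 / x3)) p)) *
        (inverse (q_poch_inf (x2 / x3) p) * inverse (q_poch_inf (p / (x2 / x3)) p)) * (inverse Q * inverse Q))"
    using D A by (simp add: Q_def add.assoc)
  moreover have "q_poch_inf p p ^ 3 / (theta x1 p * theta x2 p * theta x3 p)
      = 1 / (q_poch_inf x1 p * q_poch_inf (p / x1) p * (q_poch_inf x2 p * q_poch_inf (p / x2) p * (q_poch_inf x3 p * q_poch_inf (p / x3) p)))"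
    using Q unfolding theta_def Q_def[symmetric] by (simp add: power3_eq_cube)
  ultimately show ?thesis
    unfolding theta_def Q_def[symmetric] divide_inverse[of "appell3 _ _ _"] inverse_mult_distrib
    by (simp only: mult_ac)
qed

section \<open>The Durfee square identity and the Appell form\<close>

lemma nat_le_mult_add: "(m::nat) \<le> m * (m + a)"
  by (cases m) auto

context
  fixes q :: complex
  assumes q1: "norm q < 1"
begin

lemma durfee_summable:
  assumes "\<And>m. m \<le> e m" "\<And>m. norm (f m) \<le> C"
  shows "summable (\<lambda>m. norm (q ^ e m * f m))"
proof (rule summable_comparison_test)
  have "C \<ge> 0" using assms(2)[of 0] norm_ge_zero order_trans by blast
  have "norm (q ^ e m * f m) \<le> norm q ^ m * C" for m
    unfolding norm_mult norm_power using assms q1 \<open>C \<ge> 0\<close>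
    by (intro mult_mono power_decreasing) auto
  then show "\<exists>N. \<forall>m\<ge>N. norm (norm (q ^ e m * f m)) \<le> norm q ^ m * C" by auto
  show "summable (\<lambda>m. norm q ^ m * C)"
    using q1 by (intro summable_mult2 summable_geometric) auto
qed

text \<open>Dissection of partitions by the largest Durfee rectangle of sides \<open>m\<close> and
  \<open>m + a\<close>; hence the value is the partition generating function for every
  \<open>a\<close>.\<close>

definition durfee_sum :: "nat \<Rightarrow> complex" where
  "durfee_sum a = (\<Sum>m. q ^ (m * (m + a)) * (inv_q_poch q (int m) * inv_q_poch q (int m + int a)))"

text \<open>The difference of two consecutive sums satisfies \<open>Y a = - q ^ (a + 1) * Y (a + 1)\<close> and is bounded
  uniformly in \<open>a\<close>, so it vanishes.\<close>

lemma durfee_sum_Suc: "durfee_sum (Suc a) = durfee_sum a"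
proof -
  obtain B where B: "B > 0" "\<And>k. norm (inv_q_poch q k) \<le> B" using inv_q_poch_bounded[OF q1] by blast
  have BB: "norm (inv_q_poch q k * inv_q_poch q l) \<le> B * B" for k l
    unfolding norm_mult using B by (intro mult_mono) auto
  \<comment> \<open>The difference of the \<open>m\<close>-th terms of \<open>durfee_sum a\<close>
    and \<open>durfee_sum (Suc a)\<close> over a common denominator; \<open>suminf (t a)\<close> is
    the \<open>Y a\<close> described above.\<close>
  define t where "t a m = q ^ (m * (m + a)) * (inv_q_poch q (int m) * inv_q_poch q (int m + int a + 1) * (1 - q ^ m - q ^ (m + a + 1)))" for a m
  define K where "K = (\<Sum>m. norm q ^ m * (B * B * 3))"
  have nt: "norm (t a m) \<le> norm q ^ m * (B * B * 3)" for a m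
  proof -
    have "norm (1 - q ^ m - q ^ (m + a + 1)) \<le> norm (1 - q ^ m) + norm (q ^ (m + a + 1))"
      by (rule norm_triangle_ineq4)
    also have "norm (1 - q ^ m) \<le> norm (1::complex) + norm (q ^ m)"
      by (rule norm_triangle_ineq4)
    also have "norm (1::complex) + norm (q ^ m) + norm (q ^ (m + a + 1)) \<le> 1 + 1 + 1"
      using q1 by (intro add_mono) (auto simp: norm_power norm_mult power_le_one intro!: mult_le_one)
    finally have "norm (inv_q_poch q (int m) * inv_q_poch q (int m + int a + 1) * (1 - q ^ m - q ^ (m + a + 1))) \<le> B * B * 3"
      unfolding norm_mult[of "_ * _"] using BB B by (intro mult_mono) auto
    moreover have "norm (q ^ (m * (m + a))) \<le> norm q ^ m"
      unfolding norm_power using q1 by (intro power_decreasing nat_le_mult_add) auto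
    ultimately show ?thesis unfolding t_def norm_mult[of "q ^ _"] by (intro mult_mono) auto
  qed
  have sK: "summable (\<lambda>m. norm q ^ m * (B * B * 3))"
    using q1 by (intro summable_mult2 summable_geometric) auto
  have st: "summable (t a)" for a
    by (rule summable_comparison_test[OF _ sK]) (use nt in auto)
  have Y_bound: "norm (suminf (t a)) \<le> K" for a
    unfolding K_def by (rule norm_suminf_le[OF nt sK])
  have rec: "suminf (t a) = - (q ^ (a + 1)) * suminf (t (Suc a))" for a
  proof -
    \<comment> \<open>The last factor of \<open>t\<close> is split as
      \<open>(1 - q ^ m) - q ^ (m + a + 1)\<close>. The first part lowers an index and vanishes at
      \<open>m = 0\<close>, so it can be shifted by one and recombined with the second part into
      \<open>t (Suc a)\<close>.\<close>
    define u where "u m = q ^ (m * (m + a)) * (inv_q_poch q (int m - 1) * inv_q_poch q (int m + int a + 1))" for m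
    define v where "v m = q ^ (m * (m + a) + m + a + 1) * (inv_q_poch q (int m) * inv_q_poch q (int m + int a + 1))" for m
    have su: "summable u" unfolding u_def
      by (rule summable_norm_cancel, rule durfee_summable[OF nat_le_mult_add BB])
    have sv: "summable v" unfolding v_def
      by (rule summable_norm_cancel, rule durfee_summable[OF _ BB]) simp
    have "t a m = u m - v m" for m
    proof -
      have r: "inv_q_poch q (int m - 1) = (1 - q ^ m) * inv_q_poch q (int m)"
        using inv_q_poch_rec[OF q1, of "int m"] by simp
      show ?thesis unfolding t_def u_def v_def r by (simp add: power_add algebra_simps)
    qed
    then have "suminf (t a) = (\<Sum>m. u m - v m)" by (intro suminf_cong)
    also have "\<dots> = suminf u - suminf v"
      by (rule suminf_diff[OF su sv, symmetric])
    also have "suminf u = (\<Sum>m. u (Suc m))"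
      using suminf_split_head[OF su] by (simp add: u_def inv_q_poch_def)
    also have "(\<Sum>m. u (Suc m)) - suminf v = (\<Sum>m. u (Suc m) - v m)"
      using su sv by (intro suminf_diff) (auto simp: summable_Suc_iff)
    also have "\<dots> = (\<Sum>m. - (q ^ (a + 1)) * t (Suc a) m)"
    proof (rule suminf_cong)
      fix m
      define R where "R = inv_q_poch q (int m + int a + 2)"
      have r: "inv_q_poch q (int m + int a + 1) = (1 - q ^ (m + a + 2)) * R"
        using inv_q_poch_rec[OF q1, of "int (m + a + 2)"] unfolding power_int_of_nat R_def by (simp add: algebra_simps)
      have e: "int (Suc m) - 1 = int m" "int (Suc m) + int a + 1 = int m + int a + 2"
        "int m + int (Suc a) + 1 = int m + int a + 2" by auto
      show "u (Suc m) - v m = - (q ^ (a + 1)) * t (Suc a) m"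
        unfolding u_def v_def t_def e r R_def[symmetric] by (simp add: power_add algebra_simps power2_eq_square)
    qed
    also have "\<dots> = - (q ^ (a + 1)) * suminf (t (Suc a))"
      by (rule suminf_mult[OF st])
    finally show ?thesis .
  qed
  have "norm (suminf (t a)) \<le> norm q ^ k * K" for k
  proof (induction k arbitrary: a)
    case 0
    show ?case using Y_bound by simp
  next
    case (Suc k)
    have "norm (suminf (t a)) = norm q ^ (a + 1) * norm (suminf (t (Suc a)))"
      unfolding rec[of a] by (simp only: norm_mult norm_minus_cancel norm_power)
    also have "\<dots> \<le> norm q ^ 1 * (norm q ^ k * K)"
      using q1 Suc.IH by (intro mult_mono power_decreasing) auto
    finally show ?case by simp
  qed
  moreover have "(\<lambda>k. norm q ^ k * K) \<longlonglongrightarrow> 0 * K"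
    using q1 by (intro tendsto_intros LIMSEQ_realpow_zero) auto
  ultimately have "norm (suminf (t a)) \<le> 0 * K"
    by (intro LIMSEQ_le_const) auto
  then have Y0: "suminf (t a) = 0" by simp
  have s: "summable (\<lambda>m. q ^ (m * (m + a)) * (inv_q_poch q (int m) * inv_q_poch q (int m + int a)))" for a
    by (rule summable_norm_cancel, rule durfee_summable[OF nat_le_mult_add BB])
  have "durfee_sum a - durfee_sum (Suc a) = suminf (t a)"
    unfolding durfee_sum_def suminf_diff[OF s s]
  proof (rule suminf_cong)
    fix m
    have r: "inv_q_poch q (int m + int a) = (1 - q ^ (m + a + 1)) * inv_q_poch q (int m + int a + 1)"
      using inv_q_poch_rec[OF q1, of "int (m + a + 1)"] unfolding power_int_of_nat by (simp add: algebra_simps)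
    have e: "int m + int (Suc a) = int m + int a + 1" by simp
    show "q ^ (m * (m + a)) * (inv_q_poch q (int m) * inv_q_poch q (int m + int a)) -
         q ^ (m * (m + Suc a)) * (inv_q_poch q (int m) * inv_q_poch q (int m + int (Suc a))) = t a m"
      unfolding t_def r e by (simp add: power_add algebra_simps)
  qed
  then show ?thesis using Y0 by simp
qed

text \<open>The sum is constant in \<open>a\<close>. As the index grows, the terms with
  \<open>m > 0\<close> are suppressed by \<open>norm q ^ k\<close>, and the term
  \<open>m = 0\<close> tends to the claimed value.\<close>

lemma durfee_identity: "durfee_sum a = inverse (q_poch_inf q q)"
proof -
  obtain B where B: "B > 0" "\<And>k. norm (inv_q_poch q k) \<le> B" using inv_q_poch_bounded[OF q1] by blast
  have BB: "norm (inv_q_poch q k * inv_q_poch q l) \<le> B * B" for k l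
    unfolding norm_mult using B by (intro mult_mono) auto
  have const: "durfee_sum (a + k) = durfee_sum a" for k
    by (induction k) (simp_all add: durfee_sum_Suc)
  have bd: "norm (durfee_sum k - inv_q_poch q (int k)) \<le> norm q ^ k * (\<Sum>m. norm q ^ m * (B * B))" for k
  proof -
    define f where "f m = q ^ (m * (m + k)) * (inv_q_poch q (int m) * inv_q_poch q (int m + int k))" for m
    have "summable f" unfolding f_def
      by (rule summable_norm_cancel, rule durfee_summable[OF nat_le_mult_add BB])
    moreover have f0: "f 0 = inv_q_poch q (int k)" by (simp add: f_def inv_q_poch_def)
    ultimately have "durfee_sum k - inv_q_poch q (int k) = (\<Sum>m. f (Suc m))"
      unfolding durfee_sum_def f_def[symmetric] using suminf_split_head[of f] f0 by simp
    also have "norm \<dots> \<le> (\<Sum>m. norm q ^ k * (norm q ^ m * (B * B)))"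
    proof (rule norm_suminf_le)
      show "summable (\<lambda>m. norm q ^ k * (norm q ^ m * (B * B)))"
        using q1 by (intro summable_mult summable_mult2 summable_geometric) auto
      show "norm (f (Suc m)) \<le> norm q ^ k * (norm q ^ m * (B * B))" for m
      proof -
        have "norm (f (Suc m)) \<le> norm q ^ (k + m) * (B * B)"
          unfolding f_def norm_mult[of "q ^ _"] norm_power using q1 BB B
          by (intro mult_mono power_decreasing) auto
        then show ?thesis by (simp add: power_add mult_ac)
      qed
    qed
    also have "\<dots> = norm q ^ k * (\<Sum>m. norm q ^ m * (B * B))"
      using q1 by (intro suminf_mult summable_mult2 summable_geometric) auto
    finally show ?thesis .
  qed
  have "(\<lambda>k. norm q ^ k * (\<Sum>m. norm q ^ m * (B * B))) \<longlonglongrightarrow> 0 * (\<Sum>m. norm q ^ m * (B * B))"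
    using q1 by (intro tendsto_intros LIMSEQ_realpow_zero) auto
  then have lim0: "(\<lambda>k. norm q ^ k * (\<Sum>m. norm q ^ m * (B * B))) \<longlonglongrightarrow> 0"
    by (simp only: mult_zero_left)
  have "(\<lambda>k. durfee_sum k - inv_q_poch q (int k)) \<longlonglongrightarrow> 0"
    by (rule Lim_null_comparison[OF _ lim0]) (intro always_eventually allI bd)
  moreover have "(\<lambda>k. inv_q_poch q (int k)) \<longlonglongrightarrow> inverse (q_poch_inf q q)"
    using inv_q_poch_tendsto[OF q1, of 0] by simp
  ultimately have "(\<lambda>k. (durfee_sum k - inv_q_poch q (int k)) + inv_q_poch q (int k)) \<longlonglongrightarrow> 0 + inverse (q_poch_inf q q)"
    using tendsto_add by blast
  then have "durfee_sum \<longlonglongrightarrow> inverse (q_poch_inf q q)" by simp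
  then have "(\<lambda>k. durfee_sum (k + a)) \<longlonglongrightarrow> inverse (q_poch_inf q q)"
    by (rule LIMSEQ_ignore_initial_segment)
  then have "(\<lambda>k::nat. durfee_sum a) \<longlonglongrightarrow> inverse (q_poch_inf q q)"
    by (simp only: const add.commute[of _ a])
  then show ?thesis by (simp only: LIMSEQ_const_iff)
qed

text \<open>With \<open>D = m + k\<close> the exponent \<open>D * (D + 1)\<close> is
  \<open>k * (k + 1) + m * (m + (2 * k + 1))\<close>, so this is \<open>durfee_identity\<close> at
  \<open>a = 2 * k + 1\<close>.\<close>

lemma durfee_has_sum_aux:
  "((\<lambda>D. q ^ (D * (D + 1)) * (inv_q_poch q (int D - int k) * inv_q_poch q (int D + 1 + int k)))
     has_sum (q ^ (k * (k + 1)) * inverse (q_poch_inf q q))) (UNIV :: nat set)"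
proof -
  obtain B where B: "B > 0" "\<And>k. norm (inv_q_poch q k) \<le> B" using inv_q_poch_bounded[OF q1] by blast
  have BB: "norm (inv_q_poch q k * inv_q_poch q l) \<le> B * B" for k l
    unfolding norm_mult using B by (intro mult_mono) auto
  let ?f = "\<lambda>m. q ^ (m * (m + (2 * k + 1))) * (inv_q_poch q (int m) * inv_q_poch q (int m + int (2 * k + 1)))"
  have "summable (\<lambda>m. norm (?f m))"
    by (rule durfee_summable[OF _ BB]) (simp add: algebra_simps)
  then have "(?f has_sum suminf ?f) UNIV"
    by (intro norm_summable_imp_has_sum summable_sums) (auto intro: summable_norm_cancel)
  then have "(?f has_sum inverse (q_poch_inf q q)) UNIV"
    using durfee_identity[of "2 * k + 1"] unfolding durfee_sum_def by simp
  then have "((\<lambda>m. q ^ (k * (k + 1)) * ?f m) has_sum (q ^ (k * (k + 1)) * inverse (q_poch_inf q q))) UNIV"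
    by (rule has_sum_cmult_right)
  also have "?this \<longleftrightarrow> ((\<lambda>D. q ^ (D * (D + 1)) * (inv_q_poch q (int D - int k) * inv_q_poch q (int D + 1 + int k)))
     has_sum (q ^ (k * (k + 1)) * inverse (q_poch_inf q q))) {k..}"
  proof (rule has_sum_reindex_bij_witness[of _ "\<lambda>D. D - k" "\<lambda>m. m + k"])
    fix m :: nat
    have "(m + k) * (m + k + 1) = k * (k + 1) + m * (m + (2 * k + 1))" by (simp add: algebra_simps)
    then have "q ^ ((m + k) * (m + k + 1)) = q ^ (k * (k + 1)) * q ^ (m * (m + (2 * k + 1)))"
      by (simp only: power_add)
    then show "q ^ ((m + k) * (m + k + 1)) * (inv_q_poch q (int (m + k) - int k) * inv_q_poch q (int (m + k) + 1 + int k)) = q ^ (k * (k + 1)) * ?f m"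
      by (simp add: algebra_simps)
  qed auto
  also have "\<dots> \<longleftrightarrow> ((\<lambda>D. q ^ (D * (D + 1)) * (inv_q_poch q (int D - int k) * inv_q_poch q (int D + 1 + int k)))
     has_sum (q ^ (k * (k + 1)) * inverse (q_poch_inf q q))) UNIV"
    by (rule has_sum_cong_neutral) (auto simp: inv_q_poch_def)
  finally show ?thesis .
qed

text \<open>Negative \<open>n\<close> reduce to the previous case by \<open>n\<close> to
  \<open>- 1 - n\<close>, which swaps the two reciprocals.\<close>

lemma durfee_has_sum:
  "((\<lambda>D. q ^ (D * (D + 1)) * (inv_q_poch q (int D - n) * inv_q_poch q (int D + 1 + n)))
     has_sum (q powi (2 * tri (n + 1)) * inverse (q_poch_inf q q))) (UNIV :: nat set)"
proof (cases "n \<ge> 0")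
  case True
  define k where "k = nat n"
  have n: "n = int k" using True by (simp add: k_def)
  have "2 * tri (n + 1) = int (k * (k + 1))" unfolding two_tri n by (simp add: algebra_simps)
  then show ?thesis using durfee_has_sum_aux[of k] n by (simp only: power_int_of_nat)
next
  case False
  define k where "k = nat (- 1 - n)"
  have n: "n = - 1 - int k" using False by (simp add: k_def)
  have e: "2 * tri (n + 1) = int (k * (k + 1))" unfolding two_tri n by (simp add: algebra_simps)
  have "int D - n = int D + 1 + int k" "int D + 1 + n = int D - int k" for D using n by auto
  then show ?thesis using durfee_has_sum_aux[of k] unfolding e power_int_of_nat by (simp only: mult_ac)
qed

text \<open>Each summand is a finite Appell sum with a single pole family, by
  \<open>finite_appell\<close> at \<open>N = D + 1\<close>. After interchanging sums, the sum over
  \<open>D\<close> contributes \<open>2 * tri (n + 1)\<close>, which joins the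
  \<open>tri (n + 1)\<close> of the partial fractions: this is where level 3 comes from.\<close>

theorem eulerian_eq_appell:
  assumes q0: "q \<noteq> 0" and x0: "x \<noteq> 0" and x1: "\<And>n. x * q powi n \<noteq> 1"
  shows "((\<lambda>D. q ^ (D * (D + 1)) / (q_poch x q (D + 1) * q_poch (q / x) q (D + 1)))
     has_sum (appell3 q x 1 * inverse (q_poch_inf q q))) (UNIV :: nat set)"
proof -
  obtain B where B: "B > 0" "\<And>k. norm (inv_q_poch q k) \<le> B" using inv_q_poch_bounded[OF q1] by blast
  have BB: "norm (inv_q_poch q k * inv_q_poch q l) \<le> B * B" for k l
    unfolding norm_mult using B by (intro mult_mono) auto
  define A where "A = appell_coeff {()} (\<lambda>_. x) q ()"
  have A: "A n = (- 1) powi n * q powi tri (n + 1) / (1 - x * q powi n)" for n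
    using x0 by (simp add: A_def appell_coeff_def)
  have sA: "(\<lambda>n. norm (A n)) summable_on UNIV"
    unfolding A_def by (rule appell_coeff_abs_summable) (use q1 q0 x0 x1 in auto)
  define f where "f D n = q ^ (D * (D + 1)) * (A n * (inv_q_poch q (int D - n) * inv_q_poch q (int D + 1 + n)))" for D :: nat and n
  have row: "infsum (f D) UNIV = q ^ (D * (D + 1)) / (q_poch x q (D + 1) * q_poch (q / x) q (D + 1))" for D
  proof -
    have "1 / (q_poch x q (D + 1) * q_poch (q / x) q (D + 1)) = infsum (\<lambda>n. A n * (inv_q_poch q (int D - n) * inv_q_poch q (int D + 1 + n))) UNIV"
      using finite_appell[of q "{()}" "D + 1" "\<lambda>_. x"] q1 q0 x0 x1 by (simp add: A_def algebra_simps)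
    then show ?thesis
      unfolding f_def by (simp add: infsum_cmult_right' divide_inverse)
  qed
  \<comment> \<open>The interchange is licensed by summability of \<open>A\<close> in
    \<open>n\<close>, boundedness of the reciprocals, and geometric decay in \<open>D\<close> from
    \<open>D \<le> D * (D + 1)\<close>.\<close>
  have abs: "(\<lambda>z. norm (case z of (D, n) \<Rightarrow> f D n)) summable_on UNIV \<times> UNIV"
  proof (rule Infinite_Sum.abs_summable_on_comparison_test)
    show "(\<lambda>z. norm (case z of (D, n) \<Rightarrow> norm q ^ D * (B * B * norm (A n)))) summable_on UNIV \<times> UNIV"
    proof (subst Infinite_Sum.abs_summable_on_Sigma_iff, intro conjI ballI)
      have "(\<lambda>D. norm q ^ D * (B * B * infsum (\<lambda>n. norm (A n)) UNIV)) summable_on UNIV"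
        using q1 by (intro summable_on_cmult_left summable_nonneg_imp_summable_on summable_geometric) auto
      then show "(\<lambda>D. norm (infsum (\<lambda>n. norm (case (D, n) of (D, n) \<Rightarrow> norm q ^ D * (B * B * norm (A n)))) UNIV)) summable_on UNIV"
        using B by (simp add: abs_mult infsum_cmult_right' infsum_nonneg)
      show "(\<lambda>n. norm (case (D, n) of (D, n) \<Rightarrow> norm q ^ D * (B * B * norm (A n)))) summable_on UNIV" for D
        using sA B by (auto simp: abs_mult intro!: summable_on_cmult_right)
    qed
    fix z :: "nat \<times> int"
    obtain D n where z: "z = (D, n)" by fastforce
    have "norm (f D n) \<le> norm q ^ D * (norm (A n) * (B * B))"
      unfolding f_def norm_mult[of "q ^ _"] norm_mult[of "A n"] norm_power
      using q1 BB B by (intro mult_mono power_decreasing mult_nonneg_nonneg) auto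
    then show "norm (case z of (D, n) \<Rightarrow> f D n) \<le> norm (case z of (D, n) \<Rightarrow> norm q ^ D * (B * B * norm (A n)))"
      using B by (simp add: z abs_mult mult_ac)
  qed
  then have sf: "(\<lambda>(D, n). f D n) summable_on UNIV \<times> UNIV" by (rule abs_summable_summable)
  have col: "infsum (\<lambda>D. f D n) UNIV = A n * (q powi (2 * tri (n + 1)) * inverse (q_poch_inf q q))" for n
  proof (rule infsumI)
    have "((\<lambda>D. A n * (q ^ (D * (D + 1)) * (inv_q_poch q (int D - n) * inv_q_poch q (int D + 1 + n))))
     has_sum (A n * (q powi (2 * tri (n + 1)) * inverse (q_poch_inf q q)))) UNIV"
      by (intro has_sum_cmult_right durfee_has_sum)
    then show "((\<lambda>D. f D n) has_sum (A n * (q powi (2 * tri (n + 1)) * inverse (q_poch_inf q q)))) UNIV"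
      by (simp add: f_def mult_ac)
  qed
  have "infsum (\<lambda>D. infsum (f D) UNIV) UNIV = infsum (\<lambda>n. infsum (\<lambda>D. f D n) UNIV) UNIV"
    by (rule infsum_swap_banach[OF sf])
  also have "\<dots> = infsum (\<lambda>n. A n * (q powi (2 * tri (n + 1)) * inverse (q_poch_inf q q))) UNIV"
    by (simp only: col)
  also have "\<dots> = appell3 q x 1 * inverse (q_poch_inf q q)"
  proof -
    have "A n * (q powi (2 * tri (n + 1)) * inverse (q_poch_inf q q))
      = (- 1) powi n * q powi (3 * tri (n + 1)) * 1 powi n / (1 - x * q powi n) * inverse (q_poch_inf q q)" for n
    proof -
      have "q powi (3 * tri (n + 1)) = q powi tri (n + 1) * q powi (2 * tri (n + 1))"
        using q0 power_int_add[of q "tri (n + 1)" "2 * tri (n + 1)"] by simp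
      then show ?thesis by (simp add: A mult_ac)
    qed
    then show ?thesis unfolding appell3_def by (simp only: infsum_cmult_left')
  qed
  finally have "infsum (\<lambda>D. infsum (f D) UNIV) UNIV = appell3 q x 1 * inverse (q_poch_inf q q)" .
  moreover have "(\<lambda>D. infsum (f D) UNIV) summable_on UNIV"
    by (rule summable_on_Sigma_banach[OF sf])
  ultimately have "((\<lambda>D. infsum (f D) UNIV) has_sum (appell3 q x 1 * inverse (q_poch_inf q q))) UNIV"
    unfolding has_sum_iff by blast
  then show ?thesis by (simp only: row)
qed

end

section \<open>The generating function of the odd rank\<close>

lemma has_sum_times:
  fixes f :: "'a \<Rightarrow> complex" and g :: "'b \<Rightarrow> complex"
  assumes f: "(f has_sum S) A" and g: "(g has_sum T) B"
  shows "((\<lambda>(x, y). f x * g y) has_sum (S * T)) (A \<times> B)"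
proof (rule has_sum_SigmaI)
  show "((\<lambda>y. case (x, y) of (x, y) \<Rightarrow> f x * g y) has_sum (f x * T)) B" for x
    using g by (simp add: has_sum_cmult_right)
  show "((\<lambda>x. f x * T) has_sum (S * T)) A"
    using f by (rule has_sum_cmult_left)
  have fa: "(\<lambda>x. norm (f x)) summable_on A" and ga: "(\<lambda>x. norm (g x)) summable_on B"
    using f g by (auto simp: summable_on_iff_abs_summable_on_complex[symmetric] dest: has_sum_imp_summable)
  have "(\<lambda>z. norm (case z of (x, y) \<Rightarrow> f x * g y)) summable_on A \<times> B"
  proof (subst Infinite_Sum.abs_summable_on_Sigma_iff, intro conjI ballI)
    show "(\<lambda>y. norm (case (x, y) of (x, y) \<Rightarrow> f x * g y)) summable_on B" for x
      using ga by (simp add: norm_mult summable_on_cmult_right)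
    show "(\<lambda>x. norm (infsum (\<lambda>y. norm (case (x, y) of (x, y) \<Rightarrow> f x * g y)) B)) summable_on A"
      using fa by (simp add: norm_mult infsum_cmult_right' abs_mult summable_on_cmult_left)
  qed
  then show "(\<lambda>(x, y). f x * g y) summable_on A \<times> B" by (rule abs_summable_summable)
qed

text \<open>Indexed by the number \<open>k\<close> of admissible part sizes, so that induction
  starts with the empty row only; subscript \<open>D\<close> corresponds to
  \<open>k = D + 1\<close>.\<close>

definition odd_rows :: "nat \<Rightarrow> nat list set" where
  "odd_rows k = {xs. sorted_wrt (\<ge>) xs \<and> (\<forall>x\<in>set xs. odd x \<and> x < 2 * k)}"

lemma odd_durfee_row_iff: "odd_durfee_row D xs \<longleftrightarrow> xs \<in> odd_rows (D + 1)"
  unfolding odd_durfee_row_def odd_rows_def by auto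

lemma odd_rows_0: "odd_rows 0 = {[]}"
  by (auto simp: odd_rows_def)

text \<open>Rows are non-increasing, so all copies of the new largest size form an initial block,
  whose length is arbitrary.\<close>

lemma odd_rows_Suc:
  "bij_betw (\<lambda>(j, xs). replicate j (2 * k + 1) @ xs) (UNIV \<times> odd_rows k) (odd_rows (Suc k))"
proof (rule bij_betw_byWitness[where f' = "\<lambda>xs. (length (takeWhile ((=) (2 * k + 1)) xs), dropWhile ((=) (2 * k + 1)) xs)"])
  let ?f = "\<lambda>(j, xs). replicate j (2 * k + 1) @ xs"
  let ?g = "\<lambda>xs. (length (takeWhile ((=) (2 * k + 1)) xs), dropWhile ((=) (2 * k + 1)) xs)"
  show "\<forall>a\<in>UNIV \<times> odd_rows k. ?g (?f a) = a"
  proof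
    fix a assume "a \<in> (UNIV :: nat set) \<times> odd_rows k"
    then obtain j xs where a: "a = (j, xs)" and xs: "xs \<in> odd_rows k" by auto
    then have "xs = [] \<or> hd xs \<noteq> 2 * k + 1" by (cases xs) (auto simp: odd_rows_def)
    then have "takeWhile ((=) (2 * k + 1)) xs = []" "dropWhile ((=) (2 * k + 1)) xs = xs"
      by (cases xs; auto)+
    then have "length (takeWhile ((=) (2 * k + 1)) (replicate j (2 * k + 1) @ xs)) = j \<and>
        dropWhile ((=) (2 * k + 1)) (replicate j (2 * k + 1) @ xs) = xs"
      by (induction j) auto
    then show "?g (?f a) = a" by (simp add: a)
  qed
  have tw: "takeWhile ((=) c) xs = replicate (length (takeWhile ((=) c) xs)) c" for c and xs :: "nat list"
    by (induction xs) auto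
  show "\<forall>xs\<in>odd_rows (Suc k). ?f (?g xs) = xs"
    using tw[of "2 * k + 1"] by (simp del: replicate.simps)
  show "?f ` (UNIV \<times> odd_rows k) \<subseteq> odd_rows (Suc k)"
  proof clarify
    fix j xs assume xs: "xs \<in> odd_rows k"
    have "sorted_wrt (\<ge>) (replicate j (2 * k + 1))" by (induction j) auto
    moreover have "x < 2 * k" if "x \<in> set xs" for x using xs that by (auto simp: odd_rows_def)
    ultimately show "replicate j (2 * k + 1) @ xs \<in> odd_rows (Suc k)"
      using xs by (force simp: odd_rows_def sorted_wrt_append)
  qed
  show "?g ` odd_rows (Suc k) \<subseteq> UNIV \<times> odd_rows k"
  proof (intro image_subsetI SigmaI UNIV_I)
    fix xs assume xs: "xs \<in> odd_rows (Suc k)"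
    let ?ys = "dropWhile ((=) (2 * k + 1)) xs"
    have sub: "set ?ys \<subseteq> set xs" by (meson set_dropWhileD subsetI)
    have split: "takeWhile ((=) (2 * k + 1)) xs @ ?ys = xs" by simp
    have sorted: "sorted_wrt (\<ge>) ?ys"
      using xs split unfolding odd_rows_def by (metis (no_types, lifting) mem_Collect_eq sorted_wrt_append)
    have "x < 2 * k" if x: "x \<in> set ?ys" for x
    proof -
      obtain y ys where ys: "?ys = y # ys" using x by (metis list.set_cases)
      have "y \<noteq> 2 * k + 1" using ys by (simp add: dropWhile_eq_Cons_conv)
      moreover have "y < 2 * Suc k" "odd y" using xs sub ys by (auto simp: odd_rows_def)
      ultimately have "y < 2 * k + 1" by simp
      moreover have "x \<le> y" using sorted x ys by auto
      moreover have "odd x" using x sub xs by (auto simp: odd_rows_def)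
      ultimately show ?thesis by (metis Suc_eq_plus1 dvd_triv_left less_Suc_eq_le nat_less_le order.trans)
    qed
    then show "?ys \<in> odd_rows k"
      using sorted sub xs by (auto simp: odd_rows_def)
  qed
qed

lemma odd_rows_has_sum:
  fixes z Q :: complex
  assumes z: "norm z = 1" and Q: "norm Q < 1"
  shows "((\<lambda>xs. z ^ length xs * Q ^ sum_list xs) has_sum inverse (q_poch (z * Q) (Q\<^sup>2) k)) (odd_rows k)"
proof (induction k)
  case 0
  show ?case by (simp add: odd_rows_0 has_sum_finiteI)
next
  case (Suc k)
  define w where "w = z * Q ^ (2 * k + 1)"
  have nw: "norm w < 1"
    using z Q norm_power_less_one[of Q "2 * k + 1"] by (simp add: w_def norm_mult)
  have "((\<lambda>j. w ^ j) has_sum (1 / (1 - w))) UNIV"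
    using nw by (intro norm_summable_imp_has_sum geometric_sums) (auto simp: norm_power intro!: summable_geometric)
  then have "((\<lambda>(j, xs). w ^ j * (z ^ length xs * Q ^ sum_list xs)) has_sum
      (1 / (1 - w) * inverse (q_poch (z * Q) (Q\<^sup>2) k))) (UNIV \<times> odd_rows k)"
    using Suc.IH by (rule has_sum_times)
  also have "1 / (1 - w) * inverse (q_poch (z * Q) (Q\<^sup>2) k) = inverse (q_poch (z * Q) (Q\<^sup>2) (Suc k))"
    by (simp add: q_poch_Suc w_def divide_inverse power_mult[symmetric] mult_ac)
  also have "(\<lambda>(j, xs). w ^ j * (z ^ length xs * Q ^ sum_list xs)) =
      (\<lambda>a. (\<lambda>xs. z ^ length xs * Q ^ sum_list xs) (case a of (j, xs) \<Rightarrow> replicate j (2 * k + 1) @ xs))"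
    by (auto simp: fun_eq_iff w_def sum_list_replicate power_add power_mult_distrib power_mult[symmetric] mult_ac)
  finally show ?case
    by (rule has_sum_reindex_bij_betw[OF odd_rows_Suc, where f = "\<lambda>xs. z ^ length xs * Q ^ sum_list xs", THEN iffD1])
qed

text \<open>The number \<open>c n\<close> of the overview, with \<open>z\<close> arbitrary.\<close>

definition rank_weight :: "complex \<Rightarrow> nat \<Rightarrow> complex" where
  "rank_weight z n = (\<Sum>\<sigma>\<in>odd_durfee_symbols n. z powi odd_rank \<sigma>)"

text \<open>The weighted family of all symbols is summed in two ways: by subscript, which gives
  \<open>T\<close>, and by size, which gives the coefficients
  \<open>rank_weight z n\<close>.\<close>

theorem rank_weight_generating_function:
  fixes z Q :: complex
  assumes z: "norm z = 1" and Q: "norm Q < 1"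
    and T: "((\<lambda>D. Q ^ (2 * D\<^sup>2 + 2 * D + 1) / (q_poch (z * Q) (Q\<^sup>2) (D + 1) * q_poch (Q / z) (Q\<^sup>2) (D + 1))) has_sum T) UNIV"
  shows "((\<lambda>n. rank_weight z n * Q ^ n) has_sum T) UNIV"
proof -
  define w where "w z xs = z ^ length xs * Q ^ sum_list xs" for z and xs :: "nat list"
  \<comment> \<open>The bottom row carries \<open>inverse z\<close> because it enters the rank with
    a minus sign.\<close>
  define W where "W = (\<lambda>(D::nat, as, bs). Q ^ (2 * D\<^sup>2 + 2 * D + 1) * (w z as * w (inverse z) bs))"
  define Sy where "Sy = Sigma UNIV (\<lambda>D. odd_rows (D + 1) \<times> odd_rows (D + 1))"
  have z0: "z \<noteq> 0" "norm (inverse z) = 1" using z by (auto simp: norm_inverse)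
  have row: "((\<lambda>y. W (D, y)) has_sum (Q ^ (2 * D\<^sup>2 + 2 * D + 1) / (q_poch (z * Q) (Q\<^sup>2) (D + 1) * q_poch (Q / z) (Q\<^sup>2) (D + 1))))
      (odd_rows (D + 1) \<times> odd_rows (D + 1))" for D
  proof -
    have "((\<lambda>(as, bs). w z as * w (inverse z) bs) has_sum
       (inverse (q_poch (z * Q) (Q\<^sup>2) (D + 1)) * inverse (q_poch (inverse z * Q) (Q\<^sup>2) (D + 1)))) (odd_rows (D + 1) \<times> odd_rows (D + 1))"
      unfolding w_def by (intro has_sum_times odd_rows_has_sum z Q z0)
    from has_sum_cmult_right[OF this, of "Q ^ (2 * D\<^sup>2 + 2 * D + 1)"] show ?thesis
      by (simp add: W_def case_prod_unfold divide_inverse mult_ac)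
  qed
  have "(\<lambda>s. norm (W s)) summable_on Sy"
    unfolding Sy_def
  proof (subst Infinite_Sum.abs_summable_on_Sigma_iff, intro conjI ballI)
    fix D :: nat
    show "(\<lambda>y. norm (W (D, y))) summable_on odd_rows (D + 1) \<times> odd_rows (D + 1)"
      using row[of D] by (simp add: summable_on_iff_abs_summable_on_complex[symmetric] has_sum_imp_summable)
  next
    \<comment> \<open>With \<open>z = 1\<close> and \<open>Q\<close> replaced by its norm,
      \<open>odd_rows_has_sum\<close> evaluates the sums of norms; that lemma is complex-valued,
      hence the coercion.\<close>
    define r where "r = complex_of_real (norm Q)"
    have r: "norm r < 1" using Q by (simp add: r_def)
    have "Bseq (\<lambda>n. inverse (q_poch r (r\<^sup>2) n))"
    proof (rule Bseq_inverse_q_poch)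
      show "norm (r\<^sup>2) < 1" using norm_power_less_one[OF r, of 2] by simp
      show "r * (r\<^sup>2) ^ k \<noteq> 1" for k
        using one_minus_power_nonzero[OF r, of "Suc (2 * k)"] by (simp add: power_mult)
    qed
    then obtain B where B: "B > 0" "\<And>n. norm (inverse (q_poch r (r\<^sup>2) n)) \<le> B" by (auto elim!: BseqE)
    have inner: "norm (infsum (\<lambda>y. norm (W (D, y))) (odd_rows (D + 1) \<times> odd_rows (D + 1))) \<le> norm Q ^ D * (B * B)" for D
    proof -
      define I where "I = inverse (q_poch r (r\<^sup>2) (D + 1))"
      have "((\<lambda>xs. 1 ^ length xs * r ^ sum_list xs) has_sum inverse (q_poch (1 * r) (r\<^sup>2) (D + 1))) (odd_rows (D + 1))"
        by (rule odd_rows_has_sum) (use r in auto)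
      then have s: "((\<lambda>xs. r ^ sum_list xs) has_sum I) (odd_rows (D + 1))" by (simp add: I_def)
      have "((\<lambda>(as, bs). r ^ sum_list as * r ^ sum_list bs) has_sum (I * I)) (odd_rows (D + 1) \<times> odd_rows (D + 1))"
        by (rule has_sum_times[OF s s])
      from has_sum_cmult_right[OF this, of "r ^ (2 * D\<^sup>2 + 2 * D + 1)"]
      have "((\<lambda>y. complex_of_real (norm (W (D, y)))) has_sum (r ^ (2 * D\<^sup>2 + 2 * D + 1) * (I * I))) (odd_rows (D + 1) \<times> odd_rows (D + 1))"
        using z z0 by (simp add: W_def w_def r_def case_prod_unfold norm_mult norm_power)
      moreover have "(\<lambda>y. norm (W (D, y))) summable_on odd_rows (D + 1) \<times> odd_rows (D + 1)"
        using row[of D] by (simp add: summable_on_iff_abs_summable_on_complex[symmetric] has_sum_imp_summable)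
      ultimately have "complex_of_real (infsum (\<lambda>y. norm (W (D, y))) (odd_rows (D + 1) \<times> odd_rows (D + 1))) = r ^ (2 * D\<^sup>2 + 2 * D + 1) * (I * I)"
        using has_sum_of_real has_sum_unique has_sum_infsum by blast
      then have "norm (infsum (\<lambda>y. norm (W (D, y))) (odd_rows (D + 1) \<times> odd_rows (D + 1))) = norm (r ^ (2 * D\<^sup>2 + 2 * D + 1) * (I * I))"
        by (metis norm_of_real real_norm_def)
      also have "\<dots> \<le> norm Q ^ D * (B * B)"
      proof -
        have "norm r ^ (2 * D\<^sup>2 + 2 * D + 1) \<le> norm Q ^ D"
          unfolding r_def norm_of_real abs_norm_cancel using Q by (intro power_decreasing) auto
        then show ?thesis
          unfolding norm_mult norm_power I_def using B by (intro mult_mono) auto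
      qed
      finally show ?thesis .
    qed
    have "(\<lambda>D. norm Q ^ D * (B * B)) summable_on UNIV"
      using Q by (intro summable_on_cmult_left summable_nonneg_imp_summable_on summable_geometric) auto
    then show "(\<lambda>D. norm (infsum (\<lambda>y. norm (W (D, y))) (odd_rows (D + 1) \<times> odd_rows (D + 1)))) summable_on UNIV"
      by (rule summable_on_comparison_test) (use inner in auto)
  qed
  then have "W summable_on Sy" by (rule abs_summable_summable)
  then obtain S where total: "(W has_sum S) Sy" by (auto simp: summable_on_def)
  have "((\<lambda>D. Q ^ (2 * D\<^sup>2 + 2 * D + 1) / (q_poch (z * Q) (Q\<^sup>2) (D + 1) * q_poch (Q / z) (Q\<^sup>2) (D + 1))) has_sum S) UNIV"
    by (rule has_sum_Sigma'[OF total[unfolded Sy_def] row])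
  then have "S = T" using T has_sum_unique by blast
  with total have "(W has_sum T) Sy" by simp
  also have "?this \<longleftrightarrow> ((\<lambda>(n, s). W s) has_sum T) (Sigma UNIV odd_durfee_symbols)"
    by (rule has_sum_reindex_bij_witness[of _ snd "\<lambda>(D, as, bs). (sum_list as + sum_list bs + 2 * D\<^sup>2 + 2 * D + 1, D, as, bs)"])
       (auto simp: Sy_def odd_durfee_symbols_def odd_durfee_row_iff)
  finally have "((\<lambda>(n, s). W s) has_sum T) (Sigma UNIV odd_durfee_symbols)" .
  then show ?thesis
  proof (rule has_sum_Sigma')
    fix n :: nat
    have "W s = z powi odd_rank s * Q ^ n" if "s \<in> odd_durfee_symbols n" for s
    proof -
      obtain D as bs where s: "s = (D, as, bs)" by (cases s) auto
      have n: "n = sum_list as + sum_list bs + 2 * D\<^sup>2 + 2 * D + 1"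
        using that by (simp add: s odd_durfee_symbols_def)
      show ?thesis
        unfolding n using z0 by (simp add: s W_def w_def power_int_diff power_add divide_inverse power_inverse mult_ac)
    qed
    then show "((\<lambda>s. case (n, s) of (n, s) \<Rightarrow> W s) has_sum (rank_weight z n * Q ^ n)) (odd_durfee_symbols n)"
      by (intro has_sum_finiteI finite_odd_durfee_symbols) (simp add: rank_weight_def sum_distrib_right)
  qed
qed

section \<open>Dissection of the Appell sums\<close>

lemma infsum_int_residues:
  fixes f :: "int \<Rightarrow> complex"
  assumes f: "f summable_on UNIV" and m: "m > 0"
  shows "infsum f UNIV = (\<Sum>r\<in>{0..<m}. infsum (\<lambda>k. f (m * k + r)) UNIV)"
proof -
  have "f summable_on UNIV \<longleftrightarrow> (\<lambda>(r, k). f (m * k + r)) summable_on {0..<m} \<times> UNIV"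
    by (rule summable_on_reindex_bij_witness[of _ "\<lambda>(r, k). m * k + r" "\<lambda>n. (n mod m, n div m)"]) (use m in auto)
  with f have s: "(\<lambda>(r, k). f (m * k + r)) summable_on {0..<m} \<times> UNIV" by simp
  have "infsum f UNIV = infsum (\<lambda>(r, k). f (m * k + r)) ({0..<m} \<times> UNIV)"
    by (rule infsum_reindex_bij_witness[of _ "\<lambda>(r, k). m * k + r" "\<lambda>n. (n mod m, n div m)"]) (use m in auto)
  also have "\<dots> = infsum (\<lambda>r. infsum (\<lambda>k. f (m * k + r)) UNIV) {0..<m}"
    using infsum_Sigma'_banach[OF s] by simp
  finally show ?thesis by simp
qed

text \<open>The components of \<open>appell3 (Q\<^sup>2) (z * Q) 1\<close> for \<open>z ^ 4 = - 1\<close> under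
  \<open>1 / (1 - y) = (1 + y + y\<^sup>2 + y ^ 3) / (1 - y ^ 4)\<close>.\<close>

definition appell_part :: "int \<Rightarrow> complex \<Rightarrow> complex" where
  "appell_part j q = infsum (\<lambda>n. (- 1) powi n * q powi (3 * tri (n + 1) + j * n) / (1 + q powi (4 * n + 2))) UNIV"

section \<open>Residue classes modulo 4 and theta functions of nome \<open>q ^ 16\<close>\<close>

context
  fixes q p :: complex
  assumes q: "norm q < 1" "q \<noteq> 0" and p: "p = q ^ 16"
begin

lemma norm_powi_inject: "norm q powi k = norm q powi l \<longleftrightarrow> k = l"
proof
  assume e: "norm q powi k = norm q powi l"
  show "k = l"
  proof (rule ccontr)
    assume "k \<noteq> l"
    then have "norm q powi k \<noteq> norm q powi l"
      using q power_int_strict_decreasing[of k l "norm q"] power_int_strict_decreasing[of l k "norm q"]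
      by (cases "k < l") auto
    then show False using e by simp
  qed
qed simp

text \<open>Norms alone separate the points, so signs are irrelevant, and every distinctness
  condition on signed powers of \<open>q\<close> becomes a divisibility by 16.\<close>

lemma monomials_distinct:
  assumes "norm x = norm q powi k" "norm y = norm q powi l" "\<not> 16 dvd (k - l)"
  shows "x * p powi n \<noteq> y"
proof
  assume "x * p powi n = y"
  then have "norm x * norm q powi (16 * n) = norm y"
    unfolding p by (metis norm_mult norm_power_int norm_power power_int_power of_nat_numeral)
  then have "norm q powi (k + 16 * n) = norm q powi l"
    using assms q by (simp add: power_int_add)
  then have "k - l = 16 * (- n)" by (simp add: norm_powi_inject)
  then show False using assms(3) by (metis dvd_triv_left)
qed

lemma one_plus_nonzero:
  assumes "e \<noteq> 0"
  shows "1 + q powi e \<noteq> 0"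
proof
  assume "1 + q powi e = 0"
  then have "q powi e = - 1" by (simp add: eq_neg_iff_add_eq_0 add.commute)
  then have "norm (q powi e) = 1" by simp
  then have "norm q powi e = norm q powi 0" by (simp add: norm_power_int)
  then show False using assms norm_powi_inject by blast
qed

lemma norm_p: "norm p < 1" "p \<noteq> 0"
  unfolding p using q norm_power_less_one[OF q(1), of 16] by auto

lemma appell_part_summable:
  "(\<lambda>n. (- 1) powi n * q powi (3 * tri (n + 1) + j * n) / (1 + q powi (4 * n + 2))) summable_on UNIV"
proof -
  have q4: "norm (q ^ 4) < 1" "q ^ 4 \<noteq> 0" using q norm_power_less_one[OF q(1), of 4] by auto
  have eq: "1 - (- (q\<^sup>2)) * (q ^ 4) powi n = 1 + q powi (4 * n + 2)" for n
    using q power_int_add[of q "4 * n" 2] by (simp add: power_int_power mult.commute)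
  have "- (q\<^sup>2) * (q ^ 4) powi n \<noteq> 1" for n
  proof
    assume h: "- (q\<^sup>2) * (q ^ 4) powi n = 1"
    have "1 - (- (q\<^sup>2)) * (q ^ 4) powi n \<noteq> 0"
      unfolding eq by (rule one_plus_nonzero) presburger
    then show False unfolding h by simp
  qed
  then obtain B where B: "B > 0" "\<And>n. norm (inverse (1 - (- (q\<^sup>2)) * (q ^ 4) powi n)) \<le> B"
    using pole_factor_bounded[OF q4, of "- (q\<^sup>2)"] q by auto
  define r where "r = norm q ^ 3"
  define D where "D = norm q powi j"
  have r: "0 < r" "r < 1" using q power_less_one_iff[of "norm q" 3] by (auto simp: r_def)
  have D: "D > 0" using q by (simp add: D_def)
  have "(\<lambda>n. B * (r powi tri n * (r * D) powi n)) summable_on UNIV"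
    using r D by (intro summable_on_cmult_right summable_on_gauss) auto
  then have "(\<lambda>n. norm ((- 1) powi n * q powi (3 * tri (n + 1) + j * n) / (1 + q powi (4 * n + 2)))) summable_on UNIV"
  proof (rule summable_on_comparison_test)
    fix n
    have "norm ((- 1) powi n * q powi (3 * tri (n + 1) + j * n)) = norm q powi (3 * tri n + (3 * n + j * n))"
      using tri_add[of n 1] by (simp add: norm_mult norm_power_int algebra_simps)
    also have "\<dots> = r powi tri n * (r * D) powi n"
    proof -
      have "r powi tri n = norm q powi (3 * tri n)" by (simp add: r_def power_int_power)
      moreover have "r powi n = norm q powi (3 * n)" by (simp add: r_def power_int_power)
      moreover have "D powi n = norm q powi (j * n)" by (simp add: D_def power_int_mult)
      ultimately show ?thesis using q by (simp add: power_int_mult_distrib power_int_add)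
    qed
    finally have num: "norm ((- 1) powi n * q powi (3 * tri (n + 1) + j * n)) = r powi tri n * (r * D) powi n" .
    have "norm ((- 1) powi n * q powi (3 * tri (n + 1) + j * n) / (1 + q powi (4 * n + 2)))
       = norm ((- 1) powi n * q powi (3 * tri (n + 1) + j * n)) * norm (inverse (1 - (- (q\<^sup>2)) * (q ^ 4) powi n))"
      unfolding eq by (simp only: divide_inverse norm_mult)
    also have "\<dots> \<le> (r powi tri n * (r * D) powi n) * B"
      unfolding num using r D by (intro mult_left_mono B(2)) auto
    finally show "norm ((- 1) powi n * q powi (3 * tri (n + 1) + j * n) / (1 + q powi (4 * n + 2)))
      \<le> B * (r powi tri n * (r * D) powi n)" by (simp add: mult_ac)
  qed auto
  then show ?thesis by (rule abs_summable_summable)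
qed

text \<open>Under \<open>n = 4 * k + r\<close> the quadratic part of the exponent becomes
  \<open>48 * tri (k + 1)\<close>, which is level 3 again in nome \<open>q ^ 16\<close>. As
  \<open>(- 1) powi (4 * k) = 1\<close>, the minus sign of the multiplier cancels the
  \<open>(- 1) powi k\<close> built into \<open>appell3\<close>.\<close>

lemma appell_part_residue:
  "infsum (\<lambda>k. (- 1) powi (4 * k + r) * q powi (3 * tri (4 * k + r + 1) + j * (4 * k + r)) / (1 + q powi (4 * (4 * k + r) + 2))) UNIV
   = (- 1) powi r * q powi (3 * tri (r + 1) + j * r) * appell3 p (- (q powi (4 * r + 2))) (- (q powi (12 * r + 4 * j - 18)))"
proof -
  have "(- 1) powi (4 * k + r) * q powi (3 * tri (4 * k + r + 1) + j * (4 * k + r)) / (1 + q powi (4 * (4 * k + r) + 2))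
     = (- 1) powi r * q powi (3 * tri (r + 1) + j * r) *
      ((- 1) powi k * p powi (3 * tri (k + 1)) * (- (q powi (12 * r + 4 * j - 18))) powi k / (1 - (- (q powi (4 * r + 2))) * p powi k))" for k
  proof -
    have s: "(- 1 :: complex) powi (4 * k + r) = (- 1) powi r"
      by (simp add: power_int_add power_int_mult)
    have "3 * tri (4 * k + r + 1) + j * (4 * k + r) = (3 * tri (r + 1) + j * r) + (48 * tri (k + 1) + (12 * r + 4 * j - 18) * k)"
      using two_tri[of "4 * k + r + 1"] two_tri[of "r + 1"] two_tri[of "k + 1"] by (simp add: algebra_simps)
    then have e: "q powi (3 * tri (4 * k + r + 1) + j * (4 * k + r))
       = q powi (3 * tri (r + 1) + j * r) * (p powi (3 * tri (k + 1)) * (q powi (12 * r + 4 * j - 18)) powi k)"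
      using q by (simp add: p power_int_add power_int_power power_int_mult[symmetric])
    have d: "1 - (- (q powi (4 * r + 2))) * p powi k = 1 + q powi (4 * (4 * k + r) + 2)"
      using q power_int_add[of q "4 * r + 2" "16 * k"] by (simp add: p power_int_power algebra_simps)
    have m: "(- (q powi (12 * r + 4 * j - 18))) powi k = (- 1) powi k * (q powi (12 * r + 4 * j - 18)) powi k"
      using power_int_mult_distrib[of "-1" "q powi (12 * r + 4 * j - 18)" k] by simp
    have u: "(- 1 :: complex) powi k * P * ((- 1) powi k * R) = P * R" for P R
      using power_int_minus_one_square[of k "P * R"] by (simp add: mult_ac)
    show ?thesis unfolding s e d m u by simp
  qed
  then show ?thesis
    unfolding appell3_def by (simp only: infsum_cmult_right')
qed

lemma appell_part_split:
  "appell_part j q = (\<Sum>r\<in>{0, 1, 2, 3}. (- 1) powi r * q powi (3 * tri (r + 1) + j * r) *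
      appell3 p (- (q powi (4 * r + 2))) (- (q powi (12 * r + 4 * j - 18))))"
proof -
  have r: "{0..<4} = {0, 1, 2, 3 :: int}" and four: "(0::int) < 4" by auto
  show ?thesis
    unfolding appell_part_def infsum_int_residues[OF appell_part_summable four] appell_part_residue r ..
qed

lemma powi_mult: "q powi k * q powi l = q powi (k + l)"
  using q by (simp add: power_int_add)

text \<open>The triple product series is split by the parity of its index; the odd half is theta at
  \<open>- (q ^ 14)\<close>, reflected to \<open>- (q\<^sup>2)\<close>. The parameter
  \<open>s\<close> covers both signs at once.\<close>

lemma theta_dissection:
  assumes s: "s\<^sup>2 = 1"
  shows "theta (s * q) (q ^ 4) = theta (- (q ^ 6)) p - s * q * theta (- (q\<^sup>2)) p"
proof -
  have s0: "s \<noteq> 0" using s by auto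
  have q4: "norm (q ^ 4) < 1" "q ^ 4 \<noteq> 0" using q norm_power_less_one[OF q(1), of 4] by auto
  have J: "((\<lambda>n. (q ^ 4) powi tri n * (- (s * q)) powi n) has_sum theta (s * q) (q ^ 4)) UNIV"
    using q s0 by (intro jacobi_triple q4) auto
  then have "theta (s * q) (q ^ 4) = (\<Sum>r\<in>{0..<2}. infsum (\<lambda>k. (q ^ 4) powi tri (2 * k + r) * (- (s * q)) powi (2 * k + r)) UNIV)"
    using infsum_int_residues[OF has_sum_imp_summable[OF J], of 2] infsumI[OF J] by simp
  also have "{0..<2} = {0, 1 :: int}" by auto
  also have "(\<Sum>r\<in>{0, 1}. infsum (\<lambda>k. (q ^ 4) powi tri (2 * k + r) * (- (s * q)) powi (2 * k + r)) UNIV)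
     = infsum (\<lambda>k. (q ^ 4) powi tri (2 * k) * (- (s * q)) powi (2 * k)) UNIV
     + infsum (\<lambda>k. (q ^ 4) powi tri (2 * k + 1) * (- (s * q)) powi (2 * k + 1)) UNIV" by simp
  also have "infsum (\<lambda>k. (q ^ 4) powi tri (2 * k) * (- (s * q)) powi (2 * k)) UNIV = theta (- (q ^ 6)) p"
  proof (rule infsumI)
    have "(q ^ 4) powi tri (2 * k) * (- (s * q)) powi (2 * k) = p powi tri k * (- (- (q ^ 6))) powi k" for k
    proof -
      have "(- (s * q)) powi (2 * k) = q powi (2 * k)"
        unfolding power_int_mult[of _ 2 k] using s by (simp add: power_mult_distrib)
      moreover have "4 * tri (2 * k) + 2 * k = 16 * tri k + 6 * k"
        using two_tri[of k] two_tri[of "2 * k"] by (simp add: algebra_simps)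
      ultimately show ?thesis
        by (simp only: p power_int_power of_nat_numeral powi_mult minus_minus)
    qed
    then show "((\<lambda>k. (q ^ 4) powi tri (2 * k) * (- (s * q)) powi (2 * k)) has_sum theta (- (q ^ 6)) p) UNIV"
      using jacobi_triple[OF norm_p, of "- (q ^ 6)"] q by simp
  qed
  also have "infsum (\<lambda>k. (q ^ 4) powi tri (2 * k + 1) * (- (s * q)) powi (2 * k + 1)) UNIV = - (s * q) * theta (- (q\<^sup>2)) p"
  proof (rule infsumI)
    have "theta (- (q\<^sup>2)) p = theta (- (q ^ 14)) p"
      using theta_reflect[of "- (q\<^sup>2)" p] q norm_p by (simp add: p power_diff[symmetric] flip: minus_divide_right)
    moreover have "((\<lambda>k. p powi tri k * (- (- (q ^ 14))) powi k) has_sum theta (- (q ^ 14)) p) UNIV"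
      using q by (intro jacobi_triple norm_p) auto
    ultimately have "((\<lambda>k. - (s * q) * (p powi tri k * (- (- (q ^ 14))) powi k)) has_sum (- (s * q) * theta (- (q\<^sup>2)) p)) UNIV"
      by (intro has_sum_cmult_right) simp
    moreover have "(q ^ 4) powi tri (2 * k + 1) * (- (s * q)) powi (2 * k + 1) = - (s * q) * (p powi tri k * (- (- (q ^ 14))) powi k)" for k
    proof -
      have "(- (s * q)) powi (2 * k + 1) = - (s * q) * q powi (2 * k)"
        using q s0 s by (simp add: power_int_add power_int_mult[of _ 2 k] power_mult_distrib)
      moreover have "4 * tri (2 * k + 1) + 2 * k = 16 * tri k + 14 * k"
        using two_tri[of k] two_tri[of "2 * k + 1"] by (simp add: algebra_simps)
      ultimately show ?thesis
        by (simp only: p power_int_power of_nat_numeral powi_mult minus_minus mult.left_commute[of _ "- (s * q)"])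
    qed
    ultimately show "((\<lambda>k. (q ^ 4) powi tri (2 * k + 1) * (- (s * q)) powi (2 * k + 1)) has_sum (- (s * q) * theta (- (q\<^sup>2)) p)) UNIV"
      by (simp only:)
  qed
  finally show ?thesis by simp
qed

lemma q_poch_inf_halve: "n > 0 \<Longrightarrow> q_poch_inf x (q ^ n) = q_poch_inf x (q ^ (2 * n)) * q_poch_inf (x * q ^ n) (q ^ (2 * n))"
  using q_poch_inf_even_odd[of "q ^ n" x] norm_power_less_one[OF q(1), of n] by (simp add: power_mult[symmetric] mult.commute)

lemma q_poch_inf_conjugate: "n > 0 \<Longrightarrow> q_poch_inf x (q ^ n) * q_poch_inf (- x) (q ^ n) = q_poch_inf (x\<^sup>2) (q ^ (2 * n))"
  using q_poch_inf_mult_minus[of "q ^ n" x] norm_power_less_one[OF q(1), of n] by (simp add: power_mult[symmetric] mult.commute)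

lemma q_poch_inf_power_nonzero: "n > 0 \<Longrightarrow> q_poch_inf (q ^ n) (q ^ n) \<noteq> 0"
  using norm_power_less_one[OF q(1), of n] by (intro q_poch_inf_self_nonzero) auto

text \<open>The first identity is the cancellation of \<open>(q; q)\<close>. The second trades the
  square of \<open>a + q * b\<close> for \<open>theta (- q) (q\<^sup>2)\<close>, whose series runs
  over all squares. Both reduce to halving and conjugation of infinite products.\<close>

lemma theta_products:
  defines "a \<equiv> theta (- (q ^ 6)) p" and "b \<equiv> theta (- (q\<^sup>2)) p" and "e \<equiv> theta (q ^ 4) p" and "Q \<equiv> q_poch_inf p p"
  shows "(a - q * b) * e * Q = q_poch_inf q q * (a * b)"
    and "(a + q * b)\<^sup>2 * Q\<^sup>2 = theta (- q) (q\<^sup>2) * q_poch_inf (q ^ 8) (q ^ 8) * (a * b)"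
proof -
  have qd: "q ^ m / q ^ n = q ^ (m - n)" if "n \<le> m" for m n
    using q that by (simp add: power_diff)
  define X where "X = q_poch_inf (q ^ 4) (q ^ 8)"
  define Y where "Y = q_poch_inf (- (q\<^sup>2)) (q ^ 4)"
  define E4 where "E4 = q_poch_inf (q ^ 4) (q ^ 4)"
  define E2 where "E2 = q_poch_inf (q\<^sup>2) (q\<^sup>2)"
  define E8 where "E8 = q_poch_inf (q ^ 8) (q ^ 8)"
  define Z where "Z = q_poch_inf (- q) (q\<^sup>2)"
  have e: "e = X * Q"
    unfolding e_def theta_def Q_def X_def using q_poch_inf_halve[of 8 "q ^ 4"] by (simp add: p qd power_add[symmetric])
  have ab: "a * b = Y * Q\<^sup>2"
  proof -
    have "Y = q_poch_inf (- (q\<^sup>2)) (q ^ 8) * q_poch_inf (- (q ^ 6)) (q ^ 8)"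
      unfolding Y_def using q_poch_inf_halve[of 4 "- (q\<^sup>2)"] by (simp add: power_add[symmetric])
    also have "q_poch_inf (- (q\<^sup>2)) (q ^ 8) = q_poch_inf (- (q\<^sup>2)) p * q_poch_inf (- (q ^ 10)) p"
      using q_poch_inf_halve[of 8 "- (q\<^sup>2)"] by (simp add: p power_add[symmetric])
    also have "q_poch_inf (- (q ^ 6)) (q ^ 8) = q_poch_inf (- (q ^ 6)) p * q_poch_inf (- (q ^ 14)) p"
      using q_poch_inf_halve[of 8 "- (q ^ 6)"] by (simp add: p power_add[symmetric])
    finally have Y: "Y = q_poch_inf (- (q\<^sup>2)) p * q_poch_inf (- (q ^ 10)) p * (q_poch_inf (- (q ^ 6)) p * q_poch_inf (- (q ^ 14)) p)" .
    have "p / - (q ^ 6) = - (q ^ 10)" "p / - (q\<^sup>2) = - (q ^ 14)"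
      unfolding p using qd[of 6 16] qd[of 2 16] by simp_all
    then show ?thesis
      unfolding a_def b_def theta_def Y Q_def by (simp add: power2_eq_square mult_ac)
  qed
  have E4: "E4 = X * E8"
    unfolding E4_def X_def E8_def using q_poch_inf_halve[of 4 "q ^ 4"] by (simp add: power_add[symmetric])
  \<comment> \<open>This rests on \<open>(q ^ 2; q ^ 4)\<close> times
    \<open>(- q ^ 2; q ^ 4)\<close> being \<open>(q ^ 4; q ^ 8)\<close>; it links
    \<open>a * b\<close>, which contains \<open>Y\<close>, to \<open>E2\<close> and
    \<open>E4\<close>.\<close>
  have XY: "E2 * Y = X * E4"
  proof -
    have "E2 = q_poch_inf (q\<^sup>2) (q ^ 4) * E4"
      unfolding E2_def E4_def using q_poch_inf_halve[of 2 "q\<^sup>2"] by (simp add: power_add[symmetric])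
    moreover have "q_poch_inf (q\<^sup>2) (q ^ 4) * Y = X"
      unfolding Y_def X_def using q_poch_inf_conjugate[of 4 "q\<^sup>2"] by (simp add: power_mult[symmetric])
    ultimately show ?thesis by (simp add: mult_ac)
  qed
  have amb: "(a - q * b) * E2 = q_poch_inf q q * E4"
  proof -
    have "a - q * b = q_poch_inf q (q ^ 4) * q_poch_inf (q ^ 3) (q ^ 4) * E4"
      using theta_dissection[of 1] qd[of 1 4] by (simp add: a_def b_def theta_def E4_def)
    also have "q_poch_inf q (q ^ 4) * q_poch_inf (q ^ 3) (q ^ 4) = q_poch_inf q (q\<^sup>2)"
      using q_poch_inf_halve[of 2 q] by (simp add: power_Suc[symmetric] numeral_eq_Suc del: power_Suc)
    finally have "a - q * b = q_poch_inf q (q\<^sup>2) * E4" .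
    moreover have "q_poch_inf q q = q_poch_inf q (q\<^sup>2) * E2"
      unfolding E2_def using q_poch_inf_even_odd[OF q(1), of q] by (simp add: power2_eq_square)
    ultimately show ?thesis by (simp add: mult_ac)
  qed
  have apb: "a + q * b = Z * E4"
  proof -
    have "a + q * b = q_poch_inf (- q) (q ^ 4) * q_poch_inf (- (q ^ 3)) (q ^ 4) * E4"
      using theta_dissection[of "-1"] qd[of 1 4] by (simp add: a_def b_def theta_def E4_def)
    also have "q_poch_inf (- q) (q ^ 4) * q_poch_inf (- (q ^ 3)) (q ^ 4) = Z"
      unfolding Z_def using q_poch_inf_halve[of 2 "- q"] by (simp add: power_Suc[symmetric] numeral_eq_Suc del: power_Suc)
    finally show ?thesis .
  qed
  have nz: "E2 \<noteq> 0" "E4 \<noteq> 0" "E8 \<noteq> 0"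
    unfolding E2_def E4_def E8_def by (rule q_poch_inf_power_nonzero; simp)+
  have "(a - q * b) * e * Q * E2 = q_poch_inf q q * (a * b) * E2"
  proof -
    have "(a - q * b) * e * Q * E2 = ((a - q * b) * E2) * X * Q\<^sup>2" by (simp add: e power2_eq_square mult_ac)
    also have "\<dots> = q_poch_inf q q * (X * E4) * Q\<^sup>2" unfolding amb by (simp add: mult_ac)
    also have "\<dots> = q_poch_inf q q * (a * b) * E2" unfolding XY[symmetric] ab by (simp add: mult_ac)
    finally show ?thesis .
  qed
  then show "(a - q * b) * e * Q = q_poch_inf q q * (a * b)" using nz by simp
  have th: "theta (- q) (q\<^sup>2) = Z * Z * E2"
    unfolding theta_def Z_def E2_def using q by (simp add: power2_eq_square)
  show "(a + q * b)\<^sup>2 * Q\<^sup>2 = theta (- q) (q\<^sup>2) * q_poch_inf (q ^ 8) (q ^ 8) * (a * b)"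
  proof -
    have "theta (- q) (q\<^sup>2) * q_poch_inf (q ^ 8) (q ^ 8) * (a * b) = Z * Z * (E2 * Y) * E8 * Q\<^sup>2"
      unfolding th ab E8_def[symmetric] by (simp add: mult_ac)
    also have "\<dots> = Z * Z * E4 * E4 * Q\<^sup>2" unfolding XY E4 by (simp add: mult_ac)
    finally show ?thesis unfolding apb by (simp add: power2_eq_square mult_ac)
  qed
qed

end

text \<open>At \<open>t = q ^ 4\<close> the exponents are the even squares; the companion below
  gives the odd squares lowered by one.\<close>

definition even_square_sum :: "complex \<Rightarrow> complex" where
  "even_square_sum t = infsum (\<lambda>k. t powi (k * k)) UNIV"

definition odd_square_sum :: "complex \<Rightarrow> complex" where
  "odd_square_sum t = infsum (\<lambda>k. t powi (k * k + k)) UNIV"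

context
  fixes q p :: complex
  assumes q: "norm q < 1" "q \<noteq> 0" and p: "p = q ^ 16"
begin

lemma phi_dissection:
  "theta (- q) (q\<^sup>2) = even_square_sum (q ^ 4) + q * odd_square_sum (q ^ 4)"
proof -
  have q2: "norm (q\<^sup>2) < 1" "q\<^sup>2 \<noteq> 0" using q norm_power_less_one[OF q(1), of 2] by auto
  have J: "((\<lambda>n. (q\<^sup>2) powi tri n * (- (- q)) powi n) has_sum theta (- q) (q\<^sup>2)) UNIV"
    using q by (intro jacobi_triple q2) auto
  have r: "{0..<2} = {0, 1 :: int}" and two: "(0::int) < 2" by auto
  have e0: "(q\<^sup>2) powi tri (2 * k) * (- (- q)) powi (2 * k) = (q ^ 4) powi (k * k)" for k
  proof -
    have "2 * tri (2 * k) + 2 * k = 4 * (k * k)" unfolding two_tri by (simp add: algebra_simps)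
    then show ?thesis by (simp only: power_int_power of_nat_numeral minus_minus powi_mult[OF q p])
  qed
  have e1: "(q\<^sup>2) powi tri (2 * k + 1) * (- (- q)) powi (2 * k + 1) = q * (q ^ 4) powi (k * k + k)" for k
  proof -
    have "2 * tri (2 * k + 1) + (2 * k + 1) = 1 + 4 * (k * k + k)" unfolding two_tri by (simp add: algebra_simps)
    then have "(q\<^sup>2) powi tri (2 * k + 1) * (- (- q)) powi (2 * k + 1) = q powi (1 + 4 * (k * k + k))"
      by (simp only: power_int_power of_nat_numeral minus_minus powi_mult[OF q p])
    also have "\<dots> = q powi 1 * q powi (4 * (k * k + k))"
      by (simp only: powi_mult[OF q p])
    finally show ?thesis by (simp only: power_int_power of_nat_numeral power_int_1_right)
  qed
  have "theta (- q) (q\<^sup>2) = infsum (\<lambda>k. (q\<^sup>2) powi tri (2 * k) * (- (- q)) powi (2 * k)) UNIV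
     + infsum (\<lambda>k. (q\<^sup>2) powi tri (2 * k + 1) * (- (- q)) powi (2 * k + 1)) UNIV"
    using infsum_int_residues[OF has_sum_imp_summable[OF J] two] infsumI[OF J] unfolding r by simp
  then show ?thesis
    by (simp only: e0 e1 even_square_sum_def odd_square_sum_def infsum_cmult_right')
qed

text \<open>With the three rules that follow, this reduces theta at the signed powers of
  \<open>q\<close> met below to the exponents 2, 4, 6 and 8.\<close>

lemma theta_minus_neg: "theta (- (q powi (- k))) p = theta (- (q powi k)) p * q powi (- k)"
proof -
  have "- (q powi (- k)) = inverse (- (q powi k))" by (simp add: power_int_minus)
  then show ?thesis
    using theta_inverse[OF norm_p(1)[OF q p], of "- (q powi k)"] q norm_p(2)[OF q p]
    by (simp add: power_int_minus divide_inverse)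
qed

lemma theta_plus_neg: "theta (q powi (- k)) p = - (theta (q powi k) p * q powi (- k))"
  using theta_inverse[OF norm_p(1)[OF q p], of "q powi k"] q norm_p(2)[OF q p]
  by (simp add: power_int_minus divide_inverse)

lemma theta_minus_reflect: "theta (- (q powi (16 - k))) p = theta (- (q powi k)) p"
  using theta_reflect[of "- (q powi k)" p] q norm_p(2)[OF q p]
  by (simp add: p power_int_diff flip: minus_divide_right)

lemma theta_plus_reflect: "theta (q powi (16 - k)) p = theta (q powi k) p"
  using theta_reflect[of "q powi k" p] q norm_p(2)[OF q p]
  by (simp add: p power_int_diff)

lemma theta_monomial_nonzero:
  assumes "norm x = norm q powi k" "\<not> 16 dvd k"
  shows "theta x p \<noteq> 0"
proof (rule theta_nonzero)
  have "norm x \<noteq> 0" using assms q by simp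
  then show "x \<noteq> 0" by auto
  show "x * p powi n \<noteq> 1" for n
    using monomials_distinct[OF q p assms(1), of 1 0 n] assms(2) by simp
qed (use norm_p[OF q p] in auto)

text \<open>Two negative points, to match the poles \<open>- (q powi (4 * r + 2))\<close> of the
  residue classes, and a positive auxiliary one.\<close>

lemma three_monomials:
  assumes "\<not> 16 dvd k1" "\<not> 16 dvd k2" "\<not> 16 dvd k3"
    "\<not> 16 dvd k1 - k2" "\<not> 16 dvd k1 - k3" "\<not> 16 dvd k2 - k3"
  shows "q_poch_inf p p ^ 3 / (theta (- (q powi k1)) p * theta (- (q powi k2)) p * theta (q powi k3) p) =
      appell3 p (- (q powi k1)) (- (q powi (2 * k1 - k2 - k3))) / (theta (q powi (k2 - k1)) p * theta (- (q powi (k3 - k1))) p)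
    + appell3 p (- (q powi k2)) (- (q powi (2 * k2 - k1 - k3))) / (theta (q powi (k1 - k2)) p * theta (- (q powi (k3 - k2))) p)
    + appell3 p (q powi k3) (q powi (2 * k3 - k1 - k2)) / (theta (- (q powi (k1 - k3))) p * theta (- (q powi (k2 - k3))) p)"
proof -
  let ?x = "- (q powi k1)" and ?y = "- (q powi k2)" and ?z = "q powi k3"
  have c: "?x\<^sup>2 / (?y * ?z) = - (q powi (2 * k1 - k2 - k3))" "?y\<^sup>2 / (?x * ?z) = - (q powi (2 * k2 - k1 - k3))"
    "?z\<^sup>2 / (?x * ?y) = q powi (2 * k3 - k1 - k2)"
    using q by (simp_all add: power_int_diff power_int_power' mult.commute)
  have d: "?y / ?x = q powi (k2 - k1)" "?z / ?x = - (q powi (k3 - k1))" "?x / ?y = q powi (k1 - k2)"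
    "?z / ?y = - (q powi (k3 - k2))" "?x / ?z = - (q powi (k1 - k3))" "?y / ?z = - (q powi (k2 - k3))"
    using q by (simp_all add: power_int_diff)
  have n: "norm ?x = norm q powi k1" "norm ?y = norm q powi k2" "norm ?z = norm q powi k3"
    "norm (1::complex) = norm q powi 0"
    by (simp_all add: norm_power_int)
  show ?thesis
    using three_theta_partial_fractions[OF norm_p[OF q p], of ?x ?y ?z,
        OF _ _ _ monomials_distinct[OF q p n(1) n(4)] monomials_distinct[OF q p n(2) n(4)]
        monomials_distinct[OF q p n(3) n(4)] monomials_distinct[OF q p n(1) n(2)]
        monomials_distinct[OF q p n(1) n(3)] monomials_distinct[OF q p n(2) n(3)]]
      assms q unfolding c d by simp
qed

lemma tri_values: "tri 2 = 1" "tri 3 = 3" "tri 4 = 6"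
  by (simp_all add: tri_def)

text \<open>The partial fraction expansions at \<open>- q\<^sup>2, - q ^ 14, q ^ 8\<close> and at \<open>- q ^ 6, - q ^ 10, q ^ 8\<close> produce the
  terms with \<open>n mod 4 \<in> {0, 3}\<close> and \<open>n mod 4 \<in> {1, 2}\<close>; both contain the same third Appell sum.\<close>

lemma appell_part_0:
  "appell_part 0 q = q_poch_inf q q *
     (even_square_sum (q ^ 4) * q_poch_inf (q ^ 8) (q ^ 8) / theta (q ^ 8) p
      + q * (odd_square_sum (q ^ 4) * q_poch_inf (q ^ 8) (q ^ 8) / theta (q ^ 8) p - (q_poch_inf p p)\<^sup>2 / theta (q ^ 8) p
             + q ^ 4 * appell3 p (q ^ 8) 1 / q_poch_inf p p))"
proof -
  define a where "a = theta (- (q ^ 6)) p"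
  define b where "b = theta (- (q\<^sup>2)) p"
  define e where "e = theta (q ^ 4) p"
  define h where "h = theta (q ^ 8) p"
  define Q where "Q = q_poch_inf p p"
  define L where "L = appell3 p (q ^ 8) 1"
  define E where "E = q_poch_inf (q ^ 8) (q ^ 8)"
  define \<alpha> where "\<alpha> r = appell3 p (- (q powi (4 * r + 2))) (- (q powi (12 * r - 18)))" for r
  have nz: "a \<noteq> 0" "b \<noteq> 0" "e \<noteq> 0" "h \<noteq> 0" "Q \<noteq> 0"
  proof -
    show "a \<noteq> 0" unfolding a_def by (rule theta_monomial_nonzero[of _ 6]) (auto simp: norm_power)
    show "b \<noteq> 0" unfolding b_def by (rule theta_monomial_nonzero[of _ 2]) (auto simp: norm_power)
    show "e \<noteq> 0" unfolding e_def by (rule theta_monomial_nonzero[of _ 4]) (auto simp: norm_power)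
    show "h \<noteq> 0" unfolding h_def by (rule theta_monomial_nonzero[of _ 8]) (auto simp: norm_power)
    show "Q \<noteq> 0" unfolding Q_def by (rule q_poch_inf_self_nonzero[OF norm_p(1)[OF q p]])
  qed
  have th: "theta (- (q ^ 14)) p = b" "theta (- (q ^ 10)) p = a" "theta (q ^ 12) p = e"
    "theta (- (q powi (- 6))) p = a / q ^ 6" "theta (- (q powi (- 2))) p = b / q\<^sup>2"
    "theta (q powi (- 12)) p = - (e / q ^ 12)" "theta (q powi (- 4)) p = - (e / q ^ 4)"
    using theta_minus_reflect[of 2] theta_minus_reflect[of 6] theta_plus_reflect[of 4]
      theta_minus_neg[of 6] theta_minus_neg[of 2] theta_plus_neg[of 12] theta_plus_neg[of 4]
    by (simp_all add: a_def b_def e_def power_int_minus divide_inverse)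
  \<comment> \<open>The multiplier exponents \<open>2 * k1 - k2 - k3\<close> and
    \<open>2 * k2 - k1 - k3\<close> are -18 and 18, equal to \<open>12 * r - 18\<close> at
    \<open>r = 0\<close> and \<open>r = 3\<close>; this forces the third point 8, whose own exponent
    is 0. The points 6, 10, 8 below match \<open>r = 1\<close> and \<open>r = 2\<close> and again
    give 0, hence the same \<open>L\<close>.\<close>
  have A: "Q ^ 3 / (b * b * h) = \<alpha> 0 / (e * a) - q ^ 18 * \<alpha> 3 / (e * a) + q ^ 6 * L / (a * a)"
    using three_monomials[of 2 14 8] q nz
    by (simp add: th \<alpha>_def L_def[symmetric] Q_def[symmetric] h_def[symmetric] a_def[symmetric] b_def[symmetric])
       (simp add: mult_ac flip: power_add)
  have B: "Q ^ 3 / (a * a * h) = \<alpha> 1 / (e * b) - q ^ 6 * \<alpha> 2 / (e * b) + q\<^sup>2 * L / (b * b)"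
    using three_monomials[of 6 10 8] q nz
    by (simp add: th \<alpha>_def L_def[symmetric] Q_def[symmetric] h_def[symmetric] a_def[symmetric] b_def[symmetric] e_def[symmetric])
       (simp add: mult_ac flip: power_add)
  have A': "\<alpha> 0 - q ^ 18 * \<alpha> 3 = e * a * (Q ^ 3 / (b * b * h)) - q ^ 6 * L * e / a"
    unfolding A using nz by (simp add: field_simps)
  have B': "\<alpha> 1 - q ^ 6 * \<alpha> 2 = e * b * (Q ^ 3 / (a * a * h)) - q\<^sup>2 * L * e / b"
    unfolding B using nz by (simp add: field_simps)
  have "appell_part 0 q = (\<alpha> 0 - q ^ 18 * \<alpha> 3) - q ^ 3 * (\<alpha> 1 - q ^ 6 * \<alpha> 2)"
    unfolding appell_part_split[OF q p] \<alpha>_def by (simp add: tri_values algebra_simps flip: power_add)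
  \<comment> \<open>The theta quotients combine to \<open>a ^ 3 - q ^ 3 * b ^ 3\<close>, which is
    \<open>a - q * b\<close> times \<open>(a + q * b)\<^sup>2 - q * (a * b)\<close>; the terms with
    \<open>L\<close> have the factor \<open>a - q * b\<close> directly.\<close>
  also have "\<dots> = (a - q * b) * e * Q *
      (Q\<^sup>2 * ((a + q * b)\<^sup>2 - q * (a * b)) / (a * b * (a * b) * h) + q ^ 5 * L / (a * b * Q))"
    unfolding A' B' using nz by (simp add: field_simps power2_eq_square power3_eq_cube) (simp add: algebra_simps eval_nat_numeral)
  also have "(a - q * b) * e * Q = q_poch_inf q q * (a * b)"
    using theta_products(1)[OF q p] by (simp add: a_def b_def e_def Q_def)
  also have "(a + q * b)\<^sup>2 = theta (- q) (q\<^sup>2) * E * (a * b) / Q\<^sup>2"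
    using theta_products(2)[OF q p] nz by (simp add: a_def b_def Q_def E_def field_simps)
  finally have "appell_part 0 q = q_poch_inf q q * (a * b) * (Q\<^sup>2 * (theta (- q) (q\<^sup>2) * E * (a * b) / Q\<^sup>2 - q * (a * b)) / (a * b * (a * b) * h)
      + q ^ 5 * L / (a * b * Q))" .
  moreover have "X * c * (Q\<^sup>2 * (T * E * c / Q\<^sup>2 - q * c) / (c * c * h) + q ^ 5 * L / (c * Q))
      = X * (T * E / h - q * Q\<^sup>2 / h + q ^ 5 * L / Q)" if "c \<noteq> 0" for X c T
    using that nz by (simp add: field_simps)
  ultimately have "appell_part 0 q = q_poch_inf q q * (theta (- q) (q\<^sup>2) * E / h - q * Q\<^sup>2 / h + q ^ 5 * L / Q)"
    using nz by simp
  moreover have "q ^ 5 = q * q ^ 4" by (simp flip: power_Suc)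
  ultimately show ?thesis
    unfolding h_def[symmetric] Q_def[symmetric] L_def[symmetric] E_def[symmetric] phi_dissection
    by (simp add: algebra_simps add_divide_distrib)
qed

text \<open>An index shift moves the pole from \<open>q powi (- 4)\<close> to \<open>q ^ 12\<close>.
  The exponent \<open>3 * tri\<close> then grows by three times the shifted index, which turns the
  multiplier \<open>p powi (- 2)\<close> into \<open>p\<close>.\<close>

lemma appell3_shift: "appell3 p (inverse (q ^ 4)) (inverse (p\<^sup>2)) = - (p * appell3 p (q ^ 12) p)"
proof -
  let ?f = "\<lambda>n. (- 1) powi n * p powi (3 * tri (n + 1)) * (inverse (p\<^sup>2)) powi n / (1 - inverse (q ^ 4) * p powi n)"
  let ?g = "\<lambda>n. (- 1) powi n * p powi (3 * tri (n + 1)) * p powi n / (1 - q ^ 12 * p powi n)"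
  have p0: "p \<noteq> 0" by (rule norm_p(2)[OF q p])
  have pp: "p powi k * p powi l = p powi (k + l)" for k l using p0 by (simp add: power_int_add)
  have "infsum ?f UNIV = infsum (\<lambda>n. - p * ?g n) UNIV"
  proof (rule infsum_reindex_bij_witness[of _ "\<lambda>n. n + 1" "\<lambda>n. n - 1"])
    fix n :: int
    define m where "m = n - 1"
    have n: "n = m + 1" by (simp add: m_def)
    have d: "inverse (q ^ 4) * p powi (m + 1) = q ^ 12 * p powi m"
    proof -
      have "inverse (q ^ 4) * p = q ^ 12" using q by (simp add: p field_simps flip: power_add)
      then show ?thesis using p0 by (simp add: power_int_add mult_ac)
    qed
    have i: "(inverse (p\<^sup>2)) powi (m + 1) = p powi (- 2 * (m + 1))"
      unfolding power_int_mult by (simp add: power_int_minus)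
    have "3 * tri (m + 2) + - 2 * (m + 1) = 1 + (3 * tri (m + 1) + m)"
      using tri_add[of "m + 1" 1] by (simp add: algebra_simps)
    then have e: "p powi (3 * tri (m + 2)) * (inverse (p\<^sup>2)) powi (m + 1) = p * (p powi (3 * tri (m + 1)) * p powi m)"
      unfolding i pp using pp[of 1 "3 * tri (m + 1) + m"] by (simp only: power_int_1_right)
    have s: "(- 1 :: complex) powi (m + 1) = - ((- 1) powi m)" by (simp add: power_int_add)
    have "?f n = (- 1) powi (m + 1) * (p powi (3 * tri (m + 2)) * (inverse (p\<^sup>2)) powi (m + 1)) / (1 - inverse (q ^ 4) * p powi (m + 1))"
      unfolding n by (simp add: mult.assoc add.commute)
    also have "\<dots> = - p * ?g m" unfolding d e s by (simp add: mult_ac)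
    finally show "- p * ?g (n - 1) = ?f n" by (simp add: m_def)
  qed auto
  also have "\<dots> = - p * infsum ?g UNIV" by (rule infsum_cmult_right')
  finally show ?thesis unfolding appell3_def by simp
qed

text \<open>Here the points \<open>- q\<^sup>2, - q ^ 6, q ^ 12\<close> give \<open>n mod 4 \<in> {0, 1}\<close> and \<open>- q ^ 10, - q ^ 14, q powi (- 4)\<close>
  give \<open>n mod 4 \<in> {2, 3}\<close>.\<close>

lemma appell_part_1:
  "appell_part 1 q = q_poch_inf q q * ((q_poch_inf p p)\<^sup>2 / theta (q ^ 4) p + q ^ 15 * appell3 p (q ^ 12) p / q_poch_inf p p)"
proof -
  define a where "a = theta (- (q ^ 6)) p"
  define b where "b = theta (- (q\<^sup>2)) p"
  define e where "e = theta (q ^ 4) p"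
  define Q where "Q = q_poch_inf p p"
  define K where "K = appell3 p (q ^ 12) p"
  define \<alpha> where "\<alpha> r = appell3 p (- (q powi (4 * r + 2))) (- (q powi (12 * r - 14)))" for r
  have nz: "a \<noteq> 0" "b \<noteq> 0" "e \<noteq> 0" "Q \<noteq> 0"
  proof -
    show "a \<noteq> 0" unfolding a_def by (rule theta_monomial_nonzero[of _ 6]) (auto simp: norm_power)
    show "b \<noteq> 0" unfolding b_def by (rule theta_monomial_nonzero[of _ 2]) (auto simp: norm_power)
    show "e \<noteq> 0" unfolding e_def by (rule theta_monomial_nonzero[of _ 4]) (auto simp: norm_power)
    show "Q \<noteq> 0" unfolding Q_def by (rule q_poch_inf_self_nonzero[OF norm_p(1)[OF q p]])
  qed
  have th: "theta (- (q ^ 14)) p = b" "theta (- (q ^ 10)) p = a" "theta (q ^ 12) p = e"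
    "theta (- (q powi (- 6))) p = a / q ^ 6" "theta (- (q powi (- 10))) p = a / q ^ 10"
    "theta (- (q powi (- 14))) p = b / q ^ 14"
    "theta (- (q ^ 18)) p = b / q\<^sup>2" "theta (- (q powi (- 18))) p = b / q ^ 20"
    "theta (q powi (- 4)) p = - (e / q ^ 4)"
    using theta_minus_reflect[of 2] theta_minus_reflect[of 6] theta_plus_reflect[of 4] theta_minus_reflect[of "- 2"]
      theta_minus_neg[of 6] theta_minus_neg[of 2] theta_minus_neg[of 10] theta_minus_neg[of 14] theta_minus_neg[of 18]
      theta_plus_neg[of 4]
    by (simp_all add: a_def b_def e_def power_int_minus divide_inverse mult.assoc flip: power_add inverse_mult_distrib)
  \<comment> \<open>The multiplier exponents are now to be \<open>12 * r - 14\<close>: the points 2,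
    6, 12 give -14 and -2 for \<open>r = 0\<close> and \<open>r = 1\<close>, and 16 at the third
    point, hence the multiplier \<open>p\<close> in \<open>K\<close>.\<close>
  have A: "Q ^ 3 / (b * a * e) = \<alpha> 0 / (e * a) - q ^ 4 * \<alpha> 1 / (e * a) + q ^ 16 * K / (a * a)"
    using three_monomials[of 2 6 12] q nz
    by (simp add: th \<alpha>_def p[symmetric] K_def[symmetric] Q_def[symmetric] e_def[symmetric] a_def[symmetric] b_def[symmetric])
       (simp add: p mult_ac flip: power_add)
  \<comment> \<open>The points 10, 14, -4 give 10 and 22 for \<open>r = 2\<close> and
    \<open>r = 3\<close>, and -32 at the third point; \<open>appell3_shift\<close> turns that third
    sum into \<open>K\<close> as well.\<close>
  have B: "- (q ^ 4 * (Q ^ 3 / (a * b * e))) = q ^ 14 * \<alpha> 2 / (e * b) - q ^ 24 * \<alpha> 3 / (e * b) - q ^ 18 * K / (b * b)"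
  proof -
    have i: "q powi (- 4) = inverse (q ^ 4)" "q powi (- 32) = inverse (p\<^sup>2)"
      by (simp_all add: power_int_minus p power_mult[symmetric])
    have th4: "theta (inverse (q ^ 4)) p = - (e / q ^ 4)" using th(9) unfolding i .
    have "Q ^ 3 / (a * b * (- (e / q ^ 4))) = \<alpha> 2 / (e * (b / q ^ 14)) + \<alpha> 3 / ((- (e / q ^ 4)) * (b / q ^ 20))
       + (- (p * K)) / (b * (b / q\<^sup>2))"
      using three_monomials[of 10 14 "- 4"]
      by (simp add: th \<alpha>_def Q_def[symmetric] e_def[symmetric] i th4 appell3_shift K_def[symmetric])
    then show ?thesis
      using q nz by (simp add: p mult_ac flip: power_add)
  qed
  have A': "\<alpha> 0 - q ^ 4 * \<alpha> 1 = e * a * (Q ^ 3 / (b * a * e)) - q ^ 16 * K * e / a"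
    unfolding A using nz by (simp add: field_simps)
  have B': "q ^ 3 * (q ^ 11 * \<alpha> 2 - q ^ 21 * \<alpha> 3) = e * b * (- (q ^ 4 * (Q ^ 3 / (a * b * e)))) + q ^ 18 * K * e / b"
    unfolding B using nz by (simp add: field_simps flip: power_add)
  \<comment> \<open>The identity \<open>B\<close> carries \<open>\<alpha> 2\<close> with
    \<open>q ^ 14\<close> where \<open>appell_part\<close> has \<open>q ^ 11\<close>; the extra
    \<open>q ^ 3\<close> is cancelled at the end.\<close>
  have "q ^ 3 * appell_part 1 q = q ^ 3 * (\<alpha> 0 - q ^ 4 * \<alpha> 1) + q ^ 3 * (q ^ 11 * \<alpha> 2 - q ^ 21 * \<alpha> 3)"
    unfolding appell_part_split[OF q p] \<alpha>_def by (simp add: tri_values algebra_simps)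
  also have "\<dots> = q ^ 3 * ((a - q * b) * e * Q * (Q\<^sup>2 / (a * b * e) + q ^ 15 * K / (a * b * Q)))"
    unfolding A' B' using nz by (simp add: field_simps power2_eq_square power3_eq_cube) (simp add: algebra_simps eval_nat_numeral)
  also have "(a - q * b) * e * Q = q_poch_inf q q * (a * b)"
    using theta_products(1)[OF q p] by (simp add: a_def b_def e_def Q_def)
  finally have f1: "appell_part 1 q = q_poch_inf q q * (a * b) * (Q\<^sup>2 / (a * b * e) + q ^ 15 * K / (a * b * Q))"
    using q by simp
  show ?thesis
    unfolding e_def[symmetric] Q_def[symmetric] K_def[symmetric] f1
    using nz by (simp add: field_simps)
qed

end

section \<open>Vanishing coefficients\<close>

lemma powi_neg_one_reflect: "(- 1 :: complex) powi (- 1 - n) = - ((- 1) powi n)"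
  using power_int_minus[of "-1 :: complex" "1 + n"] by (simp add: power_int_add flip: power_int_inverse)

text \<open>The substitution of \<open>- 1 - n\<close> for \<open>n\<close> fixes
  \<open>tri (n + 1)\<close>, changes the sign \<open>(- 1) powi n\<close>, and reproduces the
  denominator up to a power of \<open>q\<close>.\<close>

lemma appell_part_reflect:
  assumes q: "norm q < 1" "q \<noteq> 0"
  shows "appell_part j q = - (q powi (2 - j)) * appell_part (4 - j) q"
proof -
  let ?g = "\<lambda>j n. (- 1) powi n * q powi (3 * tri (n + 1) + j * n) / (1 + q powi (4 * n + 2))"
  have "infsum (?g j) UNIV = infsum (\<lambda>n. - (q powi (2 - j)) * ?g (4 - j) n) UNIV"
  proof (rule infsum_reindex_bij_witness[of _ "\<lambda>n. - 1 - n" "\<lambda>n. - 1 - n"])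
    fix m :: int
    define n where "n = - 1 - m"
    have m: "m = - 1 - n" by (simp add: n_def)
    have t: "tri (m + 1) = tri (n + 1)"
      using tri_minus[of n] tri_add[of n 1] by (simp add: m)
    have d: "1 + q powi (4 * m + 2) = q powi (- (4 * n + 2)) * (1 + q powi (4 * n + 2))"
    proof -
      have "q powi (- (4 * n + 2)) * q powi (4 * n + 2) = 1"
        unfolding power_int_minus[of q "4 * n + 2"] using q by simp
      moreover have "4 * m + 2 = - (4 * n + 2)" by (simp add: m)
      ultimately show ?thesis by (simp only: distrib_left mult_1_right) simp
    qed
    have e: "q powi (3 * tri (m + 1) + j * m) = q powi (- (4 * n + 2)) * (q powi (2 - j) * q powi (3 * tri (n + 1) + (4 - j) * n))"
    proof -
      have "3 * tri (m + 1) + j * m = - (4 * n + 2) + ((2 - j) + (3 * tri (n + 1) + (4 - j) * n))"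
        unfolding t by (simp add: m algebra_simps)
      then show ?thesis using q by (simp only: power_int_add simp_thms disj_not1)
    qed
    have "?g j m = - ((- 1) powi n) * (q powi (- (4 * n + 2)) * (q powi (2 - j) * q powi (3 * tri (n + 1) + (4 - j) * n)))
        / (q powi (- (4 * n + 2)) * (1 + q powi (4 * n + 2)))"
      unfolding d e by (simp only: m powi_neg_one_reflect)
    also have "\<dots> = - (q powi (2 - j)) * ?g (4 - j) n"
      using q by simp
    finally show "- (q powi (2 - j)) * ?g (4 - j) (- 1 - m) = ?g j m" by (simp only: n_def)
  qed auto
  then show ?thesis unfolding appell_part_def by (simp only: infsum_cmult_right')
qed

text \<open>The geometric expansion gives four parts. Reflection kills part 2 and turns part 3 into
  minus part 1 over \<open>q\<close>, whence the coefficient \<open>z - z ^ 3\<close>.\<close>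

lemma appell3_eq_parts:
  assumes Q: "norm Q < 1" "Q \<noteq> 0" and z: "z ^ 4 = - 1"
  shows "appell3 (Q\<^sup>2) (z * Q) 1 = appell_part 0 (Q\<^sup>2) + (z - z ^ 3) * Q * appell_part 1 (Q\<^sup>2)"
proof -
  define q where "q = Q\<^sup>2"
  have q: "norm q < 1" "q \<noteq> 0" using Q norm_power_less_one[OF Q(1), of 2] by (auto simp: q_def)
  let ?g = "\<lambda>j n. (- 1) powi n * q powi (3 * tri (n + 1) + j * n) / (1 + q powi (4 * n + 2))"
  have s: "((\<lambda>n. c * ?g j n) has_sum (c * appell_part j q)) UNIV" for c j
    unfolding appell_part_def using appell_part_summable[OF q refl] by (intro has_sum_cmult_right has_sum_infsum)
  have summand: "(- 1) powi n * q powi (3 * tri (n + 1)) * 1 powi n / (1 - z * Q * q powi n)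
     = 1 * ?g 0 n + (z * Q) * ?g 1 n + (z * Q)\<^sup>2 * ?g 2 n + (z * Q) ^ 3 * ?g 3 n" for n
  proof -
    define y where "y = z * Q * q powi n"
    have y4: "1 - y ^ 4 = 1 + q powi (4 * n + 2)"
    proof -
      have "(q powi n) ^ 4 = q powi (4 * n)" by (simp add: power_int_power' mult.commute)
      moreover have "Q ^ 4 = q powi 2" by (simp add: q_def power_mult[symmetric])
      ultimately have "y ^ 4 = - (q powi 2 * q powi (4 * n))"
        unfolding y_def power_mult_distrib z by simp
      then have "y ^ 4 = - (q powi (2 + 4 * n))" by (simp only: powi_mult[OF q refl])
      then show ?thesis by (simp add: add.commute)
    qed
    have nz: "1 - y ^ 4 \<noteq> 0"
      unfolding y4 by (rule one_plus_nonzero[OF q refl]) presburger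
    have fac: "1 - y ^ 4 = (1 - y) * (1 + y + y\<^sup>2 + y ^ 3)" by (simp add: algebra_simps eval_nat_numeral)
    have inv: "1 / (1 - y) = (1 + y + y\<^sup>2 + y ^ 3) / (1 - y ^ 4)"
      using nz unfolding fac by simp
    have pw: "q powi (3 * tri (n + 1) + j * n) = q powi (3 * tri (n + 1)) * (q powi n) powi j" for j
      using q by (simp add: power_int_add power_int_mult mult.commute[of j])
    have "(- 1) powi n * q powi (3 * tri (n + 1)) * 1 powi n / (1 - z * Q * q powi n)
       = (- 1) powi n * q powi (3 * tri (n + 1)) * (1 / (1 - y))" by (simp add: y_def)
    also have "\<dots> = 1 * ?g 0 n + (z * Q) * ?g 1 n + (z * Q)\<^sup>2 * ?g 2 n + (z * Q) ^ 3 * ?g 3 n"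
      unfolding inv y4 pw by (simp add: y_def power_mult_distrib distrib_left add_divide_distrib mult_ac)
    finally show ?thesis .
  qed
  have "((\<lambda>n. 1 * ?g 0 n + (z * Q) * ?g 1 n + (z * Q)\<^sup>2 * ?g 2 n + (z * Q) ^ 3 * ?g 3 n) has_sum
      (1 * appell_part 0 q + (z * Q) * appell_part 1 q + (z * Q)\<^sup>2 * appell_part 2 q + (z * Q) ^ 3 * appell_part 3 q)) UNIV"
    by (intro has_sum_add s)
  then have "appell3 q (z * Q) 1 = 1 * appell_part 0 q + (z * Q) * appell_part 1 q + (z * Q)\<^sup>2 * appell_part 2 q + (z * Q) ^ 3 * appell_part 3 q"
    unfolding appell3_def summand by (rule infsumI)
  moreover have "appell_part 2 q = 0"
  proof -
    have "appell_part 2 q = - appell_part 2 q" using appell_part_reflect[OF q, of 2] by simp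
    then show ?thesis by simp
  qed
  moreover have "appell_part 3 q = - (appell_part 1 q / q)"
    using appell_part_reflect[OF q, of 3] by (simp add: power_int_minus divide_inverse mult.commute)
  moreover have "(z * Q) ^ 3 * (appell_part 1 q / q) = z ^ 3 * Q * appell_part 1 q"
    using Q by (simp add: q_def power_mult_distrib power3_eq_cube power2_eq_square)
  ultimately show ?thesis
    unfolding q_def[symmetric] by (simp add: algebra_simps)
qed

text \<open>Parts 0 and 1 supply \<open>\<alpha>\<close>, \<open>\<beta>\<close> and
  \<open>\<gamma>\<close>, \<open>\<delta>\<close>. They are quantified before \<open>Q\<close> and
  enter only through their values at \<open>Q ^ 8\<close>, which the rotations of \<open>Q\<close>
  by powers of \<open>z\<close> preserve; the prefactors have exponents 1, 3, 2, 0 modulo 8.\<close>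

theorem rank_weight_dissection:
  assumes z: "norm z = 1" "z ^ 4 = - 1"
  shows "\<exists>\<alpha> \<beta> \<gamma> \<delta>. \<forall>Q. norm Q < 1 \<longrightarrow> Q \<noteq> 0 \<longrightarrow>
    ((\<lambda>n. rank_weight z n * Q ^ n) has_sum
      (Q * \<alpha> (Q ^ 8) + Q ^ 3 * \<beta> (Q ^ 8) + Q\<^sup>2 * \<gamma> (Q ^ 8) + Q ^ 8 * \<delta> (Q ^ 8))) UNIV"
proof -
  define \<alpha> where "\<alpha> t = even_square_sum t * q_poch_inf (t\<^sup>2) (t\<^sup>2) / theta (t\<^sup>2) (t ^ 4)" for t
  define \<beta> where "\<beta> t = odd_square_sum t * q_poch_inf (t\<^sup>2) (t\<^sup>2) / theta (t\<^sup>2) (t ^ 4) - (q_poch_inf (t ^ 4) (t ^ 4))\<^sup>2 / theta (t\<^sup>2) (t ^ 4)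
    + t * appell3 (t ^ 4) (t\<^sup>2) 1 / q_poch_inf (t ^ 4) (t ^ 4)" for t
  define \<gamma> where "\<gamma> t = (z - z ^ 3) * ((q_poch_inf (t ^ 4) (t ^ 4))\<^sup>2 / theta t (t ^ 4))" for t
  define \<delta> where "\<delta> t = (z - z ^ 3) * (t ^ 3 * appell3 (t ^ 4) (t ^ 3) (t ^ 4) / q_poch_inf (t ^ 4) (t ^ 4))" for t
  show ?thesis
  proof (rule exI[of _ \<alpha>], rule exI[of _ \<beta>], rule exI[of _ \<gamma>], rule exI[of _ \<delta>], intro allI impI,
      rule rank_weight_generating_function[OF z(1)])
    fix Q :: complex assume Q: "norm Q < 1" "Q \<noteq> 0"
    define q where "q = Q\<^sup>2"
    have q: "norm q < 1" "q \<noteq> 0" using Q norm_power_less_one[OF Q(1), of 2] by (auto simp: q_def)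
    have z0: "z \<noteq> 0" using z by auto
    define t where "t = Q ^ 8"
    have t: "q ^ 4 = t" "q ^ 8 = t\<^sup>2" "q ^ 12 = t ^ 3" "q ^ 16 = t ^ 4" "q ^ 15 = q ^ 3 * t ^ 3"
      by (simp_all add: q_def t_def power_mult[symmetric] power_add[symmetric])
    have pz: "q_poch_inf q q \<noteq> 0" by (rule q_poch_inf_self_nonzero[OF q(1)])
    have f0: "appell_part 0 q = q_poch_inf q q * (\<alpha> t + q * \<beta> t)"
      unfolding appell_part_0[OF q refl] t \<alpha>_def \<beta>_def ..
    have f1: "(z - z ^ 3) * appell_part 1 q = q_poch_inf q q * (\<gamma> t + q ^ 3 * \<delta> t)"
      unfolding appell_part_1[OF q refl] t \<gamma>_def \<delta>_def by (simp add: algebra_simps)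
    have "z * Q * q powi n \<noteq> 1" for n
    proof
      assume "z * Q * q powi n = 1"
      then have "norm Q * norm q powi n = 1"
        using z by (metis mult_1 norm_mult norm_one norm_power_int)
      then have "norm Q powi (1 + 2 * n) = norm Q powi 0"
        using Q by (simp add: q_def norm_power power_int_add power_int_power)
      then have "1 + 2 * n = 0" using norm_powi_inject[OF Q refl] by blast
      then show False by presburger
    qed
    then have "((\<lambda>D. q ^ (D * (D + 1)) / (q_poch (z * Q) q (D + 1) * q_poch (q / (z * Q)) q (D + 1)))
       has_sum (appell3 q (z * Q) 1 * inverse (q_poch_inf q q))) UNIV"
      using q z0 Q by (intro eulerian_eq_appell) auto
    from has_sum_cmult_right[OF this, of Q]
    have "((\<lambda>D. Q ^ (2 * D\<^sup>2 + 2 * D + 1) / (q_poch (z * Q) (Q\<^sup>2) (D + 1) * q_poch (Q / z) (Q\<^sup>2) (D + 1)))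
       has_sum (Q * (appell3 q (z * Q) 1 * inverse (q_poch_inf q q)))) UNIV"
    proof -
      have a: "q / (z * Q) = Q / z" using Q by (simp add: q_def power2_eq_square)
      have b: "Q * q ^ (D * (D + 1)) = Q ^ (2 * D\<^sup>2 + 2 * D + 1)" for D
      proof -
        have "2 * D\<^sup>2 + 2 * D + 1 = Suc (2 * (D * (D + 1)))" by (simp add: power2_eq_square algebra_simps)
        then show ?thesis by (simp only: power_Suc power_mult q_def)
      qed
      have "Q * (q ^ (D * (D + 1)) / (q_poch (z * Q) q (D + 1) * q_poch (q / (z * Q)) q (D + 1)))
        = Q ^ (2 * D\<^sup>2 + 2 * D + 1) / (q_poch (z * Q) (Q\<^sup>2) (D + 1) * q_poch (Q / z) (Q\<^sup>2) (D + 1))" for D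
        unfolding a b[symmetric] q_def[symmetric] by simp
      then show ?thesis using \<open>((\<lambda>D. Q * _ D) has_sum _) UNIV\<close> by (simp only:)
    qed
    also have "Q * (appell3 q (z * Q) 1 * inverse (q_poch_inf q q)) = Q * \<alpha> (Q ^ 8) + Q ^ 3 * \<beta> (Q ^ 8) + Q\<^sup>2 * \<gamma> (Q ^ 8) + Q ^ 8 * \<delta> (Q ^ 8)"
    proof -
      have "appell3 q (z * Q) 1 = appell_part 0 q + Q * ((z - z ^ 3) * appell_part 1 q)"
        using appell3_eq_parts[OF Q z(2)] by (simp add: q_def mult_ac)
      also have "\<dots> = q_poch_inf q q * (\<alpha> t + q * \<beta> t + Q * (\<gamma> t + q ^ 3 * \<delta> t))"
        unfolding f0 f1 by (simp add: algebra_simps)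
      finally have "Q * (appell3 q (z * Q) 1 * inverse (q_poch_inf q q)) = Q * (\<alpha> t + q * \<beta> t + Q * (\<gamma> t + q ^ 3 * \<delta> t))"
        using pz by simp
      also have "\<dots> = Q * \<alpha> t + Q ^ 3 * \<beta> t + Q\<^sup>2 * \<gamma> t + Q ^ 8 * \<delta> t"
        by (simp add: q_def algebra_simps eval_nat_numeral)
      finally show ?thesis by (simp only: t_def)
    qed
    finally show "((\<lambda>D. Q ^ (2 * D\<^sup>2 + 2 * D + 1) / (q_poch (z * Q) (Q\<^sup>2) (D + 1) * q_poch (Q / z) (Q\<^sup>2) (D + 1)))
       has_sum (Q * \<alpha> (Q ^ 8) + Q ^ 3 * \<beta> (Q ^ 8) + Q\<^sup>2 * \<gamma> (Q ^ 8) + Q ^ 8 * \<delta> (Q ^ 8))) UNIV" .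
  qed
qed

section \<open>Extraction of coefficients in a residue class modulo 8\<close>

lemma power_series_zero:
  fixes a :: "nat \<Rightarrow> complex"
  assumes "\<And>Q. norm Q < 1 \<Longrightarrow> Q \<noteq> 0 \<Longrightarrow> (\<lambda>n. a n * Q ^ n) sums 0"
  shows "a n = 0"
  using assms
proof (induction n arbitrary: a)
  case 0
  have "((\<lambda>_::complex. 0) \<longlongrightarrow> a 0) (at 0)"
    by (rule powser_limit_0_strong[where s = 1 and a = a and f = "\<lambda>_. 0"]) (use 0 in auto)
  then show ?case by (simp add: tendsto_const_iff)
next
  case (Suc n)
  have a0: "a 0 = 0"
  proof -
    have "((\<lambda>_::complex. 0) \<longlongrightarrow> a 0) (at 0)"
      by (rule powser_limit_0_strong[where s = 1 and a = a and f = "\<lambda>_. 0"]) (use Suc.prems in auto)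
    then show ?thesis by (simp add: tendsto_const_iff)
  qed
  have "(\<lambda>n. a (Suc n) * Q ^ n) sums 0" if Q: "norm Q < 1" "Q \<noteq> 0" for Q
  proof -
    have "(\<lambda>n. a (Suc n) * Q ^ Suc n) sums 0"
      using Suc.prems[OF Q] a0 by (subst sums_Suc_iff) simp
    from sums_mult[OF this, of "inverse Q"] show ?thesis
      using Q by (simp add: field_simps)
  qed
  then show ?case using Suc.IH[of "\<lambda>n. a (Suc n)"] by blast
qed

text \<open>The fourth power of \<open>z ^ m\<close> is \<open>(- 1) ^ m\<close>, which forces
  \<open>m\<close> to be even; the residues 2, 4, 6 are excluded one by one.\<close>

lemma power_eq_one_of_power4:
  fixes z :: complex
  assumes z: "z ^ 4 = - 1" and m: "z ^ m = 1"
  shows "8 dvd m"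
proof -
  have z8: "z ^ 8 = 1" using z power_mult[of z 4 2] by simp
  have "z ^ m = z ^ (8 * (m div 8) + m mod 8)" by simp
  also have "\<dots> = z ^ (m mod 8)" unfolding power_add power_mult z8 by simp
  finally have r: "z ^ (m mod 8) = 1" using m by simp
  have "(z ^ (m mod 8)) ^ 4 = (- 1) ^ (m mod 8)" unfolding z[symmetric] by (simp add: power_mult[symmetric] mult.commute)
  with r have "even (m mod 8)" by (cases "even (m mod 8)") auto
  moreover have "m mod 8 < 8" by simp
  ultimately have "m mod 8 = 0 \<or> m mod 8 = 2 \<or> m mod 8 = 4 \<or> m mod 8 = 6" by presburger
  moreover have "z\<^sup>2 \<noteq> 1" "z ^ 6 \<noteq> 1" "z ^ 4 \<noteq> 1"
  proof -
    have "z ^ 6 = z ^ 4 * z\<^sup>2" by (simp flip: power_add)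
    then have z22: "z\<^sup>2 * z\<^sup>2 = - 1" "z ^ 6 = - (z\<^sup>2)"
      using z by (simp_all flip: power_add)
    show "z\<^sup>2 \<noteq> 1"
    proof
      assume h: "z\<^sup>2 = 1"
      show False using z22(1) unfolding h by simp
    qed
    show "z ^ 6 \<noteq> 1"
    proof
      assume "z ^ 6 = 1"
      then have h: "z\<^sup>2 = - 1" using z22(2) by (simp add: minus_equation_iff)
      show False using z22(1) unfolding h by simp
    qed
    show "z ^ 4 \<noteq> 1" using z by simp
  qed
  ultimately show ?thesis using r by auto
qed

lemma sum_roots_of_unity:
  fixes z :: complex
  assumes z: "z ^ 4 = - 1"
  shows "(\<Sum>k<8. z ^ (k * m)) = (if 8 dvd m then 8 else 0)"
proof (cases "8 dvd m")
  case True
  have z8: "z ^ 8 = 1" using z power_mult[of z 4 2] by simp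
  from True obtain l where "m = 8 * l" by auto
  then have "z ^ (k * m) = (z ^ 8) ^ (k * l)" for k unfolding power_mult[symmetric] by (simp add: mult_ac)
  then have "z ^ (k * m) = 1" for k using z8 by simp
  then show ?thesis using True by simp
next
  case False
  have z8: "z ^ 8 = 1" using z power_mult[of z 4 2] by simp
  have "z ^ m \<noteq> 1" using power_eq_one_of_power4[OF z] False by blast
  then have "(\<Sum>k<8. (z ^ m) ^ k) = (1 - (z ^ m) ^ 8) / (1 - z ^ m)" by (simp add: sum_gp_strict)
  also have "(z ^ m) ^ 8 = 1" using z8 by (metis power_mult mult.commute power_one)
  finally show ?thesis using False by (simp add: power_mult[symmetric] mult.commute)
qed

lemma has_sum_finite_sum:
  fixes f :: "'k \<Rightarrow> 'a \<Rightarrow> complex"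
  assumes "finite K" "\<And>k. k \<in> K \<Longrightarrow> (f k has_sum s k) A"
  shows "((\<lambda>x. \<Sum>k\<in>K. f k x) has_sum (\<Sum>k\<in>K. s k)) A"
  using assms by (induction K rule: finite_induct) (auto intro!: has_sum_add)

text \<open>Averaging the identity over \<open>z ^ k * Q\<close> with weights
  \<open>z ^ (k * s)\<close> keeps exactly the coefficients in the class of \<open>n\<close> and
  annihilates all four terms on the right, so the surviving power series is zero.\<close>

theorem rank_weight_vanishes:
  assumes z: "norm z = 1" "z ^ 4 = - 1" and n: "n mod 8 \<in> {4, 5, 6, 7}"
  shows "rank_weight z n = 0"
proof -
  obtain \<alpha> \<beta> \<gamma> \<delta> where C: "\<forall>Q. norm Q < 1 \<longrightarrow> Q \<noteq> 0 \<longrightarrow>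
    ((\<lambda>n. rank_weight z n * Q ^ n) has_sum
      (Q * \<alpha> (Q ^ 8) + Q ^ 3 * \<beta> (Q ^ 8) + Q\<^sup>2 * \<gamma> (Q ^ 8) + Q ^ 8 * \<delta> (Q ^ 8))) UNIV"
    using rank_weight_dissection[OF z] by (elim exE)
  define r where "r = n mod 8"
  \<comment> \<open>Chosen so that \<open>8 dvd m + s\<close> selects the indices \<open>m\<close>
    congruent to \<open>r\<close>.\<close>
  define s where "s = 8 - r"
  have r: "r \<in> {4, 5, 6, 7}" using n by (simp add: r_def)
  have z8: "z ^ 8 = 1" using z power_mult[of z 4 2] by simp
  have "(\<lambda>m. (if 8 dvd m + s then 8 * rank_weight z m else 0) * Q ^ m) sums 0" if Q: "norm Q < 1" "Q \<noteq> 0" for Q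
  proof (rule has_sum_imp_sums)
    let ?t = "Q ^ 8"
    have "((\<lambda>m. rank_weight z m * (z ^ k * Q) ^ m) has_sum
      (z ^ k * Q * \<alpha> ?t + (z ^ k * Q) ^ 3 * \<beta> ?t + (z ^ k * Q)\<^sup>2 * \<gamma> ?t + (z ^ k * Q) ^ 8 * \<delta> ?t)) UNIV" for k
    proof -
      have "(z ^ k * Q) ^ 8 = ?t"
        using z8 by (simp add: power_mult_distrib power_mult[symmetric] mult.commute[of k]) (simp add: power_mult)
      moreover have "norm (z ^ k * Q) < 1" "z ^ k * Q \<noteq> 0" using z Q by (auto simp: norm_mult norm_power)
      ultimately show ?thesis using C[THEN spec, of "z ^ k * Q"] by simp
    qed
    from has_sum_cmult_right[OF this]
    have "((\<lambda>m. z ^ (k * s) * (rank_weight z m * (z ^ k * Q) ^ m)) has_sum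
      (z ^ (k * s) * (z ^ k * Q * \<alpha> ?t + (z ^ k * Q) ^ 3 * \<beta> ?t + (z ^ k * Q)\<^sup>2 * \<gamma> ?t + (z ^ k * Q) ^ 8 * \<delta> ?t))) UNIV" for k .
    then have "((\<lambda>m. \<Sum>k<8. z ^ (k * s) * (rank_weight z m * (z ^ k * Q) ^ m)) has_sum
      (\<Sum>k<8. z ^ (k * s) * (z ^ k * Q * \<alpha> ?t + (z ^ k * Q) ^ 3 * \<beta> ?t + (z ^ k * Q)\<^sup>2 * \<gamma> ?t + (z ^ k * Q) ^ 8 * \<delta> ?t))) UNIV"
      by (intro has_sum_finite_sum) auto
    moreover have "(\<Sum>k<8. z ^ (k * s) * (rank_weight z m * (z ^ k * Q) ^ m)) = (if 8 dvd m + s then 8 * rank_weight z m else 0) * Q ^ m" for m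
    proof -
      have "(\<Sum>k<8. z ^ (k * s) * (rank_weight z m * (z ^ k * Q) ^ m)) = (\<Sum>k<8. z ^ (k * (m + s))) * (rank_weight z m * Q ^ m)"
        unfolding sum_distrib_right by (intro sum.cong refl) (simp add: power_mult_distrib power_add power_mult[symmetric] distrib_left mult_ac)
      then show ?thesis unfolding sum_roots_of_unity[OF z(2)] by simp
    qed
    moreover have "(\<Sum>k<8. z ^ (k * s) * (z ^ k * Q * \<alpha> ?t + (z ^ k * Q) ^ 3 * \<beta> ?t + (z ^ k * Q)\<^sup>2 * \<gamma> ?t + (z ^ k * Q) ^ 8 * \<delta> ?t)) = 0"
    proof -
      have "(\<Sum>k<8. z ^ (k * s) * (z ^ k * Q * \<alpha> ?t + (z ^ k * Q) ^ 3 * \<beta> ?t + (z ^ k * Q)\<^sup>2 * \<gamma> ?t + (z ^ k * Q) ^ 8 * \<delta> ?t))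
        = (\<Sum>k<8. z ^ (k * (s + 1))) * (Q * \<alpha> ?t) + (\<Sum>k<8. z ^ (k * (s + 3))) * (Q ^ 3 * \<beta> ?t)
          + (\<Sum>k<8. z ^ (k * (s + 2))) * (Q\<^sup>2 * \<gamma> ?t) + (\<Sum>k<8. z ^ (k * (s + 8))) * (Q ^ 8 * \<delta> ?t)"
        unfolding sum_distrib_right sum.distrib[symmetric]
        by (intro sum.cong refl) (simp add: power_mult_distrib power_add power_mult[symmetric] distrib_left mult_2_right mult_ac)
      also have "\<dots> = 0"
      proof -
        \<comment> \<open>The range 4 to 7 of \<open>r\<close> is exactly what keeps
          \<open>s\<close> plus each of 1, 2, 3, 8 away from the multiples of 8.\<close>
        have "1 \<le> s" "s \<le> 4" using r by (auto simp: s_def)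
        then have "\<not> 8 dvd s + 1" "\<not> 8 dvd s + 2" "\<not> 8 dvd s + 3" "\<not> 8 dvd s + 8" by presburger+
        then show ?thesis unfolding sum_roots_of_unity[OF z(2)] by simp
      qed
      finally show ?thesis .
    qed
    ultimately show "((\<lambda>m. (if 8 dvd m + s then 8 * rank_weight z m else 0) * Q ^ m) has_sum 0) UNIV"
      by (simp only:)
  qed
  then have "(if 8 dvd n + s then 8 * rank_weight z n else 0) = 0"
    by (rule power_series_zero)
  moreover have "8 dvd n + s" unfolding s_def r_def by presburger
  ultimately show ?thesis by simp
qed

section \<open>From vanishing weights to equal counts\<close>

lemma even_sum_list_odd:
  fixes xs :: "nat list"
  assumes "\<forall>x\<in>set xs. odd x"
  shows "even (sum_list xs) \<longleftrightarrow> even (length xs)"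
  using assms by (induction xs) auto

lemma odd_rank_parity:
  assumes "\<sigma> \<in> odd_durfee_symbols n"
  shows "even (odd_rank \<sigma>) \<longleftrightarrow> odd n"
proof -
  obtain D as bs where s: "\<sigma> = (D, as, bs)" by (cases \<sigma>) auto
  have "odd_durfee_row D as" "odd_durfee_row D bs" "n = sum_list as + sum_list bs + 2 * D\<^sup>2 + 2 * D + 1"
    using assms by (auto simp: s odd_durfee_symbols_def)
  then show ?thesis
    using even_sum_list_odd[of as] even_sum_list_odd[of bs] by (auto simp: s odd_durfee_row_def)
qed

lemma Re_i_powi: "Re (\<i> powi f) = (if f mod 4 = 0 then 1 else if f mod 4 = 2 then - 1 else 0)"
proof -
  have "\<i> powi f = \<i> powi (4 * (f div 4) + f mod 4)" by simp
  also have "\<dots> = \<i> powi (f mod 4)"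
    by (subst power_int_add) (auto simp: power_int_mult)
  finally have e: "\<i> powi f = \<i> powi (f mod 4)" .
  have "f mod 4 \<in> {0, 1, 2, 3}" using pos_mod_bound[of 4 f] pos_mod_sign[of 4 f] by auto
  then show ?thesis unfolding e by (auto simp: power3_eq_cube)
qed

text \<open>After multiplication by \<open>z powi (- a)\<close>, a symbol with
  \<open>odd_rank \<sigma> - a = 2 * f\<close> has weight \<open>\<i> powi f\<close>. Its real part
  is 1 or -1 on the two classes to be compared and 0 for odd \<open>f\<close>.\<close>

lemma N0_eq_of_parity:
  assumes n: "n mod 8 \<in> {4, 5, 6, 7}"
    and a: "\<And>\<sigma>. \<sigma> \<in> odd_durfee_symbols n \<Longrightarrow> even (odd_rank \<sigma> - a)"
  shows "N0 a 8 n = N0 (a + 4) 8 n"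
proof -
  define z where "z = cis (pi / 4)"
  have z2: "z\<^sup>2 = \<i>" using Complex.DeMoivre[of "pi / 4" 2] by (simp add: z_def)
  have z4: "z ^ 4 = - 1" using power_mult[of z 2 2] z2 by simp
  have z0: "z \<noteq> 0" by (simp add: z_def)
  let ?S = "odd_durfee_symbols n"
  have "rank_weight z n = 0"
    by (rule rank_weight_vanishes[OF _ z4 n]) (simp add: z_def)
  then have "0 = Re (z powi (- a) * rank_weight z n)" by simp
  also have "z powi (- a) * rank_weight z n = (\<Sum>\<sigma>\<in>?S. z powi (odd_rank \<sigma> - a))"
    unfolding rank_weight_def sum_distrib_left using z0
    by (intro sum.cong refl) (simp add: add.commute[of "- a"] flip: power_int_add)
  also have "Re \<dots> = (\<Sum>\<sigma>\<in>?S. (if [odd_rank \<sigma> = a] (mod 8) then 1 else 0) - (if [odd_rank \<sigma> = a + 4] (mod 8) then 1 else 0))"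
    unfolding Re_sum
  proof (intro sum.cong refl)
    fix \<sigma> assume s: "\<sigma> \<in> ?S"
    define f where "f = (odd_rank \<sigma> - a) div 2"
    have f: "odd_rank \<sigma> = 2 * f + a" using a[OF s] by (simp add: f_def)
    have "Re (z powi (odd_rank \<sigma> - a)) = Re (\<i> powi f)"
      unfolding f using z2 by (simp add: power_int_mult)
    moreover have "[odd_rank \<sigma> = a] (mod 8) \<longleftrightarrow> 8 dvd 2 * f" "[odd_rank \<sigma> = a + 4] (mod 8) \<longleftrightarrow> 8 dvd 2 * f - 4"
      by (simp_all add: f cong_iff_dvd_diff)
    moreover have "8 dvd 2 * f \<longleftrightarrow> f mod 4 = 0" "8 dvd 2 * f - 4 \<longleftrightarrow> f mod 4 = 2" by presburger+
    ultimately show "Re (z powi (odd_rank \<sigma> - a)) = (if [odd_rank \<sigma> = a] (mod 8) then 1 else 0) - (if [odd_rank \<sigma> = a + 4] (mod 8) then 1 else 0)"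
      unfolding Re_i_powi by auto
  qed
  also have "\<dots> = real (N0 a 8 n) - real (N0 (a + 4) 8 n)"
  proof -
    have "(\<Sum>\<sigma>\<in>?S. if [odd_rank \<sigma> = b] (mod 8) then 1 else 0 :: real) = real (N0 b 8 n)" for b
      unfolding N0_def using finite_odd_durfee_symbols[of n]
      by (subst sum.inter_filter[symmetric]) auto
    then show ?thesis by (simp only: sum_subtractf)
  qed
  finally show ?thesis by simp
qed

lemma N0_uminus: "N0 (- a) M n = N0 a M n"
  unfolding N0_def
proof (rule bij_betw_same_card)
  show "bij_betw (\<lambda>(D, as, bs). (D, bs, as)) {\<sigma> \<in> odd_durfee_symbols n. [odd_rank \<sigma> = - a] (mod int M)}
      {\<sigma> \<in> odd_durfee_symbols n. [odd_rank \<sigma> = a] (mod int M)}"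
  proof (rule bij_betw_byWitness[where f' = "\<lambda>(D, as, bs). (D, bs, as)"])
    have "[x - y = - b] (mod int M) \<longleftrightarrow> [y - x = b] (mod int M)" for x y b
      using cong_minus_minus_iff[of "x - y" "- b" "int M"] by simp
    then show "(\<lambda>(D, as, bs). (D, bs, as)) ` {\<sigma> \<in> odd_durfee_symbols n. [odd_rank \<sigma> = - a] (mod int M)}
        \<subseteq> {\<sigma> \<in> odd_durfee_symbols n. [odd_rank \<sigma> = a] (mod int M)}"
      "(\<lambda>(D, as, bs). (D, bs, as)) ` {\<sigma> \<in> odd_durfee_symbols n. [odd_rank \<sigma> = a] (mod int M)}
        \<subseteq> {\<sigma> \<in> odd_durfee_symbols n. [odd_rank \<sigma> = - a] (mod int M)}"
      by (auto simp: odd_durfee_symbols_def)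
  qed auto
qed

lemma N0_cong: "[a = b] (mod int M) \<Longrightarrow> N0 a M n = N0 b M n"
  unfolding N0_def by (auto intro!: arg_cong[where f = card] intro: cong_trans cong_sym)

theorem theorem1p8:
  fixes n :: nat
  shows "(\<forall>r\<in>{5, 7}. N0 0 8 (8 * n + r) = N0 4 8 (8 * n + r)) \<and>
         (\<forall>r\<in>{4, 6}. N0 1 8 (8 * n + r) = N0 3 8 (8 * n + r))"
proof (intro conjI ballI)
  fix r :: nat assume r: "r \<in> {5, 7}"
  have "N0 0 8 (8 * n + r) = N0 (0 + 4) 8 (8 * n + r)"
    by (rule N0_eq_of_parity) (use r in \<open>auto simp: odd_rank_parity\<close>)
  then show "N0 0 8 (8 * n + r) = N0 4 8 (8 * n + r)" by simp
next
  fix r :: nat assume r: "r \<in> {4, 6}"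
  have "N0 1 8 (8 * n + r) = N0 (1 + 4) 8 (8 * n + r)"
    by (rule N0_eq_of_parity) (use r in \<open>auto simp: odd_rank_parity\<close>)
  \<comment> \<open>The classes 5 and -3 agree modulo 8, and exchanging the rows leads from -3 to
    3.\<close>
  also have "\<dots> = N0 (- 3) 8 (8 * n + r)"
    by (rule N0_cong) (simp add: Cong.cong_def)
  also have "\<dots> = N0 3 8 (8 * n + r)" by (rule N0_uminus)
  finally show "N0 1 8 (8 * n + r) = N0 3 8 (8 * n + r)" .
qed

end
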